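(* A category is equivalent to the category $\mathbf{PAsm}(\mathcal{A},\cdot)$ of partitioned assemblies over some partial combinatory algebra $(\mathcal{A},\cdot)$ if and only if it is weakly locally cartesian closed and local, and has a separated discrete generic object (i.e. an object that is simultaneously separated, discrete and generic).
   Context: **Partial terms.** For partially defined terms, $t\downarrow$ means that $t$ is defined, and $s\preceq t$ means: if $s$ is defined then $t$ is defined and $s=t$. **PCAs.** A partial applicative structure is a set $\mathcal{A}$ with a partial binary operation $(-\cdot-):\mathcal{A}\times\mathcal{A}\rightharpoonup\mathcal{A}$ (application, associating to the left). A polynomial over $\mathcal{A}$ is a term $t[x_1,\dots,x_n]$ built from variables $x_1,\dots,x_n$, constants in $\mathcal{A}$, and application. A partial combinatory algebra (PCA) is a partial applicative structure such that for every polynomial $t[x_1,\dots,x_{n+1}]$ there is an $e\in\mathcal{A}$ with $e\cdot a_1\cdot\ldots\cdot a_n\downarrow$ and $t[a_1,\dots,a_{n+1}]\preceq e\cdot a_1\cdot\ldots\cdot a_{n+1}$ for all $a_1,\dots,a_{n+1}\in\mathcal{A}$. **Partitioned assemblies.** $\mathbf{PAsm}(\mathcal{A},\cdot)$ has as objects pairs $(I,\varphi)$ with $I$ a set and $\varphi:I\to\mathcal{A}$ a function; a morphism $(I,\varphi)\to(J,\psi)$ is a function $f:I\to J$ for which there is an $e\in\mathcal{A}$ such that $e\cdot\varphi(i)$ is defined and equal to $\psi(f(i))$ for all $i\in I$. **Local categories.** A local category is a locally small category $\mathbb{C}$ with finite limits whose global sections functor $\Gamma=\mathbb{C}(1,-):\mathbb{C}\to\mathbf{Set}$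 has a right adjoint $\nabla$; the unit is denoted $\eta:\mathrm{id}\to\nabla\Gamma$. An arrow $f:B\to A$ in $\mathbb{C}$ is closed if the naturality square of $\eta$ at $f$ (with sides $f$, $\eta_B$, $\eta_A$, $\nabla\Gamma f$) is a pullback. An object $G$ is separated if $\eta_G:G\to\nabla\Gamma G$ is monic. It is generic if for every $C\in\mathbb{C}$ there is a closed $f:C\to G$. It is discrete if for any span $C\xleftarrow{e}D\xrightarrow{f}G$ with $e$ closed and $\Gamma e$ surjective there is a unique $g:C\to G$ with $ge=f$. **Weak local cartesian closure.** A finite-limit category $\mathbb{C}$ is weakly locally cartesian closed if for all arrows $b:B\to J$ and $u:J\to I$ the presheaf $(\mathbb{C}/J)(u^*-,b):(\mathbb{C}/I)^{\mathrm{op}}\to\mathbf{Set}$ is weakly representable, i.e. admits a (pointwise surjective) cover by a representable presheaf. *)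

theory Defs
  imports Main "HOL-Library.FuncSet" "HOL-Library.Equipollence"
begin

section \<open>Universes of small sets\<close>

text \<open>
  The type \<open>'u\<close> plays the role of the class of all sets, and the members of \<open>U\<close> are those of
  its subclasses that are sets (``small''). If \<open>'u\<close> is a model of ZFC, or the underlying set of a
  Grothendieck universe, then its small subsets satisfy the conditions below; the category
  \<open>set_cat U\<close> defined below is then the usual category of sets. Infinity is not required, so that
  the finite sets of natural numbers are an instance too.
\<close>

definition universe :: "'u set set \<Rightarrow> bool" where
  "universe U \<longleftrightarrow>
     U \<noteq> {} \<and>
     (\<forall>X\<in>U. \<forall>Y. Y \<subseteq> X \<longrightarrow> Y \<in> U) \<and>
     (\<forall>X\<in>U. \<forall>f :: 'u \<Rightarrow> 'u. f ` X \<in> U) \<and>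
     (\<forall>X\<in>U. \<forall>F. (\<forall>x\<in>X. F x \<in> U) \<longrightarrow> (\<Union>x\<in>X. F x) \<in> U) \<and>
     (\<forall>X\<in>U. \<exists>Y\<in>U. Pow X \<lesssim> Y)"

lemma universe_finite_nat_sets: "universe {X :: nat set. finite X}"
proof -
  have "\<exists>Y\<in>{X :: nat set. finite X}. Pow X \<lesssim> Y" if "finite X" for X :: "nat set"
  proof
    show "{..<card (Pow X)} \<in> {X :: nat set. finite X}" by simp
    have "Pow X \<approx> {..<card (Pow X)}"
      using that eqpoll_iff_card[of "Pow X" "{..<card (Pow X)}"] by simp
    then show "Pow X \<lesssim> {..<card (Pow X)}" by (rule eqpoll_imp_lepoll)
  qed
  then show ?thesis unfolding universe_def by (auto intro: finite_subset)
qed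


section \<open>Categories, functors, natural transformations\<close>

text \<open>
  \<open>Comp C X Y Z g f\<close> is the composite of \<open>f : X \<rightarrow> Y\<close> and \<open>g : Y \<rightarrow> Z\<close>. Hom-sets need not be
  disjoint, which is why composition and the arrow part of a functor take the objects as arguments.
\<close>

record ('o, 'm) cat =
  Obj :: "'o set"
  Hom :: "'o \<Rightarrow> 'o \<Rightarrow> 'm set"
  Comp :: "'o \<Rightarrow> 'o \<Rightarrow> 'o \<Rightarrow> 'm \<Rightarrow> 'm \<Rightarrow> 'm"
  Ide :: "'o \<Rightarrow> 'm"

locale category =
  fixes C :: "('o, 'm) cat"
  assumes Ide_Hom: "X \<in> Obj C \<Longrightarrow> Ide C X \<in> Hom C X X"
    and Comp_Hom: "\<lbrakk>X \<in> Obj C; Y \<in> Obj C; Z \<in> Obj C; f \<in> Hom C X Y; g \<in> Hom C Y Z\<rbrakk>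
      \<Longrightarrow> Comp C X Y Z g f \<in> Hom C X Z"
    and Comp_Ide_left: "\<lbrakk>X \<in> Obj C; Y \<in> Obj C; f \<in> Hom C X Y\<rbrakk>
      \<Longrightarrow> Comp C X Y Y (Ide C Y) f = f"
    and Comp_Ide_right: "\<lbrakk>X \<in> Obj C; Y \<in> Obj C; f \<in> Hom C X Y\<rbrakk>
      \<Longrightarrow> Comp C X X Y f (Ide C X) = f"
    and Comp_assoc: "\<lbrakk>W \<in> Obj C; X \<in> Obj C; Y \<in> Obj C; Z \<in> Obj C;
        f \<in> Hom C W X; g \<in> Hom C X Y; h \<in> Hom C Y Z\<rbrakk>
      \<Longrightarrow> Comp C W Y Z h (Comp C W X Y g f) = Comp C W X Z (Comp C X Y Z h g) f"

definition op_cat :: "('o, 'm) cat \<Rightarrow> ('o, 'm) cat" where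
  "op_cat C = \<lparr>Obj = Obj C,
     Hom = (\<lambda>X Y. Hom C Y X),
     Comp = (\<lambda>X Y Z g f. Comp C Z Y X f g),
     Ide = Ide C\<rparr>"

definition set_cat :: "'a set set \<Rightarrow> ('a set, 'a \<Rightarrow> 'a) cat" where
  "set_cat U = \<lparr>Obj = U,
     Hom = (\<lambda>X Y. X \<rightarrow>\<^sub>E Y),
     Comp = (\<lambda>X Y Z g f. compose X g f),
     Ide = (\<lambda>X. \<lambda>x\<in>X. x)\<rparr>"

record ('o1, 'm1, 'o2, 'm2) fun_data =
  FObj :: "'o1 \<Rightarrow> 'o2"
  FMap :: "'o1 \<Rightarrow> 'o1 \<Rightarrow> 'm1 \<Rightarrow> 'm2"

definition is_functor ::
  "('o1, 'm1) cat \<Rightarrow> ('o2, 'm2) cat \<Rightarrow> ('o1, 'm1, 'o2, 'm2) fun_data \<Rightarrow> bool" where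
  "is_functor C D F \<longleftrightarrow>
     (\<forall>X\<in>Obj C. FObj F X \<in> Obj D) \<and>
     (\<forall>X\<in>Obj C. \<forall>Y\<in>Obj C. \<forall>f\<in>Hom C X Y. FMap F X Y f \<in> Hom D (FObj F X) (FObj F Y)) \<and>
     (\<forall>X\<in>Obj C. FMap F X X (Ide C X) = Ide D (FObj F X)) \<and>
     (\<forall>X\<in>Obj C. \<forall>Y\<in>Obj C. \<forall>Z\<in>Obj C. \<forall>f\<in>Hom C X Y. \<forall>g\<in>Hom C Y Z.
        FMap F X Z (Comp C X Y Z g f)
        = Comp D (FObj F X) (FObj F Y) (FObj F Z) (FMap F Y Z g) (FMap F X Y f))"

definition id_functor :: "('o, 'm, 'o, 'm) fun_data" where
  "id_functor = \<lparr>FObj = (\<lambda>X. X), FMap = (\<lambda>X Y f. f)\<rparr>"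

definition comp_functor ::
  "('o2, 'm2, 'o3, 'm3) fun_data \<Rightarrow> ('o1, 'm1, 'o2, 'm2) fun_data \<Rightarrow> ('o1, 'm1, 'o3, 'm3) fun_data"
  where
  "comp_functor G F = \<lparr>FObj = (\<lambda>X. FObj G (FObj F X)),
     FMap = (\<lambda>X Y f. FMap G (FObj F X) (FObj F Y) (FMap F X Y f))\<rparr>"

definition op_functor :: "('o1, 'm1, 'o2, 'm2) fun_data \<Rightarrow> ('o1, 'm1, 'o2, 'm2) fun_data" where
  "op_functor F = \<lparr>FObj = FObj F, FMap = (\<lambda>X Y f. FMap F Y X f)\<rparr>"

definition natural_transformation ::
  "('o1, 'm1) cat \<Rightarrow> ('o2, 'm2) cat \<Rightarrow> ('o1, 'm1, 'o2, 'm2) fun_data \<Rightarrow> ('o1, 'm1, 'o2, 'm2) fun_data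
    \<Rightarrow> ('o1 \<Rightarrow> 'm2) \<Rightarrow> bool" where
  "natural_transformation C D F G \<alpha> \<longleftrightarrow>
     (\<forall>X\<in>Obj C. \<alpha> X \<in> Hom D (FObj F X) (FObj G X)) \<and>
     (\<forall>X\<in>Obj C. \<forall>Y\<in>Obj C. \<forall>f\<in>Hom C X Y.
        Comp D (FObj F X) (FObj F Y) (FObj G Y) (\<alpha> Y) (FMap F X Y f)
        = Comp D (FObj F X) (FObj G X) (FObj G Y) (FMap G X Y f) (\<alpha> X))"

definition is_iso :: "('o, 'm) cat \<Rightarrow> 'o \<Rightarrow> 'o \<Rightarrow> 'm \<Rightarrow> bool" where
  "is_iso C X Y f \<longleftrightarrow> f \<in> Hom C X Y \<and>
     (\<exists>g\<in>Hom C Y X. Comp C X Y X g f = Ide C X \<and> Comp C Y X Y f g = Ide C Y)"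

definition natural_isomorphism ::
  "('o1, 'm1) cat \<Rightarrow> ('o2, 'm2) cat \<Rightarrow> ('o1, 'm1, 'o2, 'm2) fun_data \<Rightarrow> ('o1, 'm1, 'o2, 'm2) fun_data
    \<Rightarrow> ('o1 \<Rightarrow> 'm2) \<Rightarrow> bool" where
  "natural_isomorphism C D F G \<alpha> \<longleftrightarrow> natural_transformation C D F G \<alpha> \<and>
     (\<forall>X\<in>Obj C. is_iso D (FObj F X) (FObj G X) (\<alpha> X))"

definition equivalent_categories :: "('o1, 'm1) cat \<Rightarrow> ('o2, 'm2) cat \<Rightarrow> bool" where
  "equivalent_categories C D \<longleftrightarrow> category C \<and> category D \<and>
     (\<exists>F G \<alpha> \<beta>. is_functor C D F \<and> is_functor D C G \<and>
        natural_isomorphism C C id_functor (comp_functor G F) \<alpha> \<and>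
        natural_isomorphism D D (comp_functor F G) id_functor \<beta>)"

definition adjunction ::
  "('o1, 'm1) cat \<Rightarrow> ('o2, 'm2) cat \<Rightarrow> ('o1, 'm1, 'o2, 'm2) fun_data \<Rightarrow> ('o2, 'm2, 'o1, 'm1) fun_data
    \<Rightarrow> ('o1 \<Rightarrow> 'm1) \<Rightarrow> ('o2 \<Rightarrow> 'm2) \<Rightarrow> bool" where
  "adjunction C D F G \<eta> \<epsilon> \<longleftrightarrow>
     is_functor C D F \<and> is_functor D C G \<and>
     natural_transformation C C id_functor (comp_functor G F) \<eta> \<and>
     natural_transformation D D (comp_functor F G) id_functor \<epsilon> \<and>
     (\<forall>X\<in>Obj C. Comp D (FObj F X) (FObj F (FObj G (FObj F X))) (FObj F X)
        (\<epsilon> (FObj F X)) (FMap F X (FObj G (FObj F X)) (\<eta> X)) = Ide D (FObj F X)) \<and>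
     (\<forall>Y\<in>Obj D. Comp C (FObj G Y) (FObj G (FObj F (FObj G Y))) (FObj G Y)
        (FMap G (FObj F (FObj G Y)) Y (\<epsilon> Y)) (\<eta> (FObj G Y)) = Ide C (FObj G Y))"

text \<open>The covariant functor \<open>C(X, -)\<close>; \<open>C(-, X)\<close> is \<open>hom_functor (op_cat C) X\<close>.\<close>

definition hom_functor :: "('o, 'm) cat \<Rightarrow> 'o \<Rightarrow> ('o, 'm, 'm set, 'm \<Rightarrow> 'm) fun_data" where
  "hom_functor C X = \<lparr>FObj = (\<lambda>Y. Hom C X Y),
     FMap = (\<lambda>Y Z f. \<lambda>g\<in>Hom C X Y. Comp C X Y Z f g)\<rparr>"

definition locally_small :: "'m set set \<Rightarrow> ('o, 'm) cat \<Rightarrow> bool" where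
  "locally_small U C \<longleftrightarrow> (\<forall>X\<in>Obj C. \<forall>Y\<in>Obj C. Hom C X Y \<in> U)"


section \<open>Limits\<close>

definition is_cone ::
  "('j, 'n) cat \<Rightarrow> ('o, 'm) cat \<Rightarrow> ('j, 'n, 'o, 'm) fun_data \<Rightarrow> 'o \<Rightarrow> ('j \<Rightarrow> 'm) \<Rightarrow> bool" where
  "is_cone J C D X \<mu> \<longleftrightarrow> X \<in> Obj C \<and>
     (\<forall>j\<in>Obj J. \<mu> j \<in> Hom C X (FObj D j)) \<and>
     (\<forall>j\<in>Obj J. \<forall>k\<in>Obj J. \<forall>f\<in>Hom J j k.
        Comp C X (FObj D j) (FObj D k) (FMap D j k f) (\<mu> j) = \<mu> k)"

definition is_limit ::
  "('j, 'n) cat \<Rightarrow> ('o, 'm) cat \<Rightarrow> ('j, 'n, 'o, 'm) fun_data \<Rightarrow> 'o \<Rightarrow> ('j \<Rightarrow> 'm) \<Rightarrow> bool" where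
  "is_limit J C D L l \<longleftrightarrow> is_cone J C D L l \<and>
     (\<forall>X \<mu>. is_cone J C D X \<mu> \<longrightarrow>
        (\<exists>!h. h \<in> Hom C X L \<and> (\<forall>j\<in>Obj J. Comp C X L (FObj D j) (l j) h = \<mu> j)))"

definition finite_category :: "('o, 'm) cat \<Rightarrow> bool" where
  "finite_category J \<longleftrightarrow> category J \<and> finite (Obj J) \<and>
     (\<forall>j\<in>Obj J. \<forall>k\<in>Obj J. finite (Hom J j k))"

text \<open>Every finite category is isomorphic to one whose objects and arrows are natural numbers.\<close>

definition has_finite_limits :: "('o, 'm) cat \<Rightarrow> bool" where
  "has_finite_limits C \<longleftrightarrow>
     (\<forall>(J :: (nat, nat) cat) D. finite_category J \<and> is_functor J C D \<longrightarrow>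
        (\<exists>L l. is_limit J C D L l))"

definition is_terminal :: "('o, 'm) cat \<Rightarrow> 'o \<Rightarrow> bool" where
  "is_terminal C T \<longleftrightarrow> T \<in> Obj C \<and> (\<forall>X\<in>Obj C. \<exists>!f. f \<in> Hom C X T)"

text \<open>The square with \<open>p : P \<rightarrow> X\<close>, \<open>q : P \<rightarrow> Y\<close>, \<open>f : X \<rightarrow> Z\<close>, \<open>g : Y \<rightarrow> Z\<close>.\<close>

definition is_pullback ::
  "('o, 'm) cat \<Rightarrow> 'o \<Rightarrow> 'o \<Rightarrow> 'o \<Rightarrow> 'o \<Rightarrow> 'm \<Rightarrow> 'm \<Rightarrow> 'm \<Rightarrow> 'm \<Rightarrow> bool" where
  "is_pullback C P X Y Z p q f g \<longleftrightarrow>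
     P \<in> Obj C \<and> X \<in> Obj C \<and> Y \<in> Obj C \<and> Z \<in> Obj C \<and>
     p \<in> Hom C P X \<and> q \<in> Hom C P Y \<and> f \<in> Hom C X Z \<and> g \<in> Hom C Y Z \<and>
     Comp C P X Z f p = Comp C P Y Z g q \<and>
     (\<forall>W\<in>Obj C. \<forall>h\<in>Hom C W X. \<forall>k\<in>Hom C W Y. Comp C W X Z f h = Comp C W Y Z g k \<longrightarrow>
        (\<exists>!m. m \<in> Hom C W P \<and> Comp C W P X p m = h \<and> Comp C W P Y q m = k))"

definition is_monic :: "('o, 'm) cat \<Rightarrow> 'o \<Rightarrow> 'o \<Rightarrow> 'm \<Rightarrow> bool" where
  "is_monic C X Y f \<longleftrightarrow> f \<in> Hom C X Y \<and>
     (\<forall>W\<in>Obj C. \<forall>g\<in>Hom C W X. \<forall>h\<in>Hom C W X. Comp C W X Y f g = Comp C W X Y f h \<longrightarrow> g = h)"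


section \<open>Weak local cartesian closure\<close>

definition slice_cat :: "('o, 'm) cat \<Rightarrow> 'o \<Rightarrow> ('o \<times> 'm, 'm) cat" where
  "slice_cat C I = \<lparr>Obj = {(X, x). X \<in> Obj C \<and> x \<in> Hom C X I},
     Hom = (\<lambda>(X, x) (Y, y). {h \<in> Hom C X Y. Comp C X Y I y h = x}),
     Comp = (\<lambda>(X, x) (Y, y) (Z, z). Comp C X Y Z),
     Ide = (\<lambda>(X, x). Ide C X)\<rparr>"

text \<open>
  The chosen pullback of \<open>S = (X, x)\<close> along \<open>u : J \<rightarrow> I\<close> is a triple \<open>(P, p, q)\<close> with
  \<open>p : P \<rightarrow> J\<close> and \<open>q : P \<rightarrow> X\<close>.
\<close>

definition chosen_pullback :: "('o, 'm) cat \<Rightarrow> 'o \<Rightarrow> 'o \<Rightarrow> 'm \<Rightarrow> 'o \<times> 'm \<Rightarrow> 'o \<times> 'm \<times> 'm" where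
  "chosen_pullback C J I u S =
     (SOME (P, p, q). is_pullback C P J (fst S) I p q u (snd S))"

definition pullback_functor ::
  "('o, 'm) cat \<Rightarrow> 'o \<Rightarrow> 'o \<Rightarrow> 'm \<Rightarrow> ('o \<times> 'm, 'm, 'o \<times> 'm, 'm) fun_data" where
  "pullback_functor C J I u = \<lparr>
     FObj = (\<lambda>S. let (P, p, q) = chosen_pullback C J I u S in (P, p)),
     FMap = (\<lambda>S S' h.
       let (P, p, q) = chosen_pullback C J I u S; (P', p', q') = chosen_pullback C J I u S'
       in (THE m. m \<in> Hom C P P' \<and> Comp C P P' J p' m = p \<and>
             Comp C P P' (fst S') q' m = Comp C P (fst S) (fst S') h q))\<rparr>"

text \<open>
  Whether a presheaf is weakly representable does not depend on which universe its values are
  required to lie in, so \<open>set_cat UNIV\<close> serves as codomain.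
\<close>

definition weakly_representable ::
  "('o, 'm) cat \<Rightarrow> ('o, 'm, 'm set, 'm \<Rightarrow> 'm) fun_data \<Rightarrow> bool" where
  "weakly_representable C P \<longleftrightarrow>
     (\<exists>R\<in>Obj C. \<exists>\<alpha>.
        natural_transformation (op_cat C) (set_cat UNIV) (hom_functor (op_cat C) R) P \<alpha> \<and>
        (\<forall>X\<in>Obj C. \<alpha> X ` Hom C X R = FObj P X))"

text \<open>The presheaf \<open>(C/J)(u\<^sup>*(-), b)\<close> on \<open>C/I\<close>, for \<open>b : B \<rightarrow> J\<close> and \<open>u : J \<rightarrow> I\<close>.\<close>

definition slice_hom_presheaf ::
  "('o, 'm) cat \<Rightarrow> 'o \<Rightarrow> 'o \<Rightarrow> 'o \<Rightarrow> 'm \<Rightarrow> 'm \<Rightarrow> ('o \<times> 'm, 'm, 'm set, 'm \<Rightarrow> 'm) fun_data" where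
  "slice_hom_presheaf C B J I b u =
     comp_functor (hom_functor (op_cat (slice_cat C J)) (B, b))
       (op_functor (pullback_functor C J I u))"

definition weakly_locally_cartesian_closed :: "('o, 'm) cat \<Rightarrow> bool" where
  "weakly_locally_cartesian_closed C \<longleftrightarrow> category C \<and> has_finite_limits C \<and>
     (\<forall>B\<in>Obj C. \<forall>J\<in>Obj C. \<forall>I\<in>Obj C. \<forall>b\<in>Hom C B J. \<forall>u\<in>Hom C J I.
        weakly_representable (slice_cat C I) (slice_hom_presheaf C B J I b u))"


section \<open>Local categories\<close>

text \<open>
  \<open>T\<close> is the terminal object used to form the global sections functor \<open>\<Gamma> = C(T, -)\<close>, and
  \<open>N\<close>, \<open>\<eta>\<close>, \<open>\<epsilon>\<close> are its right adjoint with unit and counit. All of these are determined up to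
  isomorphism by \<open>C\<close>.
\<close>

definition local_category ::
  "'m set set \<Rightarrow> ('o, 'm) cat \<Rightarrow> 'o \<Rightarrow> ('m set, 'm \<Rightarrow> 'm, 'o, 'm) fun_data
    \<Rightarrow> ('o \<Rightarrow> 'm) \<Rightarrow> ('m set \<Rightarrow> 'm \<Rightarrow> 'm) \<Rightarrow> bool" where
  "local_category U C T N \<eta> \<epsilon> \<longleftrightarrow> category C \<and> locally_small U C \<and> has_finite_limits C \<and>
     is_terminal C T \<and> adjunction C (set_cat U) (hom_functor C T) N \<eta> \<epsilon>"

definition closed_arrow ::
  "('o, 'm) cat \<Rightarrow> 'o \<Rightarrow> ('m set, 'm \<Rightarrow> 'm, 'o, 'm) fun_data \<Rightarrow> ('o \<Rightarrow> 'm) \<Rightarrow> 'o \<Rightarrow> 'o \<Rightarrow> 'm \<Rightarrow> bool"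
  where
  "closed_arrow C T N \<eta> B A f \<longleftrightarrow>
     (let \<Gamma> = hom_functor C T; N\<Gamma> = comp_functor N \<Gamma>
      in is_pullback C B A (FObj N\<Gamma> B) (FObj N\<Gamma> A) f (\<eta> B) (\<eta> A) (FMap N\<Gamma> B A f))"

definition separated_object ::
  "('o, 'm) cat \<Rightarrow> 'o \<Rightarrow> ('m set, 'm \<Rightarrow> 'm, 'o, 'm) fun_data \<Rightarrow> ('o \<Rightarrow> 'm) \<Rightarrow> 'o \<Rightarrow> bool" where
  "separated_object C T N \<eta> G \<longleftrightarrow> G \<in> Obj C \<and>
     is_monic C G (FObj (comp_functor N (hom_functor C T)) G) (\<eta> G)"

definition generic_object ::
  "('o, 'm) cat \<Rightarrow> 'o \<Rightarrow> ('m set, 'm \<Rightarrow> 'm, 'o, 'm) fun_data \<Rightarrow> ('o \<Rightarrow> 'm) \<Rightarrow> 'o \<Rightarrow> bool" where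
  "generic_object C T N \<eta> G \<longleftrightarrow> G \<in> Obj C \<and>
     (\<forall>X\<in>Obj C. \<exists>f\<in>Hom C X G. closed_arrow C T N \<eta> X G f)"

definition discrete_object ::
  "('o, 'm) cat \<Rightarrow> 'o \<Rightarrow> ('m set, 'm \<Rightarrow> 'm, 'o, 'm) fun_data \<Rightarrow> ('o \<Rightarrow> 'm) \<Rightarrow> 'o \<Rightarrow> bool" where
  "discrete_object C T N \<eta> G \<longleftrightarrow> G \<in> Obj C \<and>
     (\<forall>X\<in>Obj C. \<forall>D\<in>Obj C. \<forall>e\<in>Hom C D X. \<forall>f\<in>Hom C D G.
        closed_arrow C T N \<eta> D X e \<and>
        FMap (hom_functor C T) D X e ` FObj (hom_functor C T) D = FObj (hom_functor C T) X \<longrightarrow>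
        (\<exists>!g. g \<in> Hom C X G \<and> Comp C D X G g e = f))"


section \<open>Partial combinatory algebras and partitioned assemblies\<close>

text \<open>
  A partial operation is a function into \<open>option\<close>; \<open>None\<close> means ``undefined''. In a polynomial,
  \<open>Var i\<close> stands for the variable \<open>x\<^sub>i\<^sub>+\<^sub>1\<close>, so the polynomials in \<open>n\<close> variables are those
  whose variables are \<open>Var i\<close> with \<open>i < n\<close>.
\<close>

datatype 'a polynomial = Var nat | Const 'a | App "'a polynomial" "'a polynomial"

primrec polynomial_over :: "'a set \<Rightarrow> nat \<Rightarrow> 'a polynomial \<Rightarrow> bool" where
  "polynomial_over A n (Var i) \<longleftrightarrow> i < n"
| "polynomial_over A n (Const c) \<longleftrightarrow> c \<in> A"
| "polynomial_over A n (App s t) \<longleftrightarrow> polynomial_over A n s \<and> polynomial_over A n t"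

definition papp :: "('a \<Rightarrow> 'a \<Rightarrow> 'a option) \<Rightarrow> 'a option \<Rightarrow> 'a option \<Rightarrow> 'a option" where
  "papp app s t = Option.bind s (\<lambda>a. Option.bind t (\<lambda>b. app a b))"

primrec eval_polynomial ::
  "('a \<Rightarrow> 'a \<Rightarrow> 'a option) \<Rightarrow> 'a list \<Rightarrow> 'a polynomial \<Rightarrow> 'a option" where
  "eval_polynomial app as (Var i) = Some (as ! i)"
| "eval_polynomial app as (Const c) = Some c"
| "eval_polynomial app as (App s t) = papp app (eval_polynomial app as s) (eval_polynomial app as t)"

definition app_list :: "('a \<Rightarrow> 'a \<Rightarrow> 'a option) \<Rightarrow> 'a \<Rightarrow> 'a list \<Rightarrow> 'a option" where
  "app_list app e as = foldl (\<lambda>s a. papp app s (Some a)) (Some e) as"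

definition refines :: "'a option \<Rightarrow> 'a option \<Rightarrow> bool"  (infix \<open>\<preceq>\<close> 50) where
  "s \<preceq> t \<longleftrightarrow> (\<forall>v. s = Some v \<longrightarrow> t = Some v)"

definition partial_applicative_structure :: "'a set \<Rightarrow> ('a \<Rightarrow> 'a \<Rightarrow> 'a option) \<Rightarrow> bool" where
  "partial_applicative_structure A app \<longleftrightarrow> (\<forall>a\<in>A. \<forall>b\<in>A. \<forall>c. app a b = Some c \<longrightarrow> c \<in> A)"

definition pca :: "'a set \<Rightarrow> ('a \<Rightarrow> 'a \<Rightarrow> 'a option) \<Rightarrow> bool" where
  "pca A app \<longleftrightarrow> partial_applicative_structure A app \<and>
     (\<forall>n t. polynomial_over A (Suc n) t \<longrightarrow>
        (\<exists>e\<in>A. \<forall>as. length as = n \<and> set as \<subseteq> A \<longrightarrow>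
           app_list app e as \<noteq> None \<and>
           (\<forall>a\<in>A. eval_polynomial app (as @ [a]) t \<preceq> app_list app e (as @ [a]))))"

definition PAsm ::
  "'u set set \<Rightarrow> 'u set \<Rightarrow> ('u \<Rightarrow> 'u \<Rightarrow> 'u option) \<Rightarrow> ('u set \<times> ('u \<Rightarrow> 'u), 'u \<Rightarrow> 'u) cat" where
  "PAsm U A app = \<lparr>Obj = {(I, \<phi>). I \<in> U \<and> \<phi> \<in> I \<rightarrow>\<^sub>E A},
     Hom = (\<lambda>(I, \<phi>) (J, \<psi>). {f \<in> I \<rightarrow>\<^sub>E J. \<exists>e\<in>A. \<forall>i\<in>I. app e (\<phi> i) = Some (\<psi> (f i))}),
     Comp = (\<lambda>(I, \<phi>) (J, \<psi>) (K, \<chi>) g f. compose I g f),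
     Ide = (\<lambda>(I, \<phi>). \<lambda>i\<in>I. i)\<rparr>"

end

theory Submission
  imports Defs
begin

text \<open>
  For a separated discrete generic object \<open>G\<close> put \<open>A = C(T, G)\<close>. Closed arrows are the cartesian
  arrows for \<open>\<Gamma>\<close>, so a closed arrow \<open>X \<rightarrow> G\<close> presents \<open>X\<close> as a family of elements of \<open>A\<close> indexed by
  \<open>\<Gamma> X\<close>; separatedness makes \<open>\<Gamma>\<close> faithful, and discreteness makes the functions \<open>\<Gamma> X \<rightarrow> A\<close> that
  come from arrows \<open>X \<rightarrow> G\<close> depend only on these elements. The partial functions on \<open>A\<close> obtained
  in this way contain the constants and a pairing, and a weak dependent product provides codes in
  \<open>A\<close> for all of them, which gives the application of a partial combinatory algebra. Conversely, all
  structure is computed on underlying sets; finitely many elements of the algebra, and the code of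
  a section together with the code of its base point, are combined by pairing.
\<close>

section \<open>Small sets\<close>

text \<open>Distinct points of an object may have the same code, so an arrow \<open>h\<close> from
  \<open>X\<close> to \<open>G\<close> has no evident reading as a function of codes. Discreteness
  repairs this: a closed \<open>c\<close> from \<open>X\<close> to \<open>G\<close> factors as a
  closed arrow that is onto on points, followed by the closed subobject of \<open>G\<close> carved
  out by the codes in use, and \<open>h\<close> descends along the first factor. A dependent product
  classifies total sections, whereas application has to be partial. The remedy is to index by all
  possible domains: over \<nabla> of the power set of \<open>A\<close> no realizers are imposed, so
  every assignment of domains to codes is an arrow out of \<open>G\<close>. Weak universality at
  \<open>G\<close> itself then gives an arrow from \<open>G\<close> to \<open>G\<close> that sends a
  code to a code of the curried function. Being total, this arrow supplies the definedness of
  partial applications that the axiom for polynomials demands. In the other direction one section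
  may be tracked by many elements of the algebra, each giving another element of the dependent
  product, so the classifying arrows exist but are not unique.\<close>

definition small :: "'u set set \<Rightarrow> 'x set \<Rightarrow> bool" where
  "small U S \<longleftrightarrow> (\<exists>f. inj_on f S \<and> f ` S \<in> U)"

locale set_universe =
  fixes U :: "'u set set"
  assumes universe: "universe U"
begin

lemma subset_U: "X \<in> U \<Longrightarrow> Y \<subseteq> X \<Longrightarrow> Y \<in> U"
  using universe unfolding universe_def by blast

lemma image_U: "X \<in> U \<Longrightarrow> f ` X \<in> U" for f :: "'u \<Rightarrow> 'u"
  using universe unfolding universe_def by blast

lemma UN_U: "X \<in> U \<Longrightarrow> (\<And>x. x \<in> X \<Longrightarrow> F x \<in> U) \<Longrightarrow> (\<Union>x\<in>X. F x) \<in> U" for X :: "'u set"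
  using universe unfolding universe_def by blast

lemma Pow_U: "X \<in> U \<Longrightarrow> \<exists>Y\<in>U. Pow X \<lesssim> Y"
  using universe unfolding universe_def by blast

lemma small_inj: "small U T \<Longrightarrow> inj_on f S \<Longrightarrow> f ` S \<subseteq> T \<Longrightarrow> small U S"
proof -
  assume T: "small U T" and f: "inj_on f S" "f ` S \<subseteq> T"
  obtain g where g: "inj_on g T" "g ` T \<in> U" using T unfolding small_def by blast
  have "inj_on (g \<circ> f) S" using f g(1) by (meson comp_inj_on inj_on_subset)
  moreover have "(g \<circ> f) ` S \<subseteq> g ` T" using f(2) by auto
  ultimately show ?thesis using subset_U[OF g(2)] unfolding small_def by blast
qed

lemma small_subset: "small U T \<Longrightarrow> S \<subseteq> T \<Longrightarrow> small U S"
  by (rule small_inj[where f = id]) auto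

lemma small_if_lepoll: "Y \<in> U \<Longrightarrow> S \<lesssim> Y \<Longrightarrow> small U S"
  unfolding small_def lepoll_def using subset_U by blast

lemma small_U: "X \<in> U \<Longrightarrow> small U X"
  by (rule small_if_lepoll) auto

text \<open>Replacement along the inverse of the injection brings a small set of elements of
  \<open>'u\<close> back into \<open>U\<close>. This is needed because hom-sets must be members of
  \<open>U\<close>, while their size is bounded through a set of functions.\<close>

lemma small_U_iff: "small U X \<longleftrightarrow> X \<in> U" for X :: "'u set"
proof
  assume "small U X"
  then obtain f :: "'u \<Rightarrow> 'u" where f: "inj_on f X" "f ` X \<in> U"
    unfolding small_def by (elim exE conjE)
  have "inv_into X f ` (f ` X) = X" by (rule inv_into_image_cancel[OF f(1) subset_refl])
  with image_U[OF f(2), of "inv_into X f"] show "X \<in> U" by (rule back_subst)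
next
  assume "X \<in> U"
  then show "small U X" by (rule small_U)
qed

text \<open>That \<open>U\<close> has a nonempty member comes from power sets: \<open>Pow {}\<close>
  has an element and embeds in some \<open>Y\<close> in \<open>U\<close>. A constant map then moves
  an element of \<open>Y\<close> to \<open>x\<close>.\<close>

lemma singleton_U: "{x} \<in> U"
proof -
  obtain X where "X \<in> U" using universe unfolding universe_def by auto
  then have "{} \<in> U" by (rule subset_U) simp
  from Pow_U[OF this] obtain Y where Y: "Y \<in> U" "Pow ({} :: 'u set) \<lesssim> Y" by (elim bexE)
  then obtain y where "{y} \<subseteq> Y" by fastforce
  from image_U[OF subset_U[OF Y(1) this], of "\<lambda>_. x"] show ?thesis by simp
qed

text \<open>A binary union is a union indexed by two distinct points. These come from the power set
  of a singleton, whose two members embed in a set of \<open>U\<close>.\<close>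

lemma Un_U:
  assumes "X \<in> U" "Y \<in> U"
  shows "X \<union> Y \<in> U"
proof -
  from Pow_U[OF singleton_U, of undefined] obtain Z where Z: "Z \<in> U" "Pow {undefined :: 'u} \<lesssim> Z"
    by (elim bexE)
  then obtain f where f: "inj_on f (Pow {undefined :: 'u})" "f ` Pow {undefined} \<subseteq> Z"
    unfolding lepoll_def by blast
  define a b where "a = f {}" and "b = f {undefined}"
  have "a \<noteq> b" using f unfolding a_def b_def by (auto dest: inj_onD)
  then have eq: "(\<Union>x\<in>{a, b}. if x = a then X else Y) = X \<union> Y" by auto
  have "{a, b} \<in> U" using f(2) unfolding a_def b_def by (intro subset_U[OF Z(1)]) auto
  then have "(\<Union>x\<in>{a, b}. if x = a then X else Y) \<in> U" using assms by (intro UN_U) auto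
  then show ?thesis unfolding eq .
qed

lemma finite_U: "finite X \<Longrightarrow> X \<in> U" for X :: "'u set"
proof (induction rule: finite_induct)
  case empty
  then show ?case using subset_U[OF singleton_U] by blast
next
  case (insert x F)
  then show ?case using Un_U[OF singleton_U] by (metis insert_is_Un)
qed

text \<open>Otherwise the whole type would be a member of \<open>U\<close> and its power set would
  embed in it, against Cantor. Infinitude provides injections of finite sets of other types, and of
  pairs, into \<open>'u\<close>.\<close>

lemma infinite_UNIV: "infinite (UNIV :: 'u set)"
proof
  assume "finite (UNIV :: 'u set)"
  then have "(UNIV :: 'u set) \<in> U" by (rule finite_U)
  from Pow_U[OF this] obtain Y :: "'u set" where "Pow (UNIV :: 'u set) \<lesssim> Y" by (elim bexE)
  then have "Pow (UNIV :: 'u set) \<lesssim> (UNIV :: 'u set)" by (meson lepoll_trans subset_UNIV subset_imp_lepoll)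
  with lesspoll_Pow_self[of "UNIV :: 'u set"] have "(UNIV :: 'u set) \<prec> (UNIV :: 'u set)" by (rule lesspoll_trans2)
  then show False by simp
qed

lemma small_finite: "finite S \<Longrightarrow> small U S"
proof -
  assume S: "finite S"
  then obtain f :: "'a \<Rightarrow> 'u" where "inj_on f S"
    using finite_lepoll_infinite[OF infinite_UNIV] unfolding lepoll_def by blast
  then show ?thesis using S finite_U unfolding small_def by blast
qed

lemma ex_pairing: "\<exists>f :: 'u \<times> 'u \<Rightarrow> 'u. inj f"
proof -
  have "(UNIV :: ('u \<times> 'u) set) \<approx> (UNIV :: 'u set)"
    using card_of_Times_same_infinite[OF infinite_UNIV] by (simp add: eqpoll_iff_card_of_ordIso)
  then show ?thesis unfolding eqpoll_def bij_betw_def by auto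
qed

text \<open>Dependent pairs are coded in \<open>'u\<close> by the injection of
  \<open>ex_pairing\<close>. The codes lie in a union, over the codes \<open>x\<close> of elements
  \<open>s\<close>, of images of the codes of \<open>T s\<close>; \<open>inv_into\<close> recovers
  \<open>s\<close> from \<open>x\<close>.\<close>

lemma small_Sigma:
  assumes S: "small U S" and T: "\<And>s. s \<in> S \<Longrightarrow> small U (T s)"
  shows "small U (Sigma S T)"
proof -
  obtain p :: "'u \<times> 'u \<Rightarrow> 'u" where p: "inj p" using ex_pairing by blast
  obtain f where f: "inj_on f S" "f ` S \<in> U" using S unfolding small_def by blast
  obtain g where g: "\<And>s. s \<in> S \<Longrightarrow> inj_on (g s) (T s)" "\<And>s. s \<in> S \<Longrightarrow> g s ` T s \<in> U"
    using T unfolding small_def by metis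
  let ?h = "\<lambda>(s, t). p (f s, g s t)"
  have "inj_on ?h (Sigma S T)"
  proof (rule inj_onI, clarify)
    fix s t s' t'
    assume st: "s \<in> S" "t \<in> T s" "s' \<in> S" "t' \<in> T s'" and "p (f s, g s t) = p (f s', g s' t')"
    then have *: "(f s, g s t) = (f s', g s' t')" by (intro injD[OF p])
    then have s: "s = s'" using inj_onD[OF f(1)] st by simp
    have "t = t'" using inj_onD[OF g(1)[OF st(1)]] * st unfolding s by simp
    with s show "s = s' \<and> t = t'" by simp
  qed
  moreover have "?h ` Sigma S T \<subseteq> (\<Union>x\<in>f ` S. (\<lambda>y. p (x, y)) ` g (inv_into S f x) ` T (inv_into S f x))"
  proof clarify
    fix s t assume st: "s \<in> S" "t \<in> T s"
    then have "inv_into S f (f s) = s" using f(1) by simp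
    then have "p (f s, g s t) \<in> (\<lambda>y. p (f s, y)) ` g (inv_into S f (f s)) ` T (inv_into S f (f s))"
      using st by simp
    then show "p (f s, g s t) \<in> (\<Union>x\<in>f ` S. (\<lambda>y. p (x, y)) ` g (inv_into S f x) ` T (inv_into S f x))"
      using st(1) by blast
  qed
  moreover have "(\<Union>x\<in>f ` S. (\<lambda>y. p (x, y)) ` g (inv_into S f x) ` T (inv_into S f x)) \<in> U"
    by (intro UN_U[OF f(2)] image_U) (use f(1) g in \<open>auto simp: inv_into_into\<close>)
  ultimately show ?thesis using subset_U unfolding small_def by blast
qed

lemma small_Times: "small U S \<Longrightarrow> small U T \<Longrightarrow> small U (S \<times> T)"
  by (rule small_Sigma)

lemma small_Pow: "small U S \<Longrightarrow> small U (Pow S)"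
proof -
  assume "small U S"
  then obtain f where f: "inj_on f S" "f ` S \<in> U" unfolding small_def by auto
  obtain Y where Y: "Y \<in> U" "Pow (f ` S) \<lesssim> Y" using Pow_U[OF f(2)] by (elim bexE)
  have "inj_on (\<lambda>X. f ` X) (Pow S)" by (rule inj_on_image_Pow[OF f(1)])
  moreover have "(\<lambda>X. f ` X) ` Pow S \<subseteq> Pow (f ` S)" by auto
  ultimately have "Pow S \<lesssim> Pow (f ` S)" unfolding lepoll_def by (intro exI conjI)
  then show ?thesis by (rule small_if_lepoll[OF Y(1) lepoll_trans[OF _ Y(2)]])
qed

text \<open>An extensional function is determined by its graph, a subset of the small set
  \<open>Sigma S T\<close>.\<close>

lemma small_PiE:
  assumes "small U S" and "\<And>s. s \<in> S \<Longrightarrow> small U (T s)"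
  shows "small U (PiE S T)"
proof (rule small_inj)
  show "small U (Pow (Sigma S T))" by (intro small_Pow small_Sigma assms)
  show "inj_on (\<lambda>f. (\<lambda>s. (s, f s)) ` S) (PiE S T)"
  proof (rule inj_onI)
    fix f g assume fg: "f \<in> PiE S T" "g \<in> PiE S T" "(\<lambda>s. (s, f s)) ` S = (\<lambda>s. (s, g s)) ` S"
    show "f = g" by (rule PiE_ext[OF fg(1,2)]) (use fg(3) in auto)
  qed
  show "(\<lambda>f. (\<lambda>s. (s, f s)) ` S) ` PiE S T \<subseteq> Pow (Sigma S T)" by auto
qed

end

lemma category_set_cat: "category (set_cat U)"
  unfolding set_cat_def
proof (unfold_locales, simp_all)
  show "compose X g f \<in> X \<rightarrow>\<^sub>E Z" if "f \<in> X \<rightarrow>\<^sub>E Y" "g \<in> Y \<rightarrow>\<^sub>E Z" for X Y Z :: "'a set" and f g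
    using that by (auto simp: compose_def)
  show "compose X (\<lambda>x\<in>Y. x) f = f" if "f \<in> X \<rightarrow>\<^sub>E Y" for X Y :: "'a set" and f
    using that by (auto simp: compose_def fun_eq_iff)
  show "compose X f (\<lambda>x\<in>X. x) = f" if "f \<in> X \<rightarrow>\<^sub>E Y" for X Y :: "'a set" and f
    using that by (auto simp: compose_def fun_eq_iff)
  show "compose W h (compose W g f) = compose W (compose X h g) f"
    if "f \<in> W \<rightarrow>\<^sub>E X" "g \<in> X \<rightarrow>\<^sub>E Y" "h \<in> Y \<rightarrow>\<^sub>E Z" for W X Y Z :: "'a set" and f g h
    using that by (auto simp: compose_def fun_eq_iff)
qed

section \<open>Equivalences, adjunctions and pullbacks\<close>

definition fully_faithful ::
  "('o1, 'm1) cat \<Rightarrow> ('o2, 'm2) cat \<Rightarrow> ('o1, 'm1, 'o2, 'm2) fun_data \<Rightarrow> bool" where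
  "fully_faithful C D F \<longleftrightarrow> (\<forall>X\<in>Obj C. \<forall>Y\<in>Obj C.
     bij_betw (FMap F X Y) (Hom C X Y) (Hom D (FObj F X) (FObj F Y)))"

definition essentially_surjective ::
  "('o1, 'm1) cat \<Rightarrow> ('o2, 'm2) cat \<Rightarrow> ('o1, 'm1, 'o2, 'm2) fun_data \<Rightarrow> bool" where
  "essentially_surjective C D F \<longleftrightarrow> (\<forall>Y\<in>Obj D. \<exists>X\<in>Obj C. \<exists>i. is_iso D (FObj F X) Y i)"

lemma functor_obj: "is_functor C D F \<Longrightarrow> X \<in> Obj C \<Longrightarrow> FObj F X \<in> Obj D"
  and functor_map: "is_functor C D F \<Longrightarrow> X \<in> Obj C \<Longrightarrow> Y \<in> Obj C \<Longrightarrow> f \<in> Hom C X Y \<Longrightarrow>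
    FMap F X Y f \<in> Hom D (FObj F X) (FObj F Y)"
  and functor_Ide: "is_functor C D F \<Longrightarrow> X \<in> Obj C \<Longrightarrow> FMap F X X (Ide C X) = Ide D (FObj F X)"
  and functor_Comp: "is_functor C D F \<Longrightarrow> X \<in> Obj C \<Longrightarrow> Y \<in> Obj C \<Longrightarrow> Z \<in> Obj C \<Longrightarrow>
    f \<in> Hom C X Y \<Longrightarrow> g \<in> Hom C Y Z \<Longrightarrow> FMap F X Z (Comp C X Y Z g f)
      = Comp D (FObj F X) (FObj F Y) (FObj F Z) (FMap F Y Z g) (FMap F X Y f)"
  unfolding is_functor_def by blast+

lemma ff_inj: "fully_faithful C D F \<Longrightarrow> X \<in> Obj C \<Longrightarrow> Y \<in> Obj C \<Longrightarrow> f \<in> Hom C X Y \<Longrightarrow> g \<in> Hom C X Y \<Longrightarrow>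
    FMap F X Y f = FMap F X Y g \<Longrightarrow> f = g"
  unfolding fully_faithful_def bij_betw_def by (meson inj_onD)

lemma ff_surj: "fully_faithful C D F \<Longrightarrow> X \<in> Obj C \<Longrightarrow> Y \<in> Obj C \<Longrightarrow> h \<in> Hom D (FObj F X) (FObj F Y) \<Longrightarrow>
    \<exists>f\<in>Hom C X Y. FMap F X Y f = h"
  unfolding fully_faithful_def bij_betw_def by (metis imageE)

lemma (in category) iso_cancel_left:
  assumes "is_iso C Y Z i" "X \<in> Obj C" "Y \<in> Obj C" "Z \<in> Obj C" "f \<in> Hom C X Y" "g \<in> Hom C X Y"
    and "Comp C X Y Z i f = Comp C X Y Z i g"
  shows "f = g"
proof -
  obtain j where j: "j \<in> Hom C Z Y" "Comp C Y Z Y j i = Ide C Y" and i: "i \<in> Hom C Y Z"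
    using assms(1) unfolding is_iso_def by blast
  have *: "Comp C X Z Y j (Comp C X Y Z i h) = h" if "h \<in> Hom C X Y" for h
    using that assms(2-4) i j by (simp add: Comp_assoc Comp_Ide_left)
  show ?thesis using *[OF assms(5)] *[OF assms(6)] unfolding assms(7) by (rule box_equals[OF refl])
qed

lemma (in category) iso_cancel_right:
  assumes "is_iso C X Y i" "X \<in> Obj C" "Y \<in> Obj C" "Z \<in> Obj C" "f \<in> Hom C Y Z" "g \<in> Hom C Y Z"
    and "Comp C X Y Z f i = Comp C X Y Z g i"
  shows "f = g"
proof -
  obtain j where j: "j \<in> Hom C Y X" "Comp C Y X Y i j = Ide C Y" and i: "i \<in> Hom C X Y"
    using assms(1) unfolding is_iso_def by blast
  have *: "Comp C Y X Z (Comp C X Y Z h i) j = h" if "h \<in> Hom C Y Z" for h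
    using that assms(2-4) i j by (simp add: Comp_assoc[symmetric] Comp_Ide_right)
  show ?thesis using *[OF assms(5)] *[OF assms(6)] unfolding assms(7) by (rule box_equals[OF refl])
qed

text \<open>By naturality the composite of \<open>f\<close> with \<open>\<alpha> Y\<close> depends
  only on \<open>F f\<close>, and the isomorphism \<open>\<alpha> Y\<close> can be
  cancelled.\<close>

lemma equivalence_faithful:
  assumes "category C" and F: "is_functor C D F" and G: "is_functor D C G"
    and \<alpha>: "\<And>X. X \<in> Obj C \<Longrightarrow> is_iso C X (FObj G (FObj F X)) (\<alpha> X)"
    and nat: "\<And>X Y f. X \<in> Obj C \<Longrightarrow> Y \<in> Obj C \<Longrightarrow> f \<in> Hom C X Y \<Longrightarrow>
      Comp C X Y (FObj G (FObj F Y)) (\<alpha> Y) f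
      = Comp C X (FObj G (FObj F X)) (FObj G (FObj F Y)) (FMap G (FObj F X) (FObj F Y) (FMap F X Y f)) (\<alpha> X)"
    and X: "X \<in> Obj C" "Y \<in> Obj C" "f \<in> Hom C X Y" "g \<in> Hom C X Y" "FMap F X Y f = FMap F X Y g"
  shows "f = g"
proof -
  interpret category C by fact
  have eq: "Comp C X Y (FObj G (FObj F Y)) (\<alpha> Y) f = Comp C X Y (FObj G (FObj F Y)) (\<alpha> Y) g"
    unfolding nat[OF X(1-3)] nat[OF X(1,2,4)] X(5) ..
  show ?thesis
    by (rule iso_cancel_left[OF \<alpha>[OF X(2)] X(1,2) _ X(3,4) eq])
      (use X functor_obj[OF F] functor_obj[OF G] in auto)
qed

lemma equivalence_imp_ff:
  assumes "equivalent_categories C D"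
  shows "\<exists>F. is_functor C D F \<and> fully_faithful C D F \<and> essentially_surjective C D F"
proof -
  obtain F G \<alpha> \<beta> where "category C" "category D" and F: "is_functor C D F" and G: "is_functor D C G"
    and \<alpha>: "natural_isomorphism C C id_functor (comp_functor G F) \<alpha>"
    and \<beta>: "natural_isomorphism D D (comp_functor F G) id_functor \<beta>"
    using assms unfolding equivalent_categories_def by blast
  interpret C: category C by fact
  interpret D: category D by fact
  note obj = functor_obj[OF F] functor_obj[OF G]
  note hom = functor_map[OF F] functor_map[OF G]
  have \<alpha>_iso: "is_iso C X (FObj G (FObj F X)) (\<alpha> X)" if "X \<in> Obj C" for X
    using \<alpha> that unfolding natural_isomorphism_def id_functor_def comp_functor_def by simp
  have \<alpha>_nat: "Comp C X Y (FObj G (FObj F Y)) (\<alpha> Y) f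
      = Comp C X (FObj G (FObj F X)) (FObj G (FObj F Y)) (FMap G (FObj F X) (FObj F Y) (FMap F X Y f)) (\<alpha> X)"
    if "X \<in> Obj C" "Y \<in> Obj C" "f \<in> Hom C X Y" for X Y f
    using \<alpha> that unfolding natural_isomorphism_def natural_transformation_def id_functor_def comp_functor_def
    by simp
  have \<beta>_iso: "is_iso D (FObj F (FObj G Y)) Y (\<beta> Y)" if "Y \<in> Obj D" for Y
    using \<beta> that unfolding natural_isomorphism_def id_functor_def comp_functor_def by simp
  have \<beta>_nat: "Comp D (FObj F (FObj G X)) (FObj F (FObj G Y)) Y (\<beta> Y) (FMap F (FObj G X) (FObj G Y) (FMap G X Y f))
      = Comp D (FObj F (FObj G X)) X Y f (\<beta> X)"
    if "X \<in> Obj D" "Y \<in> Obj D" "f \<in> Hom D X Y" for X Y f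
    using \<beta> that unfolding natural_isomorphism_def natural_transformation_def id_functor_def comp_functor_def
    by simp
  have F_inj: "f = g" if "X \<in> Obj C" "Y \<in> Obj C" "f \<in> Hom C X Y" "g \<in> Hom C X Y" "FMap F X Y f = FMap F X Y g"
    for X Y f g
    by (rule equivalence_faithful[OF C.category_axioms F G \<alpha>_iso \<alpha>_nat that])
  have G_inj: "f = g" if X: "X \<in> Obj D" "Y \<in> Obj D" "f \<in> Hom D X Y" "g \<in> Hom D X Y" "FMap G X Y f = FMap G X Y g"
    for X Y f g
  proof -
    have eq: "Comp D (FObj F (FObj G X)) X Y f (\<beta> X) = Comp D (FObj F (FObj G X)) X Y g (\<beta> X)"
      unfolding \<beta>_nat[OF X(1-3), symmetric] \<beta>_nat[OF X(1,2,4), symmetric] X(5) ..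
    show ?thesis by (rule D.iso_cancel_right[OF \<beta>_iso[OF X(1)] _ X(1-4) eq]) (use X obj in auto)
  qed
  have F_surj: "\<exists>f\<in>Hom C X Y. FMap F X Y f = h"
    if X: "X \<in> Obj C" "Y \<in> Obj C" "h \<in> Hom D (FObj F X) (FObj F Y)" for X Y h
  proof -
    let ?GX = "FObj G (FObj F X)" and ?GY = "FObj G (FObj F Y)" and ?Gh = "FMap G (FObj F X) (FObj F Y) h"
    obtain j where j: "j \<in> Hom C ?GY Y" "Comp C ?GY Y ?GY (\<alpha> Y) j = Ide C ?GY"
      using \<alpha>_iso[OF X(2)] unfolding is_iso_def by blast
    have a: "\<alpha> X \<in> Hom C X ?GX" "\<alpha> Y \<in> Hom C Y ?GY"
      using \<alpha>_iso[OF X(1)] \<alpha>_iso[OF X(2)] unfolding is_iso_def by auto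
    have Gh: "?Gh \<in> Hom C ?GX ?GY" using X obj hom by simp
    let ?t = "Comp C X ?GX ?GY ?Gh (\<alpha> X)"
    have t: "?t \<in> Hom C X ?GY" using a Gh X obj by (auto intro: C.Comp_Hom)
    \<comment> \<open>\<open>f\<close> is \<open>G h\<close> conjugated by \<open>\<alpha>\<close>.
      Naturality and cancellation of \<open>\<alpha> X\<close> give \<open>GFf = Gh\<close>, and
      faithfulness of \<open>G\<close> then gives \<open>F f = h\<close>.\<close>
    define f where "f = Comp C X ?GY Y j ?t"
    have f: "f \<in> Hom C X Y" unfolding f_def using t X obj j by (auto intro: C.Comp_Hom)
    have "Comp C X Y ?GY (\<alpha> Y) f = ?t"
      unfolding f_def using t X obj j a by (simp add: C.Comp_assoc[of X ?GY Y ?GY ?t j "\<alpha> Y"] C.Comp_Ide_left)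
    then have "Comp C X ?GX ?GY (FMap G (FObj F X) (FObj F Y) (FMap F X Y f)) (\<alpha> X) = ?t"
      using \<alpha>_nat[OF X(1,2) f] by simp
    from C.iso_cancel_right[OF \<alpha>_iso[OF X(1)] X(1) _ _ _ Gh this]
    have "FMap G (FObj F X) (FObj F Y) (FMap F X Y f) = ?Gh" using X obj hom f by auto
    from G_inj[OF _ _ _ X(3) this] have "FMap F X Y f = h" using X obj hom f by auto
    then show ?thesis using f by blast
  qed
  have "fully_faithful C D F"
    unfolding fully_faithful_def bij_betw_def
  proof (intro ballI conjI)
    fix X Y assume X: "X \<in> Obj C" "Y \<in> Obj C"
    show "inj_on (FMap F X Y) (Hom C X Y)" using F_inj X by (auto intro: inj_onI)
    show "FMap F X Y ` Hom C X Y = Hom D (FObj F X) (FObj F Y)"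
      using F_surj[OF X] hom(1)[OF X] by (auto simp: image_iff)
  qed
  moreover have "essentially_surjective C D F"
    unfolding essentially_surjective_def using \<beta>_iso obj by blast
  ultimately show ?thesis using F by blast
qed

text \<open>The inverse picks \<open>K Y\<close> with an isomorphism \<open>i Y\<close> from
  \<open>F (K Y)\<close> to \<open>Y\<close>, and sends \<open>f\<close> to the arrow that
  \<open>F\<close> maps to the conjugate of \<open>f\<close> by these isomorphisms. Equations
  required in \<open>C\<close> are checked after applying \<open>F\<close>.\<close>

lemma ff_imp_equivalence:
  assumes C: "category C" and D: "category D" and F: "is_functor C D F"
    and ff: "fully_faithful C D F" and es: "essentially_surjective C D F"
  shows "equivalent_categories C D"
proof -
  interpret C: category C by fact
  interpret D: category D by fact
  obtain K i where K: "\<And>Y. Y \<in> Obj D \<Longrightarrow> K Y \<in> Obj C" and i_iso: "\<And>Y. Y \<in> Obj D \<Longrightarrow> is_iso D (FObj F (K Y)) Y (i Y)"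
    using es unfolding essentially_surjective_def by metis
  have i: "i Y \<in> Hom D (FObj F (K Y)) Y" if "Y \<in> Obj D" for Y
    using i_iso[OF that] unfolding is_iso_def by blast
  have "\<forall>Y. \<exists>j. Y \<in> Obj D \<longrightarrow> j \<in> Hom D Y (FObj F (K Y)) \<and>
      Comp D (FObj F (K Y)) Y (FObj F (K Y)) j (i Y) = Ide D (FObj F (K Y)) \<and>
      Comp D Y (FObj F (K Y)) Y (i Y) j = Ide D Y"
    using i_iso unfolding is_iso_def by meson
  then obtain j where j: "\<And>Y. Y \<in> Obj D \<Longrightarrow> j Y \<in> Hom D Y (FObj F (K Y))"
    and ji: "\<And>Y. Y \<in> Obj D \<Longrightarrow> Comp D (FObj F (K Y)) Y (FObj F (K Y)) (j Y) (i Y) = Ide D (FObj F (K Y))"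
    and ij: "\<And>Y. Y \<in> Obj D \<Longrightarrow> Comp D Y (FObj F (K Y)) Y (i Y) (j Y) = Ide D Y"
    by metis
  define l where "l X Y h = (SOME f. f \<in> Hom C X Y \<and> FMap F X Y f = h)" for X Y h
  have l: "l X Y h \<in> Hom C X Y" "FMap F X Y (l X Y h) = h"
    if "X \<in> Obj C" "Y \<in> Obj C" "h \<in> Hom D (FObj F X) (FObj F Y)" for X Y h
    using someI_ex[of "\<lambda>f. f \<in> Hom C X Y \<and> FMap F X Y f = h"] ff_surj[OF ff that] unfolding l_def by auto
  note obj = functor_obj[OF F] K and hom = functor_map[OF F] and [intro] = C.Comp_Hom D.Comp_Hom
  let ?t = "\<lambda>X Y f. Comp D (FObj F (K X)) Y (FObj F (K Y)) (j Y) (Comp D (FObj F (K X)) X Y f (i X))"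
  have t: "?t X Y f \<in> Hom D (FObj F (K X)) (FObj F (K Y))"
    if "X \<in> Obj D" "Y \<in> Obj D" "f \<in> Hom D X Y" for X Y f
    using that i j obj by blast
  define G where "G = \<lparr>FObj = K, FMap = (\<lambda>X Y f. l (K X) (K Y) (?t X Y f))\<rparr>"
  have G_hom: "FMap G X Y f \<in> Hom C (K X) (K Y)" and FG: "FMap F (K X) (K Y) (FMap G X Y f) = ?t X Y f"
    if "X \<in> Obj D" "Y \<in> Obj D" "f \<in> Hom D X Y" for X Y f
    using l[OF K K t] that unfolding G_def by simp_all
  have G_K: "FObj G = K" unfolding G_def by simp
  have \<beta>_nat: "Comp D (FObj F (K X)) (FObj F (K Y)) Y (i Y) (?t X Y f) = Comp D (FObj F (K X)) X Y f (i X)"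
    if "X \<in> Obj D" "Y \<in> Obj D" "f \<in> Hom D X Y" for X Y f
  proof -
    have *: "Comp D (FObj F (K X)) X Y f (i X) \<in> Hom D (FObj F (K X)) Y" using that i obj by blast
    show ?thesis
      using that * i j obj
      by (subst D.Comp_assoc[where X = Y]) (auto simp: ij D.Comp_Ide_left)
  qed
  have G: "is_functor D C G"
    unfolding is_functor_def
  proof (intro conjI ballI)
    show "FObj G X \<in> Obj C" if "X \<in> Obj D" for X using that K by (simp add: G_K)
    show "FMap G X Y f \<in> Hom C (FObj G X) (FObj G Y)" if "X \<in> Obj D" "Y \<in> Obj D" "f \<in> Hom D X Y" for X Y f
      using G_hom[OF that] by (simp add: G_K)
    show "FMap G X X (Ide D X) = Ide C (FObj G X)" if X: "X \<in> Obj D" for X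
      unfolding G_K
      by (rule ff_inj[OF ff K[OF X] K[OF X] G_hom[OF X X D.Ide_Hom[OF X]] C.Ide_Hom[OF K[OF X]]])
        (use X obj i in \<open>simp add: FG[OF X X D.Ide_Hom[OF X]] functor_Ide[OF F] D.Comp_Ide_left ji\<close>)
    fix X Y Z f g
    assume X: "X \<in> Obj D" "Y \<in> Obj D" "Z \<in> Obj D" and f: "f \<in> Hom D X Y" "g \<in> Hom D Y Z"
    have gf: "Comp D X Y Z g f \<in> Hom D X Z" using X f by blast
    have Gf: "FMap G X Y f \<in> Hom C (K X) (K Y)" "FMap G Y Z g \<in> Hom C (K Y) (K Z)"
      using G_hom X f by auto
    have FX: "FObj F (K X) \<in> Obj D" "FObj F (K Y) \<in> Obj D" "FObj F (K Z) \<in> Obj D"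
      "K X \<in> Obj C" "K Y \<in> Obj C" "K Z \<in> Obj C" using X obj by auto
    have fi: "Comp D (FObj F (K X)) X Y f (i X) \<in> Hom D (FObj F (K X)) Y"
      "Comp D (FObj F (K Y)) Y Z g (i Y) \<in> Hom D (FObj F (K Y)) Z" using X f FX i by blast+
    have "Comp D (FObj F (K X)) (FObj F (K Y)) (FObj F (K Z)) (?t Y Z g) (?t X Y f)
      = Comp D (FObj F (K X)) Z (FObj F (K Z)) (j Z)
          (Comp D (FObj F (K X)) (FObj F (K Y)) Z (Comp D (FObj F (K Y)) Y Z g (i Y)) (?t X Y f))"
      by (rule D.Comp_assoc[symmetric]) (use X FX f t j fi in auto)
    also have "Comp D (FObj F (K X)) (FObj F (K Y)) Z (Comp D (FObj F (K Y)) Y Z g (i Y)) (?t X Y f)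
      = Comp D (FObj F (K X)) Y Z g (Comp D (FObj F (K X)) (FObj F (K Y)) Y (i Y) (?t X Y f))"
      by (rule D.Comp_assoc[symmetric]) (use X FX f t i in auto)
    also have "\<dots> = Comp D (FObj F (K X)) Y Z g (Comp D (FObj F (K X)) X Y f (i X))"
      using \<beta>_nat X f by simp
    also have "\<dots> = Comp D (FObj F (K X)) X Z (Comp D X Y Z g f) (i X)"
      by (rule D.Comp_assoc) (use X FX f i in auto)
    finally have "?t X Z (Comp D X Y Z g f) = Comp D (FObj F (K X)) (FObj F (K Y)) (FObj F (K Z)) (?t Y Z g) (?t X Y f)"
      by simp
    then show "FMap G X Z (Comp D X Y Z g f) = Comp C (FObj G X) (FObj G Y) (FObj G Z) (FMap G Y Z g) (FMap G X Y f)"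
      unfolding G_K
      by - (rule ff_inj[OF ff FX(4,6) G_hom[OF X(1,3) gf]],
        use X f FX Gf gf in \<open>auto simp: functor_Comp[OF F] FG\<close>)
  qed
  \<comment> \<open>The isomorphism \<open>j\<close> at \<open>F X\<close>, from \<open>F X\<close>
    to \<open>F (K (F X))\<close>, lifted along \<open>F\<close>.\<close>
  define \<alpha> where "\<alpha> X = l X (K (FObj F X)) (j (FObj F X))" for X
  have \<alpha>: "\<alpha> X \<in> Hom C X (K (FObj F X))" "FMap F X (K (FObj F X)) (\<alpha> X) = j (FObj F X)"
    if "X \<in> Obj C" for X
    unfolding \<alpha>_def using that obj j by (auto intro: l)
  have \<alpha>_iso: "is_iso C X (K (FObj F X)) (\<alpha> X)" if X: "X \<in> Obj C" for X
  proof -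
    let ?Y = "K (FObj F X)"
    define r where "r = l ?Y X (i (FObj F X))"
    have Y: "?Y \<in> Obj C" "FObj F X \<in> Obj D" "FObj F ?Y \<in> Obj D" using X obj by auto
    have r: "r \<in> Hom C ?Y X" "FMap F ?Y X r = i (FObj F X)"
      unfolding r_def using Y X i by (auto intro: l)
    have "Comp C X ?Y X r (\<alpha> X) = Ide C X"
      by (rule ff_inj[OF ff X X])
        (use X Y r \<alpha>[OF X] in \<open>auto simp: functor_Comp[OF F] functor_Ide[OF F] ij intro: C.Ide_Hom\<close>)
    moreover have "Comp C ?Y X ?Y (\<alpha> X) r = Ide C ?Y"
      by (rule ff_inj[OF ff Y(1) Y(1)])
        (use X Y r \<alpha>[OF X] in \<open>auto simp: functor_Comp[OF F] functor_Ide[OF F] ji intro: C.Ide_Hom\<close>)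
    ultimately show ?thesis unfolding is_iso_def using r \<alpha>[OF X] by blast
  qed
  have \<alpha>_nat: "Comp C X Y (K (FObj F Y)) (\<alpha> Y) f
      = Comp C X (K (FObj F X)) (K (FObj F Y)) (FMap G (FObj F X) (FObj F Y) (FMap F X Y f)) (\<alpha> X)"
    if X: "X \<in> Obj C" "Y \<in> Obj C" "f \<in> Hom C X Y" for X Y f
  proof -
    let ?FX = "FObj F X" and ?FY = "FObj F Y" and ?Ff = "FMap F X Y f"
    have Y: "?FX \<in> Obj D" "?FY \<in> Obj D" "K ?FX \<in> Obj C" "K ?FY \<in> Obj C"
      "FObj F (K ?FX) \<in> Obj D" "FObj F (K ?FY) \<in> Obj D"  using X obj by auto
    have Ff: "?Ff \<in> Hom D ?FX ?FY" using X hom by blast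
    have GFf: "FMap G ?FX ?FY ?Ff \<in> Hom C (K ?FX) (K ?FY)" using G_hom Y Ff by blast
    have fi: "Comp D (FObj F (K ?FX)) ?FX ?FY ?Ff (i ?FX) \<in> Hom D (FObj F (K ?FX)) ?FY"
      using Y Ff i by blast
    have "Comp D ?FX (FObj F (K ?FX)) (FObj F (K ?FY)) (?t ?FX ?FY ?Ff) (j ?FX)
      = Comp D ?FX ?FY (FObj F (K ?FY)) (j ?FY) (Comp D ?FX (FObj F (K ?FX)) ?FY (Comp D (FObj F (K ?FX)) ?FX ?FY ?Ff (i ?FX)) (j ?FX))"
      by (rule D.Comp_assoc[symmetric]) (use X Y j fi in auto)
    also have "Comp D ?FX (FObj F (K ?FX)) ?FY (Comp D (FObj F (K ?FX)) ?FX ?FY ?Ff (i ?FX)) (j ?FX)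
      = Comp D ?FX ?FX ?FY ?Ff (Comp D ?FX (FObj F (K ?FX)) ?FX (i ?FX) (j ?FX))"
      by (rule D.Comp_assoc[symmetric]) (use X Y j i Ff in auto)
    also have "\<dots> = ?Ff" using Y Ff by (simp add: ij D.Comp_Ide_right)
    finally have "Comp D ?FX (FObj F (K ?FX)) (FObj F (K ?FY)) (?t ?FX ?FY ?Ff) (j ?FX)
      = Comp D ?FX ?FY (FObj F (K ?FY)) (j ?FY) ?Ff" .
    then show ?thesis
      by - (rule ff_inj[OF ff X(1) Y(4)],
        use X Y Ff GFf \<alpha>[OF X(1)] \<alpha>[OF X(2)] in \<open>auto simp: functor_Comp[OF F] FG\<close>)
  qed
  have "natural_isomorphism C C id_functor (comp_functor G F) \<alpha>"
    unfolding natural_isomorphism_def natural_transformation_def id_functor_def comp_functor_def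
    using \<alpha> \<alpha>_iso \<alpha>_nat by (simp add: G_K)
  moreover have "natural_isomorphism D D (comp_functor F G) id_functor i"
    unfolding natural_isomorphism_def natural_transformation_def id_functor_def comp_functor_def
    using i i_iso \<beta>_nat by (simp add: G_K FG)
  ultimately show ?thesis unfolding equivalent_categories_def using C D F G by blast
qed

section \<open>Adjunctions and universal arrows\<close>

lemma adjunction_universal:
  assumes "category C" "category D" and adj: "adjunction C D F G \<eta> \<epsilon>"
    and X: "X \<in> Obj C" "Y \<in> Obj D" "f \<in> Hom D (FObj F X) Y"
  shows "\<exists>!g. g \<in> Hom C X (FObj G Y) \<and>
    Comp D (FObj F X) (FObj F (FObj G Y)) Y (\<epsilon> Y) (FMap F X (FObj G Y) g) = f"
proof -
  interpret C: category C by fact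
  interpret D: category D by fact
  have F: "is_functor C D F" and G: "is_functor D C G" using adj unfolding adjunction_def by blast+
  have \<eta>: "\<eta> X \<in> Hom C X (FObj G (FObj F X))" if "X \<in> Obj C" for X
    using adj that unfolding adjunction_def natural_transformation_def id_functor_def comp_functor_def by simp
  have \<epsilon>: "\<epsilon> Y \<in> Hom D (FObj F (FObj G Y)) Y" if "Y \<in> Obj D" for Y
    using adj that unfolding adjunction_def natural_transformation_def id_functor_def comp_functor_def by simp
  have \<eta>_nat: "Comp C X Y (FObj G (FObj F Y)) (\<eta> Y) f
      = Comp C X (FObj G (FObj F X)) (FObj G (FObj F Y)) (FMap G (FObj F X) (FObj F Y) (FMap F X Y f)) (\<eta> X)"
    if "X \<in> Obj C" "Y \<in> Obj C" "f \<in> Hom C X Y" for X Y f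
    using adj that unfolding adjunction_def natural_transformation_def id_functor_def comp_functor_def by simp
  have \<epsilon>_nat: "Comp D (FObj F (FObj G X)) (FObj F (FObj G Y)) Y (\<epsilon> Y) (FMap F (FObj G X) (FObj G Y) (FMap G X Y f))
      = Comp D (FObj F (FObj G X)) X Y f (\<epsilon> X)"
    if "X \<in> Obj D" "Y \<in> Obj D" "f \<in> Hom D X Y" for X Y f
    using adj that unfolding adjunction_def natural_transformation_def id_functor_def comp_functor_def by simp
  have t1: "Comp D (FObj F X) (FObj F (FObj G (FObj F X))) (FObj F X)
        (\<epsilon> (FObj F X)) (FMap F X (FObj G (FObj F X)) (\<eta> X)) = Ide D (FObj F X)" if "X \<in> Obj C" for X
    using adj that unfolding adjunction_def by blast
  have t2: "Comp C (FObj G Y) (FObj G (FObj F (FObj G Y))) (FObj G Y)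
        (FMap G (FObj F (FObj G Y)) Y (\<epsilon> Y)) (\<eta> (FObj G Y)) = Ide C (FObj G Y)" if "Y \<in> Obj D" for Y
    using adj that unfolding adjunction_def by blast
  note obj = functor_obj[OF F] functor_obj[OF G]
  let ?FX = "FObj F X" and ?GY = "FObj G Y"
  have o: "?FX \<in> Obj D" "?GY \<in> Obj C" "FObj G ?FX \<in> Obj C" "FObj F ?GY \<in> Obj D" "FObj F (FObj G ?FX) \<in> Obj D"
    "FObj G (FObj F ?GY) \<in> Obj C"
    using X obj by auto
  have Gf: "FMap G ?FX Y f \<in> Hom C (FObj G ?FX) ?GY" using functor_map[OF G] o X by blast
  show ?thesis
  \<comment> \<open>The transpose of \<open>f\<close> is \<open>G f\<close> after the unit. It
    solves the equation by naturality of \<open>\<epsilon>\<close> and the first triangle identity;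
    uniqueness comes from naturality of \<open>\<eta>\<close> and the second.\<close>
  proof (rule ex1I[of _ "Comp C X (FObj G ?FX) ?GY (FMap G ?FX Y f) (\<eta> X)"], intro conjI)
    show "Comp C X (FObj G ?FX) ?GY (FMap G ?FX Y f) (\<eta> X) \<in> Hom C X ?GY"
      using C.Comp_Hom[OF X(1) o(3,2) \<eta>[OF X(1)] Gf] .
    have F\<eta>: "FMap F X (FObj G ?FX) (\<eta> X) \<in> Hom D ?FX (FObj F (FObj G ?FX))"
      and FGf: "FMap F (FObj G ?FX) ?GY (FMap G ?FX Y f) \<in> Hom D (FObj F (FObj G ?FX)) (FObj F ?GY)"
      using functor_map[OF F] o X Gf \<eta> by auto
    have "Comp D ?FX (FObj F ?GY) Y (\<epsilon> Y) (FMap F X ?GY (Comp C X (FObj G ?FX) ?GY (FMap G ?FX Y f) (\<eta> X)))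
      = Comp D ?FX (FObj F ?GY) Y (\<epsilon> Y) (Comp D ?FX (FObj F (FObj G ?FX)) (FObj F ?GY)
          (FMap F (FObj G ?FX) ?GY (FMap G ?FX Y f)) (FMap F X (FObj G ?FX) (\<eta> X)))"
      using functor_Comp[OF F X(1) o(3,2) \<eta>[OF X(1)] Gf] by simp
    also have "\<dots> = Comp D ?FX (FObj F (FObj G ?FX)) Y (Comp D (FObj F (FObj G ?FX)) (FObj F ?GY) Y (\<epsilon> Y)
          (FMap F (FObj G ?FX) ?GY (FMap G ?FX Y f))) (FMap F X (FObj G ?FX) (\<eta> X))"
      by (rule D.Comp_assoc[OF o(1,5,4) X(2) F\<eta> FGf \<epsilon>[OF X(2)]])
    also have "\<dots> = Comp D ?FX (FObj F (FObj G ?FX)) Y (Comp D (FObj F (FObj G ?FX)) ?FX Y f (\<epsilon> ?FX)) (FMap F X (FObj G ?FX) (\<eta> X))"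
      using \<epsilon>_nat[OF o(1) X(2,3)] by simp
    also have "\<dots> = Comp D ?FX ?FX Y f (Comp D ?FX (FObj F (FObj G ?FX)) ?FX (\<epsilon> ?FX) (FMap F X (FObj G ?FX) (\<eta> X)))"
      by (rule D.Comp_assoc[OF o(1,5,1) X(2) F\<eta> \<epsilon>[OF o(1)] X(3), symmetric])
    also have "\<dots> = f" using t1[OF X(1)] D.Comp_Ide_right[OF o(1) X(2,3)] by simp
    finally show "Comp D ?FX (FObj F ?GY) Y (\<epsilon> Y) (FMap F X ?GY (Comp C X (FObj G ?FX) ?GY (FMap G ?FX Y f) (\<eta> X))) = f" .
  next
    fix g assume "g \<in> Hom C X ?GY \<and> Comp D ?FX (FObj F ?GY) Y (\<epsilon> Y) (FMap F X ?GY g) = f"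
    then have g: "g \<in> Hom C X ?GY" and gf: "Comp D ?FX (FObj F ?GY) Y (\<epsilon> Y) (FMap F X ?GY g) = f" by auto
    have Fg: "FMap F X ?GY g \<in> Hom D ?FX (FObj F ?GY)" using functor_map[OF F X(1) o(2) g] .
    have GFg: "FMap G ?FX (FObj F ?GY) (FMap F X ?GY g) \<in> Hom C (FObj G ?FX) (FObj G (FObj F ?GY))"
      using functor_map[OF G o(1,4) Fg] .
    have G\<epsilon>: "FMap G (FObj F ?GY) Y (\<epsilon> Y) \<in> Hom C (FObj G (FObj F ?GY)) ?GY"
      using functor_map[OF G o(4) X(2) \<epsilon>[OF X(2)]] .
    have "g = Comp C X ?GY ?GY (Comp C ?GY (FObj G (FObj F ?GY)) ?GY (FMap G (FObj F ?GY) Y (\<epsilon> Y)) (\<eta> ?GY)) g"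
      using t2[OF X(2)] C.Comp_Ide_left[OF X(1) o(2) g] by simp
    also have "\<dots> = Comp C X (FObj G (FObj F ?GY)) ?GY (FMap G (FObj F ?GY) Y (\<epsilon> Y))
        (Comp C X ?GY (FObj G (FObj F ?GY)) (\<eta> ?GY) g)"
      by (rule C.Comp_assoc[OF X(1) o(2,6,2) g \<eta>[OF o(2)] G\<epsilon>, symmetric])
    also have "\<dots> = Comp C X (FObj G (FObj F ?GY)) ?GY (FMap G (FObj F ?GY) Y (\<epsilon> Y))
        (Comp C X (FObj G ?FX) (FObj G (FObj F ?GY)) (FMap G ?FX (FObj F ?GY) (FMap F X ?GY g)) (\<eta> X))"
      using \<eta>_nat[OF X(1) o(2) g] by simp
    also have "\<dots> = Comp C X (FObj G ?FX) ?GY (Comp C (FObj G ?FX) (FObj G (FObj F ?GY)) ?GY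
        (FMap G (FObj F ?GY) Y (\<epsilon> Y)) (FMap G ?FX (FObj F ?GY) (FMap F X ?GY g))) (\<eta> X)"
      by (rule C.Comp_assoc[OF X(1) o(3,6,2) \<eta>[OF X(1)] GFg G\<epsilon>])
    also have "\<dots> = Comp C X (FObj G ?FX) ?GY (FMap G ?FX Y f) (\<eta> X)"
      using functor_Comp[OF G o(1,4) X(2) Fg \<epsilon>[OF X(2)]] gf by simp
    finally show "g = Comp C X (FObj G ?FX) ?GY (FMap G ?FX Y f) (\<eta> X)" .
  qed
qed

text \<open>A universal arrow \<open>\<epsilon> Y\<close> for each \<open>Y\<close> determines the
  right adjoint on arrows, the unit and all laws: two arrows into \<open>GO Y\<close> agree as soon
  as their images under \<open>F\<close>, followed by \<open>\<epsilon> Y\<close>, do.\<close>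

lemma universal_adjunction:
  assumes "category C" "category D" and F: "is_functor C D F"
    and GO: "\<And>Y. Y \<in> Obj D \<Longrightarrow> GO Y \<in> Obj C"
    and \<epsilon>: "\<And>Y. Y \<in> Obj D \<Longrightarrow> \<epsilon> Y \<in> Hom D (FObj F (GO Y)) Y"
    and univ: "\<And>X Y f. X \<in> Obj C \<Longrightarrow> Y \<in> Obj D \<Longrightarrow> f \<in> Hom D (FObj F X) Y \<Longrightarrow>
      \<exists>!g. g \<in> Hom C X (GO Y) \<and> Comp D (FObj F X) (FObj F (GO Y)) Y (\<epsilon> Y) (FMap F X (GO Y) g) = f"
  shows "\<exists>G \<eta>. adjunction C D F G \<eta> \<epsilon>"
proof -
  interpret C: category C by fact
  interpret D: category D by fact
  note obj = functor_obj[OF F] and hom = functor_map[OF F]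
  define tr where "tr X Y f = (THE g. g \<in> Hom C X (GO Y) \<and>
      Comp D (FObj F X) (FObj F (GO Y)) Y (\<epsilon> Y) (FMap F X (GO Y) g) = f)" for X Y f
  have tr: "tr X Y f \<in> Hom C X (GO Y)"
    "Comp D (FObj F X) (FObj F (GO Y)) Y (\<epsilon> Y) (FMap F X (GO Y) (tr X Y f)) = f"
    if "X \<in> Obj C" "Y \<in> Obj D" "f \<in> Hom D (FObj F X) Y" for X Y f
    using theI'[OF univ[OF that]] unfolding tr_def by auto
  have uniq: "g = h" if "X \<in> Obj C" "Y \<in> Obj D" "g \<in> Hom C X (GO Y)" "h \<in> Hom C X (GO Y)"
    "Comp D (FObj F X) (FObj F (GO Y)) Y (\<epsilon> Y) (FMap F X (GO Y) g) = f"
    "Comp D (FObj F X) (FObj F (GO Y)) Y (\<epsilon> Y) (FMap F X (GO Y) h) = f" for X Y f g h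
  proof -
    have "f \<in> Hom D (FObj F X) Y"
      unfolding that(5)[symmetric] using that(1-3) GO obj hom \<epsilon> by (auto intro!: D.Comp_Hom)
    from univ[OF that(1,2) this] show ?thesis using that by blast
  qed
  define Gm where "Gm X Y f = tr (GO X) Y (Comp D (FObj F (GO X)) X Y f (\<epsilon> X))" for X Y f
  have Gm: "Gm X Y f \<in> Hom C (GO X) (GO Y)"
    "Comp D (FObj F (GO X)) (FObj F (GO Y)) Y (\<epsilon> Y) (FMap F (GO X) (GO Y) (Gm X Y f))
      = Comp D (FObj F (GO X)) X Y f (\<epsilon> X)"
    if "X \<in> Obj D" "Y \<in> Obj D" "f \<in> Hom D X Y" for X Y f
    using tr[of "GO X" Y "Comp D (FObj F (GO X)) X Y f (\<epsilon> X)"] that GO obj \<epsilon> D.Comp_Hom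
    unfolding Gm_def by auto
  \<comment> \<open>Composing with \<open>Gm X Y f\<close> composes the transpose with
    \<open>f\<close>. Functoriality, naturality of \<open>\<eta>\<close> and the second triangle
    identity share this computation.\<close>
  have push: "Comp D (FObj F W) (FObj F (GO Y)) Y (\<epsilon> Y) (FMap F W (GO Y) (Comp C W (GO X) (GO Y) (Gm X Y f) g))
      = Comp D (FObj F W) X Y f (Comp D (FObj F W) (FObj F (GO X)) X (\<epsilon> X) (FMap F W (GO X) g))"
    if X: "X \<in> Obj D" "Y \<in> Obj D" "f \<in> Hom D X Y" "W \<in> Obj C" "g \<in> Hom C W (GO X)" for X Y W f g
  proof -
    have o: "FObj F W \<in> Obj D" "FObj F (GO X) \<in> Obj D" "FObj F (GO Y) \<in> Obj D" "GO X \<in> Obj C" "GO Y \<in> Obj C"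
      using X GO obj by auto
    have Fg: "FMap F W (GO X) g \<in> Hom D (FObj F W) (FObj F (GO X))" using hom o X by blast
    have FG: "FMap F (GO X) (GO Y) (Gm X Y f) \<in> Hom D (FObj F (GO X)) (FObj F (GO Y))"
      using hom o Gm X by blast
    show ?thesis
      unfolding functor_Comp[OF F X(4) o(4,5) X(5) Gm(1)[OF X(1-3)]]
        D.Comp_assoc[OF o(1,2,3) X(2) Fg FG \<epsilon>[OF X(2)]] Gm(2)[OF X(1-3)]
        D.Comp_assoc[OF o(1,2) X(1,2) Fg \<epsilon>[OF X(1)] X(3)] ..
  qed
  define \<eta> where "\<eta> X = tr X (FObj F X) (Ide D (FObj F X))" for X
  have \<eta>: "\<eta> X \<in> Hom C X (GO (FObj F X))"
    "Comp D (FObj F X) (FObj F (GO (FObj F X))) (FObj F X) (\<epsilon> (FObj F X)) (FMap F X (GO (FObj F X)) (\<eta> X)) = Ide D (FObj F X)"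
    if "X \<in> Obj C" for X
    using tr[OF that obj[OF that] D.Ide_Hom[OF obj[OF that]]] unfolding \<eta>_def by auto
  define G where "G = \<lparr>FObj = GO, FMap = Gm\<rparr>"
  have G: "is_functor D C G"
    unfolding is_functor_def G_def fun_data.simps
  proof (intro conjI ballI)
    show "GO X \<in> Obj C" if "X \<in> Obj D" for X using GO that .
    show "Gm X Y f \<in> Hom C (GO X) (GO Y)" if "X \<in> Obj D" "Y \<in> Obj D" "f \<in> Hom D X Y" for X Y f
      using Gm that by blast
    show "Gm X X (Ide D X) = Ide C (GO X)" if X: "X \<in> Obj D" for X
      by (rule uniq[OF GO[OF X] X Gm(1)[OF X X D.Ide_Hom[OF X]] C.Ide_Hom[OF GO[OF X]]
            Gm(2)[OF X X D.Ide_Hom[OF X]]])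
        (use X GO obj \<epsilon> in \<open>simp add: functor_Ide[OF F] D.Comp_Ide_left D.Comp_Ide_right\<close>)
    fix X Y Z f g assume X: "X \<in> Obj D" "Y \<in> Obj D" "Z \<in> Obj D" and f: "f \<in> Hom D X Y" "g \<in> Hom D Y Z"
    have gf: "Comp D X Y Z g f \<in> Hom D X Z" using D.Comp_Hom X f by blast
    show "Gm X Z (Comp D X Y Z g f) = Comp C (GO X) (GO Y) (GO Z) (Gm Y Z g) (Gm X Y f)"
    proof (rule uniq[OF GO[OF X(1)] X(3) Gm(1)[OF X(1,3) gf] _ Gm(2)[OF X(1,3) gf]])
      show "Comp C (GO X) (GO Y) (GO Z) (Gm Y Z g) (Gm X Y f) \<in> Hom C (GO X) (GO Z)"
        using C.Comp_Hom[OF GO[OF X(1)] GO[OF X(2)] GO[OF X(3)]] Gm X f by blast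
      show "Comp D (FObj F (GO X)) (FObj F (GO Z)) Z (\<epsilon> Z)
          (FMap F (GO X) (GO Z) (Comp C (GO X) (GO Y) (GO Z) (Gm Y Z g) (Gm X Y f)))
        = Comp D (FObj F (GO X)) X Z (Comp D X Y Z g f) (\<epsilon> X)"
        unfolding push[OF X(2,3) f(2) GO[OF X(1)] Gm(1)[OF X(1,2) f(1)]] Gm(2)[OF X(1,2) f(1)]
        by (rule D.Comp_assoc[OF obj[OF GO[OF X(1)]] X \<epsilon>[OF X(1)] f])
    qed
  qed
  have nat\<eta>: "Comp C X Y (GO (FObj F Y)) (\<eta> Y) f
      = Comp C X (GO (FObj F X)) (GO (FObj F Y)) (Gm (FObj F X) (FObj F Y) (FMap F X Y f)) (\<eta> X)"
    if X: "X \<in> Obj C" "Y \<in> Obj C" "f \<in> Hom C X Y" for X Y f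
  proof (rule uniq[OF X(1) obj[OF X(2)], of _ _ "FMap F X Y f"])
    have o: "FObj F X \<in> Obj D" "FObj F Y \<in> Obj D" "GO (FObj F X) \<in> Obj C" "GO (FObj F Y) \<in> Obj C"
      "FObj F (GO (FObj F Y)) \<in> Obj D" using X GO obj by auto
    have Ff: "FMap F X Y f \<in> Hom D (FObj F X) (FObj F Y)" using hom X by blast
    show "Comp C X Y (GO (FObj F Y)) (\<eta> Y) f \<in> Hom C X (GO (FObj F Y))"
      using C.Comp_Hom[OF X(1,2) o(4) X(3) \<eta>(1)[OF X(2)]] .
    show "Comp C X (GO (FObj F X)) (GO (FObj F Y)) (Gm (FObj F X) (FObj F Y) (FMap F X Y f)) (\<eta> X) \<in> Hom C X (GO (FObj F Y))"
      using C.Comp_Hom[OF X(1) o(3,4) \<eta>(1)[OF X(1)] Gm(1)[OF o(1,2) Ff]] .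
    show "Comp D (FObj F X) (FObj F (GO (FObj F Y))) (FObj F Y) (\<epsilon> (FObj F Y))
        (FMap F X (GO (FObj F Y)) (Comp C X Y (GO (FObj F Y)) (\<eta> Y) f)) = FMap F X Y f"
      unfolding functor_Comp[OF F X(1,2) o(4) X(3) \<eta>(1)[OF X(2)]]
        D.Comp_assoc[OF o(1,2,5,2) Ff hom[OF X(2) o(4) \<eta>(1)[OF X(2)]] \<epsilon>[OF o(2)]] \<eta>(2)[OF X(2)]
      by (rule D.Comp_Ide_left[OF o(1,2) Ff])
    show "Comp D (FObj F X) (FObj F (GO (FObj F Y))) (FObj F Y) (\<epsilon> (FObj F Y))
        (FMap F X (GO (FObj F Y)) (Comp C X (GO (FObj F X)) (GO (FObj F Y))
          (Gm (FObj F X) (FObj F Y) (FMap F X Y f)) (\<eta> X))) = FMap F X Y f"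
      unfolding push[OF o(1,2) Ff X(1) \<eta>(1)[OF X(1)]] \<eta>(2)[OF X(1)]
      by (rule D.Comp_Ide_right[OF o(1,2) Ff])
  qed
  have t2: "Comp C (GO Y) (GO (FObj F (GO Y))) (GO Y) (Gm (FObj F (GO Y)) Y (\<epsilon> Y)) (\<eta> (GO Y)) = Ide C (GO Y)"
    if Y: "Y \<in> Obj D" for Y
  proof (rule uniq[OF GO[OF Y] Y, of _ _ "\<epsilon> Y"])
    have o: "GO Y \<in> Obj C" "FObj F (GO Y) \<in> Obj D" "GO (FObj F (GO Y)) \<in> Obj C"
      using Y GO obj by auto
    show "Comp C (GO Y) (GO (FObj F (GO Y))) (GO Y) (Gm (FObj F (GO Y)) Y (\<epsilon> Y)) (\<eta> (GO Y)) \<in> Hom C (GO Y) (GO Y)"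
      using C.Comp_Hom[OF o(1,3,1) \<eta>(1)[OF o(1)] Gm(1)[OF o(2) Y \<epsilon>[OF Y]]] .
    show "Ide C (GO Y) \<in> Hom C (GO Y) (GO Y)" using C.Ide_Hom o by blast
    show "Comp D (FObj F (GO Y)) (FObj F (GO Y)) Y (\<epsilon> Y)
        (FMap F (GO Y) (GO Y) (Comp C (GO Y) (GO (FObj F (GO Y))) (GO Y) (Gm (FObj F (GO Y)) Y (\<epsilon> Y)) (\<eta> (GO Y)))) = \<epsilon> Y"
      unfolding push[OF o(2) Y \<epsilon>[OF Y] o(1) \<eta>(1)[OF o(1)]] \<eta>(2)[OF o(1)]
      by (rule D.Comp_Ide_right[OF o(2) Y \<epsilon>[OF Y]])
    show "Comp D (FObj F (GO Y)) (FObj F (GO Y)) Y (\<epsilon> Y) (FMap F (GO Y) (GO Y) (Ide C (GO Y))) = \<epsilon> Y"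
      unfolding functor_Ide[OF F o(1)] by (rule D.Comp_Ide_right[OF o(2) Y \<epsilon>[OF Y]])
  qed
  have "adjunction C D F G \<eta> \<epsilon>"
    unfolding adjunction_def natural_transformation_def id_functor_def comp_functor_def
    using F G \<eta> \<epsilon> nat\<eta> t2 Gm by (simp add: G_def)
  then show ?thesis by blast
qed

section \<open>Opposites, slices, pullbacks and the pullback functor\<close>

lemma (in category) category_op: "category (op_cat C)"
  by unfold_locales (auto simp: op_cat_def Ide_Hom Comp_Hom Comp_Ide_left Comp_Ide_right Comp_assoc)

lemma (in category) functor_hom:
  assumes "X \<in> Obj C" and "\<And>Y. Y \<in> Obj C \<Longrightarrow> Hom C X Y \<in> U"
  shows "is_functor C (set_cat U) (hom_functor C X)"
  unfolding is_functor_def set_cat_def hom_functor_def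
  using assms by (auto simp: compose_def Comp_Hom Comp_Ide_left Comp_assoc fun_eq_iff)

lemma functor_comp: "is_functor C D F \<Longrightarrow> is_functor D E G \<Longrightarrow> is_functor C E (comp_functor G F)"
  unfolding is_functor_def comp_functor_def by simp

lemma functor_op: "is_functor C D F \<Longrightarrow> is_functor (op_cat C) (op_cat D) (op_functor F)"
  unfolding is_functor_def op_cat_def op_functor_def by simp

lemma (in category) category_slice:
  assumes "I \<in> Obj C"
  shows "category (slice_cat C I)"
  by unfold_locales
    (use assms in \<open>auto simp: slice_cat_def Ide_Hom Comp_Hom Comp_Ide_left Comp_Ide_right Comp_assoc\<close>)

lemma slice_Obj: "(X, x) \<in> Obj (slice_cat C I) \<longleftrightarrow> X \<in> Obj C \<and> x \<in> Hom C X I"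
  and slice_Hom: "h \<in> Hom (slice_cat C I) (X, x) (Y, y) \<longleftrightarrow> h \<in> Hom C X Y \<and> Comp C X Y I y h = x"
  and slice_Comp: "Comp (slice_cat C I) (X, x) (Y, y) (Z, z) g f = Comp C X Y Z g f"
  and slice_Ide: "Ide (slice_cat C I) (X, x) = Ide C X"
  by (auto simp: slice_cat_def)

lemma pullbackD:
  assumes "is_pullback C P X Y Z p q f g"
  shows "P \<in> Obj C" "X \<in> Obj C" "Y \<in> Obj C" "Z \<in> Obj C"
    "p \<in> Hom C P X" "q \<in> Hom C P Y" "f \<in> Hom C X Z" "g \<in> Hom C Y Z"
    "Comp C P X Z f p = Comp C P Y Z g q"
  using assms unfolding is_pullback_def by blast+

lemma pullback_ex1:
  assumes "is_pullback C P X Y Z p q f g"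
    and "W \<in> Obj C" "h \<in> Hom C W X" "k \<in> Hom C W Y" "Comp C W X Z f h = Comp C W Y Z g k"
  shows "\<exists>!m. m \<in> Hom C W P \<and> Comp C W P X p m = h \<and> Comp C W P Y q m = k"
  using assms unfolding is_pullback_def by blast

lemma (in category) pullback_eq:
  assumes P: "is_pullback C P X Y Z p q f g"
    and m: "W \<in> Obj C" "m \<in> Hom C W P" "m' \<in> Hom C W P"
    and eq: "Comp C W P X p m = Comp C W P X p m'" "Comp C W P Y q m = Comp C W P Y q m'"
  shows "m = m'"
proof -
  note d = pullbackD[OF P]
  have "Comp C W X Z f (Comp C W P X p m) = Comp C W Y Z g (Comp C W P Y q m)"
    using d m by (simp add: Comp_assoc)
  from pullback_ex1[OF P m(1) _ _ this] show ?thesis using d m eq Comp_Hom by (metis (no_types, lifting))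
qed

lemma has_finite_limits_pullback:
  assumes "category C" and lim: "has_finite_limits C"
    and o: "X \<in> Obj C" "Y \<in> Obj C" "Z \<in> Obj C" and f: "f \<in> Hom C X Z" and g: "g \<in> Hom C Y Z"
  shows "\<exists>P p q. is_pullback C P X Y Z p q f g"
proof -
  interpret category C by fact
  \<comment> \<open>The shape of a cospan, with arrows from \<open>0\<close> and from
    \<open>1\<close> to \<open>2\<close>. Hom-sets may overlap, so \<open>0\<close> serves as the
    only arrow of each inhabited hom-set.\<close>
  define J :: "(nat, nat) cat" where
    "J = \<lparr>Obj = {0, 1, 2}, Hom = (\<lambda>j k. if j = k \<or> k = 2 then {0} else {}),
      Comp = (\<lambda>_ _ _ _ _. 0), Ide = (\<lambda>_. 0)\<rparr>"
  define DO where "DO j = (if j = 0 then X else if j = 1 then Y else Z)" for j :: nat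
  define D where "D = \<lparr>FObj = DO,
    FMap = (\<lambda>j k (_ :: nat). if j = k then Ide C (DO j) else if j = 0 then f else g)\<rparr>"
  have "category J"
    by unfold_locales (auto simp: J_def split: if_splits)
  then have "finite_category J"
    unfolding finite_category_def by (auto simp: J_def)
  moreover have "is_functor J C D"
    unfolding is_functor_def
    using o f g by (auto simp: J_def D_def DO_def Ide_Hom Comp_Ide_left Comp_Ide_right split: if_splits)
  ultimately obtain P l where L: "is_limit J C D P l" using lim unfolding has_finite_limits_def by blast
  have cone_iff: "is_cone J C D W \<mu> \<longleftrightarrow> W \<in> Obj C \<and> \<mu> 0 \<in> Hom C W X \<and> \<mu> 1 \<in> Hom C W Y \<and> \<mu> 2 \<in> Hom C W Z \<and>
      Comp C W X Z f (\<mu> 0) = \<mu> 2 \<and> Comp C W Y Z g (\<mu> 1) = \<mu> 2" for W \<mu>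
    unfolding is_cone_def using o
    by (auto simp: J_def D_def DO_def Comp_Ide_left split: if_splits)
  have l: "P \<in> Obj C" "l 0 \<in> Hom C P X" "l 1 \<in> Hom C P Y" "Comp C P X Z f (l 0) = l 2" "Comp C P Y Z g (l 1) = l 2"
    using L unfolding is_limit_def cone_iff by auto
  have "\<exists>!m. m \<in> Hom C W P \<and> Comp C W P X (l 0) m = h \<and> Comp C W P Y (l 1) m = k"
    if W: "W \<in> Obj C" "h \<in> Hom C W X" "k \<in> Hom C W Y" "Comp C W X Z f h = Comp C W Y Z g k" for W h k
  proof -
    define \<mu> where "\<mu> j = (if j = 0 then h else if j = 1 then k else Comp C W X Z f h)" for j :: nat
    have "is_cone J C D W \<mu>"
      unfolding cone_iff \<mu>_def using W o f g by (auto intro: Comp_Hom)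
    then have ex: "\<exists>!m. m \<in> Hom C W P \<and> (\<forall>j\<in>Obj J. Comp C W P (FObj D j) (l j) m = \<mu> j)"
      using L unfolding is_limit_def by blast
    \<comment> \<open>A mediating arrow is constrained by three legs, but the leg into
      \<open>Z\<close> follows from the leg into \<open>X\<close>.\<close>
    have "(\<forall>j\<in>Obj J. Comp C W P (FObj D j) (l j) m = \<mu> j) \<longleftrightarrow>
        Comp C W P X (l 0) m = h \<and> Comp C W P Y (l 1) m = k" if m: "m \<in> Hom C W P" for m
    proof -
      have "Comp C W P Z (l 2) m = Comp C W X Z f (Comp C W P X (l 0) m)"
        unfolding l(4)[symmetric] by (rule Comp_assoc[symmetric, OF W(1) l(1) o(1,3) m l(2) f])
      then show ?thesis by (auto simp: J_def D_def DO_def \<mu>_def)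
    qed
    with ex show ?thesis by (metis (no_types, lifting))
  qed
  then have "is_pullback C P X Y Z (l 0) (l 1) f g"
    unfolding is_pullback_def using l o f g by (intro conjI ballI impI) auto
  then show ?thesis by blast
qed

locale lex_category = category +
  assumes lim: "has_finite_limits C"
begin

lemma ex_pullback:
  assumes "X \<in> Obj C" "Y \<in> Obj C" "Z \<in> Obj C" "f \<in> Hom C X Z" "g \<in> Hom C Y Z"
  obtains P p q where "is_pullback C P X Y Z p q f g"
  using has_finite_limits_pullback[OF category_axioms lim assms] by blast

lemma chosen_pullback:
  assumes "J \<in> Obj C" "I \<in> Obj C" "u \<in> Hom C J I" "(X, x) \<in> Obj (slice_cat C I)"
  obtains P p q where "chosen_pullback C J I u (X, x) = (P, p, q)" "is_pullback C P J X I p q u x"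
proof -
  obtain P p q where "is_pullback C P J X I p q u x"
    using assms by (auto simp: slice_Obj intro: ex_pullback)
  then have "case (P, p, q) of (P, p, q) \<Rightarrow> is_pullback C P J (fst (X, x)) I p q u (snd (X, x))" by simp
  from someI[of "\<lambda>(P, p, q). is_pullback C P J (fst (X, x)) I p q u (snd (X, x))", OF this]
  have "case chosen_pullback C J I u (X, x) of (P, p, q) \<Rightarrow> is_pullback C P J X I p q u x"
    unfolding chosen_pullback_def by simp
  then show thesis by (auto split: prod.splits intro: that)
qed

lemma pullback_functor_map:
  assumes P: "chosen_pullback C J I u (X, x) = (P, p, q)" "is_pullback C P J X I p q u x"
    and P': "chosen_pullback C J I u (X', x') = (P', p', q')" "is_pullback C P' J X' I p' q' u x'"
    and h: "h \<in> Hom (slice_cat C I) (X, x) (X', x')"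
  shows "FMap (pullback_functor C J I u) (X, x) (X', x') h \<in> Hom C P P'"
    "Comp C P P' J p' (FMap (pullback_functor C J I u) (X, x) (X', x') h) = p"
    "Comp C P P' X' q' (FMap (pullback_functor C J I u) (X, x) (X', x') h) = Comp C P X X' h q"
proof -
  note d = pullbackD[OF P(2)] and d' = pullbackD[OF P'(2)]
  have h: "h \<in> Hom C X X'" "Comp C X X' I x' h = x" using h by (auto simp: slice_Hom)
  have "Comp C P X' I x' (Comp C P X X' h q) = Comp C P X I x q"
    using d d' h by (simp add: Comp_assoc)
  then have eq: "Comp C P J I u p = Comp C P X' I x' (Comp C P X X' h q)" using d by simp
  have "\<exists>!m. m \<in> Hom C P P' \<and> Comp C P P' J p' m = p \<and> Comp C P P' X' q' m = Comp C P X X' h q"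
    by (rule pullback_ex1[OF P'(2) d(1) d(5) _ eq]) (use d d' h in \<open>auto intro: Comp_Hom\<close>)
  from theI'[OF this]
  show "FMap (pullback_functor C J I u) (X, x) (X', x') h \<in> Hom C P P'"
    "Comp C P P' J p' (FMap (pullback_functor C J I u) (X, x) (X', x') h) = p"
    "Comp C P P' X' q' (FMap (pullback_functor C J I u) (X, x) (X', x') h) = Comp C P X X' h q"
    unfolding pullback_functor_def using P P' by auto
qed

lemma functor_pullback:
  assumes J: "J \<in> Obj C" "I \<in> Obj C" "u \<in> Hom C J I"
  shows "is_functor (slice_cat C I) (slice_cat C J) (pullback_functor C J I u)"
proof -
  let ?F = "pullback_functor C J I u"
  have FObj: "FObj ?F (X, x) = (P, p)" if "chosen_pullback C J I u (X, x) = (P, p, q)" for X x P p q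
    using that unfolding pullback_functor_def by simp
  show ?thesis
    unfolding is_functor_def
  proof (intro conjI ballI; clarify)
    fix X x assume X: "(X, x) \<in> Obj (slice_cat C I)"
    obtain P p q where P: "chosen_pullback C J I u (X, x) = (P, p, q)" "is_pullback C P J X I p q u x"
      using chosen_pullback[OF J X] .
    note d = pullbackD[OF P(2)]
    show "FObj ?F (X, x) \<in> Obj (slice_cat C J)" using FObj[OF P(1)] d by (simp add: slice_Obj)
    have "Ide (slice_cat C I) (X, x) \<in> Hom (slice_cat C I) (X, x) (X, x)"
      using category.Ide_Hom[OF category_slice[OF J(2)] X] .
    note m = pullback_functor_map[OF P P this, unfolded slice_Ide]
    show "FMap ?F (X, x) (X, x) (Ide (slice_cat C I) (X, x)) = Ide (slice_cat C J) (FObj ?F (X, x))"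
      unfolding FObj[OF P(1)] slice_Ide
      by (rule pullback_eq[OF P(2) d(1) m(1) Ide_Hom[OF d(1)]])
        (use d in \<open>simp_all add: m(2,3) Comp_Ide_left Comp_Ide_right\<close>)
  next
    fix X x Y y h assume X: "(X, x) \<in> Obj (slice_cat C I)" and Y: "(Y, y) \<in> Obj (slice_cat C I)"
      and h: "h \<in> Hom (slice_cat C I) (X, x) (Y, y)"
    obtain P p q where P: "chosen_pullback C J I u (X, x) = (P, p, q)" "is_pullback C P J X I p q u x"
      using chosen_pullback[OF J X] .
    obtain Q s t where Q: "chosen_pullback C J I u (Y, y) = (Q, s, t)" "is_pullback C Q J Y I s t u y"
      using chosen_pullback[OF J Y] .
    note m = pullback_functor_map[OF P Q h]
    show "FMap ?F (X, x) (Y, y) h \<in> Hom (slice_cat C J) (FObj ?F (X, x)) (FObj ?F (Y, y))"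
      unfolding FObj[OF P(1)] FObj[OF Q(1)] slice_Hom using m by simp
  next
    fix X x Y y Z z h k
    assume X: "(X, x) \<in> Obj (slice_cat C I)" and Y: "(Y, y) \<in> Obj (slice_cat C I)"
      and Z: "(Z, z) \<in> Obj (slice_cat C I)"
      and h: "h \<in> Hom (slice_cat C I) (X, x) (Y, y)" and k: "k \<in> Hom (slice_cat C I) (Y, y) (Z, z)"
    obtain P p q where P: "chosen_pullback C J I u (X, x) = (P, p, q)" "is_pullback C P J X I p q u x"
      using chosen_pullback[OF J X] .
    obtain Q s t where Q: "chosen_pullback C J I u (Y, y) = (Q, s, t)" "is_pullback C Q J Y I s t u y"
      using chosen_pullback[OF J Y] .
    obtain R v w where R: "chosen_pullback C J I u (Z, z) = (R, v, w)" "is_pullback C R J Z I v w u z"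
      using chosen_pullback[OF J Z] .
    note dP = pullbackD[OF P(2)] and dQ = pullbackD[OF Q(2)] and dR = pullbackD[OF R(2)]
    have kh: "Comp (slice_cat C I) (X, x) (Y, y) (Z, z) k h \<in> Hom (slice_cat C I) (X, x) (Z, z)"
      using category.Comp_Hom[OF category_slice[OF J(2)] X Y Z h k] .
    note mh = pullback_functor_map[OF P Q h] and mk = pullback_functor_map[OF Q R k]
      and mkh = pullback_functor_map[OF P R kh, unfolded slice_Comp]
    have h': "h \<in> Hom C X Y" and k': "k \<in> Hom C Y Z" using h k by (auto simp: slice_Hom)
    let ?h = "FMap ?F (X, x) (Y, y) h" and ?k = "FMap ?F (Y, y) (Z, z) k"
    show "FMap ?F (X, x) (Z, z) (Comp (slice_cat C I) (X, x) (Y, y) (Z, z) k h)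
      = Comp (slice_cat C J) (FObj ?F (X, x)) (FObj ?F (Y, y)) (FObj ?F (Z, z)) ?k ?h"
      unfolding FObj[OF P(1)] FObj[OF Q(1)] FObj[OF R(1)] slice_Comp
    proof (rule pullback_eq[OF R(2) dP(1) mkh(1) Comp_Hom[OF dP(1) dQ(1) dR(1) mh(1) mk(1)]])
      show "Comp C P R J v (FMap ?F (X, x) (Z, z) (Comp C X Y Z k h))
        = Comp C P R J v (Comp C P Q R ?k ?h)"
        unfolding mkh(2) Comp_assoc[OF dP(1) dQ(1) dR(1,2) mh(1) mk(1) dR(5)] mk(2) mh(2) ..
      show "Comp C P R Z w (FMap ?F (X, x) (Z, z) (Comp C X Y Z k h))
        = Comp C P R Z w (Comp C P Q R ?k ?h)"
        unfolding mkh(3) Comp_assoc[OF dP(1) dQ(1) dR(1,3) mh(1) mk(1) dR(6)] mk(3)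
          Comp_assoc[OF dP(1) dQ(1) dQ(3) dR(3) mh(1) dQ(6) k', symmetric] mh(3)
        by (rule Comp_assoc[OF dP(1) dP(3) dQ(3) dR(3) dP(6) h' k', symmetric])
    qed
  qed
qed

end

text \<open>Yoneda: a natural transformation out of a representable presheaf is given by one element
  \<open>w\<close>, the image of the identity of \<open>R\<close>, and it is surjective exactly when
  every element is a restriction of \<open>w\<close>.\<close>

lemma (in category) weakly_representable_iff:
  assumes P: "is_functor (op_cat C) (set_cat UNIV) P"
  shows "weakly_representable C P \<longleftrightarrow>
    (\<exists>R\<in>Obj C. \<exists>w\<in>FObj P R. \<forall>X\<in>Obj C. \<forall>m\<in>FObj P X. \<exists>k\<in>Hom C X R. FMap P R X k w = m)"
proof
  have hom: "FMap (hom_functor (op_cat C) R) X Y k h = Comp C Y X R h k" if "h \<in> Hom C X R" for R X Y k h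
    using that unfolding hom_functor_def op_cat_def by simp
  have hom_obj: "FObj (hom_functor (op_cat C) R) X = Hom C X R" for R X
    unfolding hom_functor_def op_cat_def by simp
  {
    assume "weakly_representable C P"
    then obtain R \<alpha> where R: "R \<in> Obj C"
      and nt: "natural_transformation (op_cat C) (set_cat UNIV) (hom_functor (op_cat C) R) P \<alpha>"
      and onto: "\<And>X. X \<in> Obj C \<Longrightarrow> \<alpha> X ` Hom C X R = FObj P X"
      unfolding weakly_representable_def by blast
    have nat: "compose (Hom C X R) (\<alpha> Y) (FMap (hom_functor (op_cat C) R) X Y k) = compose (Hom C X R) (FMap P X Y k) (\<alpha> X)"
      if "X \<in> Obj C" "Y \<in> Obj C" "k \<in> Hom C Y X" for X Y k
      using nt that unfolding natural_transformation_def hom_obj by (simp add: op_cat_def set_cat_def)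
    have *: "FMap P R X k (\<alpha> R (Ide C R)) = \<alpha> X k" if "X \<in> Obj C" "k \<in> Hom C X R" for X k
      using fun_cong[OF nat[OF R that], of "Ide C R"] R that Ide_Hom[OF R]
      by (simp add: compose_def hom Comp_Ide_left)
    have "\<exists>k\<in>Hom C X R. FMap P R X k (\<alpha> R (Ide C R)) = m" if "X \<in> Obj C" "m \<in> FObj P X" for X m
    proof -
      have "m \<in> \<alpha> X ` Hom C X R" using onto that by simp
      then show ?thesis using * that(1) by blast
    qed
    moreover have "\<alpha> R (Ide C R) \<in> FObj P R" using onto[OF R] Ide_Hom[OF R] by blast
    ultimately show "\<exists>R\<in>Obj C. \<exists>w\<in>FObj P R. \<forall>X\<in>Obj C. \<forall>m\<in>FObj P X. \<exists>k\<in>Hom C X R. FMap P R X k w = m"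
      using R by blast
  }
  assume "\<exists>R\<in>Obj C. \<exists>w\<in>FObj P R. \<forall>X\<in>Obj C. \<forall>m\<in>FObj P X. \<exists>k\<in>Hom C X R. FMap P R X k w = m"
  then obtain R w where R: "R \<in> Obj C" and w: "w \<in> FObj P R"
    and onto: "\<And>X m. X \<in> Obj C \<Longrightarrow> m \<in> FObj P X \<Longrightarrow> \<exists>k\<in>Hom C X R. FMap P R X k w = m" by blast
  define \<alpha> where "\<alpha> X = (\<lambda>k\<in>Hom C X R. FMap P R X k w)" for X
  have PM: "FMap P X Y k \<in> FObj P X \<rightarrow>\<^sub>E FObj P Y" if "X \<in> Obj C" "Y \<in> Obj C" "k \<in> Hom C Y X" for X Y k
    using functor_map[OF P, of X Y k] that by (simp add: op_cat_def set_cat_def)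
  have PC: "FMap P R Y (Comp C Y X R h k) w = FMap P X Y k (FMap P R X h w)"
    if "X \<in> Obj C" "Y \<in> Obj C" "k \<in> Hom C Y X" "h \<in> Hom C X R" for X Y k h
    using functor_Comp[OF P, of R X Y h k] that R w by (simp add: op_cat_def set_cat_def compose_def)
  have mem: "FMap P R X k w \<in> FObj P X" if "X \<in> Obj C" "k \<in> Hom C X R" for X k
    using PM[OF R that] w by blast
  have "natural_transformation (op_cat C) (set_cat UNIV) (hom_functor (op_cat C) R) P \<alpha>"
    unfolding natural_transformation_def hom_obj
  proof (intro conjI ballI)
    show "\<alpha> X \<in> Hom (set_cat UNIV) (Hom C X R) (FObj P X)" if "X \<in> Obj (op_cat C)" for X
      using that mem unfolding \<alpha>_def by (simp add: op_cat_def set_cat_def)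
    show "Comp (set_cat UNIV) (Hom C X R) (Hom C Y R) (FObj P Y) (\<alpha> Y) (FMap (hom_functor (op_cat C) R) X Y k)
      = Comp (set_cat UNIV) (Hom C X R) (FObj P X) (FObj P Y) (FMap P X Y k) (\<alpha> X)"
      if "X \<in> Obj (op_cat C)" "Y \<in> Obj (op_cat C)" "k \<in> Hom (op_cat C) X Y" for X Y k
    proof -
      have XY: "X \<in> Obj C" "Y \<in> Obj C" "k \<in> Hom C Y X" using that by (simp_all add: op_cat_def)
      have "\<alpha> Y (FMap (hom_functor (op_cat C) R) X Y k h) = FMap P X Y k (\<alpha> X h)" if h: "h \<in> Hom C X R" for h
        unfolding hom[OF h] \<alpha>_def using PC[OF XY h] h Comp_Hom[OF XY(2,1) R XY(3) h] by simp
      then show ?thesis by (simp add: set_cat_def compose_def cong: restrict_cong)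
    qed
  qed
  moreover have "\<alpha> X ` Hom C X R = FObj P X" if "X \<in> Obj C" for X
  proof
    show "\<alpha> X ` Hom C X R \<subseteq> FObj P X" using that mem unfolding \<alpha>_def by auto
    show "FObj P X \<subseteq> \<alpha> X ` Hom C X R"
    proof
      fix m assume "m \<in> FObj P X"
      from onto[OF that this] obtain k where "k \<in> Hom C X R" "FMap P R X k w = m" by blast
      then show "m \<in> \<alpha> X ` Hom C X R" unfolding \<alpha>_def by (auto intro!: image_eqI[of _ _ k])
    qed
  qed
  ultimately show "weakly_representable C P" unfolding weakly_representable_def using R by blast
qed

section \<open>Weak local cartesian closure without chosen pullbacks\<close>

context lex_category
begin

lemma functor_slice_hom:
  assumes "J \<in> Obj C" "I \<in> Obj C" "u \<in> Hom C J I" "B \<in> Obj C" "b \<in> Hom C B J"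
  shows "is_functor (op_cat (slice_cat C I)) (set_cat UNIV) (slice_hom_presheaf C B J I b u)"
  unfolding slice_hom_presheaf_def
proof (rule functor_comp[OF functor_op[OF functor_pullback[OF assms(1-3)]]])
  show "is_functor (op_cat (slice_cat C J)) (set_cat UNIV) (hom_functor (op_cat (slice_cat C J)) (B, b))"
    by (rule category.functor_hom[OF category.category_op[OF category_slice[OF assms(1)]]])
      (use assms in \<open>auto simp: op_cat_def slice_Obj\<close>)
qed

lemma slice_hom_obj:
  assumes "chosen_pullback C J I u (X, x) = (P, p, q)"
  shows "FObj (slice_hom_presheaf C B J I b u) (X, x) = {m \<in> Hom C P B. Comp C P B J b m = p}"
  using assms unfolding slice_hom_presheaf_def comp_functor_def op_functor_def hom_functor_def op_cat_def
    pullback_functor_def by (auto simp: slice_Hom)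

lemma slice_hom_map:
  assumes "chosen_pullback C J I u (X, x) = (P, p, q)" "chosen_pullback C J I u (R, r) = (Q, s, t)"
    and "w \<in> Hom C Q B" "Comp C Q B J b w = s"
  shows "FMap (slice_hom_presheaf C B J I b u) (R, r) (X, x) k w
    = Comp C P Q B w (FMap (pullback_functor C J I u) (X, x) (R, r) k)"
  using assms unfolding slice_hom_presheaf_def comp_functor_def op_functor_def hom_functor_def op_cat_def
  by (auto simp: pullback_functor_def slice_Hom slice_Comp)

text \<open>The hypothesis speaks about every pullback square, hence about the chosen ones. The
  arrow that the pullback functor assigns to \<open>k\<close> enters only through its two
  projections, as \<open>n\<close>.\<close>

lemma weakly_locally_cartesian_closedI:
  assumes "\<And>B J I b u. B \<in> Obj C \<Longrightarrow> J \<in> Obj C \<Longrightarrow> I \<in> Obj C \<Longrightarrow> b \<in> Hom C B J \<Longrightarrow> u \<in> Hom C J I \<Longrightarrow>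
    \<exists>R\<in>Obj C. \<exists>r\<in>Hom C R I. \<forall>P p q. is_pullback C P J R I p q u r \<longrightarrow>
      (\<exists>w\<in>Hom C P B. Comp C P B J b w = p \<and> (\<forall>X x P' p' q' m.
        is_pullback C P' J X I p' q' u x \<and> m \<in> Hom C P' B \<and> Comp C P' B J b m = p' \<longrightarrow>
        (\<exists>k\<in>Hom C X R. Comp C X R I r k = x \<and> (\<forall>n\<in>Hom C P' P. Comp C P' P J p n = p' \<and>
          Comp C P' P R q n = Comp C P' X R k q' \<longrightarrow> Comp C P' P B w n = m))))"
  shows "weakly_locally_cartesian_closed C"
  unfolding weakly_locally_cartesian_closed_def
proof (intro conjI ballI)
  fix B J I b u
  assume B: "B \<in> Obj C" "b \<in> Hom C B J" and J: "J \<in> Obj C" "I \<in> Obj C" "u \<in> Hom C J I"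
  obtain R r where R: "R \<in> Obj C" "r \<in> Hom C R I" and
    Rw: "\<And>P p q. is_pullback C P J R I p q u r \<Longrightarrow>
      (\<exists>w\<in>Hom C P B. Comp C P B J b w = p \<and> (\<forall>X x P' p' q' m.
        is_pullback C P' J X I p' q' u x \<and> m \<in> Hom C P' B \<and> Comp C P' B J b m = p' \<longrightarrow>
        (\<exists>k\<in>Hom C X R. Comp C X R I r k = x \<and> (\<forall>n\<in>Hom C P' P. Comp C P' P J p n = p' \<and>
          Comp C P' P R q n = Comp C P' X R k q' \<longrightarrow> Comp C P' P B w n = m))))"
    using assms[OF B(1) J(1,2) B(2) J(3)] by blast
  have Ro: "(R, r) \<in> Obj (slice_cat C I)" using R by (simp add: slice_Obj)
  obtain P p q where P: "chosen_pullback C J I u (R, r) = (P, p, q)" "is_pullback C P J R I p q u r"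
    using chosen_pullback[OF J Ro] .
  obtain w where w: "w \<in> Hom C P B" "Comp C P B J b w = p" and
    univ: "\<And>X x P' p' q' m. is_pullback C P' J X I p' q' u x \<Longrightarrow> m \<in> Hom C P' B \<Longrightarrow> Comp C P' B J b m = p' \<Longrightarrow>
        (\<exists>k\<in>Hom C X R. Comp C X R I r k = x \<and> (\<forall>n\<in>Hom C P' P. Comp C P' P J p n = p' \<and>
          Comp C P' P R q n = Comp C P' X R k q' \<longrightarrow> Comp C P' P B w n = m))"
    using Rw[OF P(2)] by blast
  show "weakly_representable (slice_cat C I) (slice_hom_presheaf C B J I b u)"
    unfolding category.weakly_representable_iff[OF category_slice[OF J(2)] functor_slice_hom[OF J B]]
  proof (rule bexI[of _ "(R, r)"], rule bexI[of _ w], intro ballI)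
    show "(R, r) \<in> Obj (slice_cat C I)" by fact
    show "w \<in> FObj (slice_hom_presheaf C B J I b u) (R, r)"
      unfolding slice_hom_obj[OF P(1)] using w by simp
    fix S m assume S: "S \<in> Obj (slice_cat C I)" and m: "m \<in> FObj (slice_hom_presheaf C B J I b u) S"
    obtain X x where Xx: "S = (X, x)" by fastforce
    obtain P' p' q' where P': "chosen_pullback C J I u (X, x) = (P', p', q')" "is_pullback C P' J X I p' q' u x"
      using chosen_pullback[OF J S[unfolded Xx]] .
    have m: "m \<in> Hom C P' B" "Comp C P' B J b m = p'" using m unfolding Xx slice_hom_obj[OF P'(1)] by auto
    obtain k where k: "k \<in> Hom C X R" "Comp C X R I r k = x" and
      n: "\<And>n. n \<in> Hom C P' P \<Longrightarrow> Comp C P' P J p n = p' \<Longrightarrow>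
          Comp C P' P R q n = Comp C P' X R k q' \<Longrightarrow> Comp C P' P B w n = m"
      using univ[OF P'(2) m] by blast
    have k': "k \<in> Hom (slice_cat C I) (X, x) (R, r)" using k by (simp add: slice_Hom)
    have "FMap (slice_hom_presheaf C B J I b u) (R, r) (X, x) k w = m"
      unfolding slice_hom_map[OF P'(1) P(1) w] using pullback_functor_map[OF P' P k'] by (rule n)
    then show "\<exists>k\<in>Hom (slice_cat C I) S (R, r). FMap (slice_hom_presheaf C B J I b u) (R, r) S k w = m"
      unfolding Xx using k' by blast
  qed
qed (rule category_axioms, rule lim)

text \<open>For use, one pullback square over each \<open>x\<close> is enough, and the chosen ones
  are returned. \<open>w\<close> plays the role of evaluation, \<open>k\<close> names the section
  \<open>m\<close>, and \<open>n\<close> is the pullback of \<open>k\<close>.\<close>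

lemma weakly_locally_cartesian_closedD:
  assumes wlcc: "weakly_locally_cartesian_closed C"
    and B: "B \<in> Obj C" "b \<in> Hom C B J" and J: "J \<in> Obj C" "I \<in> Obj C" "u \<in> Hom C J I"
  shows "\<exists>R r P p q w. is_pullback C P J R I p q u r \<and> w \<in> Hom C P B \<and> Comp C P B J b w = p \<and>
    (\<forall>X\<in>Obj C. \<forall>x\<in>Hom C X I. \<exists>P' p' q'. is_pullback C P' J X I p' q' u x \<and>
      (\<forall>m\<in>Hom C P' B. Comp C P' B J b m = p' \<longrightarrow>
        (\<exists>k\<in>Hom C X R. Comp C X R I r k = x \<and> (\<exists>n\<in>Hom C P' P. Comp C P' P J p n = p' \<and>
          Comp C P' P R q n = Comp C P' X R k q' \<and> Comp C P' P B w n = m))))"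
proof -
  have "weakly_representable (slice_cat C I) (slice_hom_presheaf C B J I b u)"
    using wlcc B J unfolding weakly_locally_cartesian_closed_def by blast
  then obtain S w where S: "S \<in> Obj (slice_cat C I)" and w: "w \<in> FObj (slice_hom_presheaf C B J I b u) S"
    and univ: "\<And>X m. X \<in> Obj (slice_cat C I) \<Longrightarrow> m \<in> FObj (slice_hom_presheaf C B J I b u) X \<Longrightarrow>
      \<exists>k\<in>Hom (slice_cat C I) X S. FMap (slice_hom_presheaf C B J I b u) S X k w = m"
    unfolding category.weakly_representable_iff[OF category_slice[OF J(2)] functor_slice_hom[OF J B]] by blast
  obtain R r where Rr: "S = (R, r)" by fastforce
  obtain P p q where P: "chosen_pullback C J I u (R, r) = (P, p, q)" "is_pullback C P J R I p q u r"
    using chosen_pullback[OF J S[unfolded Rr]] .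
  have w: "w \<in> Hom C P B" "Comp C P B J b w = p" using w unfolding Rr slice_hom_obj[OF P(1)] by auto
  have "\<exists>P' p' q'. is_pullback C P' J X I p' q' u x \<and>
      (\<forall>m\<in>Hom C P' B. Comp C P' B J b m = p' \<longrightarrow>
        (\<exists>k\<in>Hom C X R. Comp C X R I r k = x \<and> (\<exists>n\<in>Hom C P' P. Comp C P' P J p n = p' \<and>
          Comp C P' P R q n = Comp C P' X R k q' \<and> Comp C P' P B w n = m)))"
    if X: "X \<in> Obj C" "x \<in> Hom C X I" for X x
  proof -
    have Xx: "(X, x) \<in> Obj (slice_cat C I)" using X by (simp add: slice_Obj)
    obtain P' p' q' where P': "chosen_pullback C J I u (X, x) = (P', p', q')" "is_pullback C P' J X I p' q' u x"
      using chosen_pullback[OF J Xx] .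
    have "\<exists>k\<in>Hom C X R. Comp C X R I r k = x \<and> (\<exists>n\<in>Hom C P' P. Comp C P' P J p n = p' \<and>
          Comp C P' P R q n = Comp C P' X R k q' \<and> Comp C P' P B w n = m)"
      if m: "m \<in> Hom C P' B" "Comp C P' B J b m = p'" for m
    proof -
      have "m \<in> FObj (slice_hom_presheaf C B J I b u) (X, x)" unfolding slice_hom_obj[OF P'(1)] using m by simp
      from univ[OF Xx this] obtain k where k: "k \<in> Hom (slice_cat C I) (X, x) (R, r)"
        and "FMap (slice_hom_presheaf C B J I b u) (R, r) (X, x) k w = m" unfolding Rr by blast
      then show ?thesis
        unfolding slice_hom_map[OF P'(1) P(1) w] using pullback_functor_map[OF P' P k] k
        unfolding slice_Hom by blast
    qed
    then show ?thesis using P' by blast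
  qed
  then show ?thesis using P w by blast
qed

end

section \<open>Local categories\<close>

lemma ex1_iff: "(\<And>x. P x \<longleftrightarrow> Q x) \<Longrightarrow> \<exists>!x. P x \<Longrightarrow> \<exists>!x. Q x"
  by simp

locale local_cat = set_universe U + lex_category C
  for U :: "'u set set" and C :: "('o, 'u) cat" +
  fixes T :: 'o and N :: "('u set, 'u \<Rightarrow> 'u, 'o, 'u) fun_data" and \<eta> :: "'o \<Rightarrow> 'u"
    and \<epsilon> :: "'u set \<Rightarrow> 'u \<Rightarrow> 'u"
  assumes local: "local_category U C T N \<eta> \<epsilon>"
begin

abbreviation pts :: "'o \<Rightarrow> 'u set" where "pts X \<equiv> Hom C T X"

lemma T_obj: "T \<in> Obj C"
  using local unfolding local_category_def is_terminal_def by blast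

lemma ex_terminal: "X \<in> Obj C \<Longrightarrow> \<exists>!f. f \<in> Hom C X T"
  using local unfolding local_category_def is_terminal_def by blast

lemma Hom_U: "X \<in> Obj C \<Longrightarrow> Y \<in> Obj C \<Longrightarrow> Hom C X Y \<in> U"
  using local unfolding local_category_def locally_small_def by blast

lemma adj: "adjunction C (set_cat U) (hom_functor C T) N \<eta> \<epsilon>"
  using local unfolding local_category_def by blast

lemma pts_T: "pts T = {Ide C T}"
  using ex_terminal[OF T_obj] Ide_Hom[OF T_obj] by blast

lemma pts_U: "X \<in> Obj C \<Longrightarrow> pts X \<in> U"
  using Hom_U T_obj by blast

lemma ap_pts: "X \<in> Obj C \<Longrightarrow> Y \<in> Obj C \<Longrightarrow> f \<in> Hom C X Y \<Longrightarrow> x \<in> pts X \<Longrightarrow> Comp C T X Y f x \<in> pts Y"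
  using Comp_Hom T_obj by blast

lemma ap_comp:
  "X \<in> Obj C \<Longrightarrow> Y \<in> Obj C \<Longrightarrow> Z \<in> Obj C \<Longrightarrow> f \<in> Hom C X Y \<Longrightarrow> g \<in> Hom C Y Z \<Longrightarrow> x \<in> pts X \<Longrightarrow>
    Comp C T X Z (Comp C X Y Z g f) x = Comp C T Y Z g (Comp C T X Y f x)"
  using Comp_assoc[OF T_obj] by simp

section \<open>The right adjoint of global sections, point by point\<close>

lemma nabla_obj: "S \<in> U \<Longrightarrow> FObj N S \<in> Obj C"
  using adj unfolding adjunction_def is_functor_def set_cat_def by simp

lemma \<epsilon>_mem: "S \<in> U \<Longrightarrow> v \<in> pts (FObj N S) \<Longrightarrow> \<epsilon> S v \<in> S"
  using adj unfolding adjunction_def natural_transformation_def set_cat_def comp_functor_def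
    hom_functor_def id_functor_def by auto

text \<open>Transposition across the adjunction, with both sides evaluated at points.\<close>

lemma nabla_ex1:
  assumes X: "X \<in> Obj C" "S \<in> U" and k: "k \<in> pts X \<rightarrow> S"
  shows "\<exists>!m. m \<in> Hom C X (FObj N S) \<and> (\<forall>x\<in>pts X. \<epsilon> S (Comp C T X (FObj N S) m x) = k x)"
proof -
  have k': "restrict k (pts X) \<in> Hom (set_cat U) (FObj (hom_functor C T) X) S"
    using k by (auto simp: set_cat_def hom_functor_def)
  have S: "S \<in> Obj (set_cat U)" using X by (simp add: set_cat_def)
  have iff: "Comp (set_cat U) (FObj (hom_functor C T) X) (FObj (hom_functor C T) (FObj N S)) S (\<epsilon> S)
      (FMap (hom_functor C T) X (FObj N S) m) = restrict k (pts X) \<longleftrightarrow>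
      (\<forall>x\<in>pts X. \<epsilon> S (Comp C T X (FObj N S) m x) = k x)" for m
  proof
    assume "Comp (set_cat U) (FObj (hom_functor C T) X) (FObj (hom_functor C T) (FObj N S)) S (\<epsilon> S)
      (FMap (hom_functor C T) X (FObj N S) m) = restrict k (pts X)"
    then have "compose (pts X) (\<epsilon> S) (\<lambda>x\<in>pts X. Comp C T X (FObj N S) m x) x = restrict k (pts X) x" for x
      by (simp add: set_cat_def hom_functor_def)
    then show "\<forall>x\<in>pts X. \<epsilon> S (Comp C T X (FObj N S) m x) = k x"
      unfolding compose_def by (metis (no_types, lifting) restrict_apply')
  qed (simp add: set_cat_def hom_functor_def compose_def cong: restrict_cong)
  show ?thesis
    using adjunction_universal[OF category_axioms category_set_cat adj X(1) S k'] unfolding iff .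
qed

lemma nabla_eq:
  assumes X: "X \<in> Obj C" "S \<in> U" and m: "m \<in> Hom C X (FObj N S)" "m' \<in> Hom C X (FObj N S)"
    and eq: "\<And>x. x \<in> pts X \<Longrightarrow> \<epsilon> S (Comp C T X (FObj N S) m x) = \<epsilon> S (Comp C T X (FObj N S) m' x)"
  shows "m = m'"
proof -
  have "(\<lambda>x. \<epsilon> S (Comp C T X (FObj N S) m' x)) \<in> pts X \<rightarrow> S"
    using \<epsilon>_mem[OF X(2)] ap_pts[OF X(1) nabla_obj[OF X(2)] m(2)] by blast
  from nabla_ex1[OF X this] show ?thesis using m eq by blast
qed

text \<open>Arrows from the terminal object into \<nabla> of \<open>S\<close> correspond to
  functions from the one-point set \<open>pts T\<close> to \<open>S\<close>; this makes \<epsilon>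
  injective here and surjective below.\<close>

lemma \<epsilon>_inj:
  assumes S: "S \<in> U" and v: "v \<in> pts (FObj N S)" "v' \<in> pts (FObj N S)" and eq: "\<epsilon> S v = \<epsilon> S v'"
  shows "v = v'"
  by (rule nabla_eq[OF T_obj S v]) (use eq v S nabla_obj in \<open>auto simp: pts_T Comp_Ide_right T_obj\<close>)

lemma \<epsilon>_surj:
  assumes S: "S \<in> U" "s \<in> S"
  obtains v where "v \<in> pts (FObj N S)" "\<epsilon> S v = s"
proof -
  obtain v where "v \<in> pts (FObj N S)" "\<forall>x\<in>pts T. \<epsilon> S (Comp C T T (FObj N S) v x) = s"
    using nabla_ex1[OF T_obj S(1), of "\<lambda>_. s"] S(2) by blast
  then show thesis using that nabla_obj S by (auto simp: pts_T Comp_Ide_right T_obj)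
qed

text \<open>The second fact is naturality of the counit, evaluated at a point.\<close>

lemma nabla_map:
  assumes S: "S \<in> U" "S' \<in> U" and k: "k \<in> S \<rightarrow>\<^sub>E S'"
  shows "FMap N S S' k \<in> Hom C (FObj N S) (FObj N S')"
    and "v \<in> pts (FObj N S) \<Longrightarrow> \<epsilon> S' (Comp C T (FObj N S) (FObj N S') (FMap N S S' k) v) = k (\<epsilon> S v)"
proof -
  show "FMap N S S' k \<in> Hom C (FObj N S) (FObj N S')"
    using adj S k unfolding adjunction_def is_functor_def set_cat_def by simp
  assume v: "v \<in> pts (FObj N S)"
  have "compose (pts (FObj N S)) (\<epsilon> S') (\<lambda>v\<in>pts (FObj N S). Comp C T (FObj N S) (FObj N S') (FMap N S S' k) v)
      = compose (pts (FObj N S)) k (\<epsilon> S)"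
    using adj S k unfolding adjunction_def natural_transformation_def
    by (simp add: set_cat_def comp_functor_def hom_functor_def id_functor_def)
  from fun_cong[OF this, of v] show "\<epsilon> S' (Comp C T (FObj N S) (FObj N S') (FMap N S S' k) v) = k (\<epsilon> S v)"
    using v by (simp add: compose_def)
qed

text \<open>The second fact is the first triangle identity, evaluated at a point.\<close>

lemma unit:
  assumes X: "X \<in> Obj C"
  shows "\<eta> X \<in> Hom C X (FObj N (pts X))"
    and "x \<in> pts X \<Longrightarrow> \<epsilon> (pts X) (Comp C T X (FObj N (pts X)) (\<eta> X) x) = x"
proof -
  show "\<eta> X \<in> Hom C X (FObj N (pts X))"
    using adj X unfolding adjunction_def natural_transformation_def
    by (simp add: comp_functor_def hom_functor_def id_functor_def)
  assume x: "x \<in> pts X"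
  have "compose (pts X) (\<epsilon> (pts X)) (\<lambda>x\<in>pts X. Comp C T X (FObj N (pts X)) (\<eta> X) x) = (\<lambda>x\<in>pts X. x)"
    using adj X unfolding adjunction_def by (simp add: set_cat_def hom_functor_def)
  from fun_cong[OF this, of x] show "\<epsilon> (pts X) (Comp C T X (FObj N (pts X)) (\<eta> X) x) = x"
    using x by (simp add: compose_def)
qed

text \<open>\<open>f\<close> is a cartesian arrow for the functor \<open>C(T, -)\<close>.\<close>

definition cartesian :: "'o \<Rightarrow> 'o \<Rightarrow> 'u \<Rightarrow> bool" where
  "cartesian B A f \<longleftrightarrow> B \<in> Obj C \<and> A \<in> Obj C \<and> f \<in> Hom C B A \<and>
    (\<forall>W\<in>Obj C. \<forall>h\<in>Hom C W A. \<forall>k\<in>pts W \<rightarrow> pts B.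
      (\<forall>t\<in>pts W. Comp C T B A f (k t) = Comp C T W A h t) \<longrightarrow>
      (\<exists>!m. m \<in> Hom C W B \<and> Comp C W B A f m = h \<and> (\<forall>t\<in>pts W. Comp C T W B m t = k t)))"

lemma cartesian_ex1:
  assumes "cartesian B A f" "W \<in> Obj C" "h \<in> Hom C W A" "k \<in> pts W \<rightarrow> pts B"
    and "\<forall>t\<in>pts W. Comp C T B A f (k t) = Comp C T W A h t"
  shows "\<exists>!m. m \<in> Hom C W B \<and> Comp C W B A f m = h \<and> (\<forall>t\<in>pts W. Comp C T W B m t = k t)"
  using assms unfolding cartesian_def by blast

text \<open>An arrow from \<open>W\<close> into \<nabla> of \<open>pts B\<close> is a function from
  \<open>pts W\<close> to \<open>pts B\<close>. Under this translation \<open>sq\<close> turns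
  commutation with the naturality square into agreement at points, and \<open>pt\<close> turns the
  condition on the leg \<eta> into prescribed values at points; the two universal properties then
  coincide.\<close>

lemma closed_iff: "closed_arrow C T N \<eta> B A f \<longleftrightarrow> cartesian B A f"
proof (cases "B \<in> Obj C \<and> A \<in> Obj C \<and> f \<in> Hom C B A")
  case False
  then show ?thesis unfolding closed_arrow_def cartesian_def is_pullback_def Let_def by auto
next
  case True
  then have B: "B \<in> Obj C" and A: "A \<in> Obj C" and f: "f \<in> Hom C B A" by auto
  let ?NB = "FObj N (pts B)" and ?NA = "FObj N (pts A)"
  let ?Gf = "\<lambda>x\<in>pts B. Comp C T B A f x"
  let ?Nf = "FMap N (pts B) (pts A) ?Gf"
  have U: "pts B \<in> U" "pts A \<in> U" using pts_U A B by auto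
  have o: "?NB \<in> Obj C" "?NA \<in> Obj C" using nabla_obj U by auto
  have Gf: "?Gf \<in> pts B \<rightarrow>\<^sub>E pts A" using ap_pts[OF B A f] by auto
  note Nf = nabla_map(1)[OF U Gf] and Nf_ev = nabla_map(2)[OF U Gf]
  have Nf': "\<epsilon> (pts A) (Comp C T W ?NA (Comp C W ?NB ?NA ?Nf v) t) = Comp C T B A f (\<epsilon> (pts B) (Comp C T W ?NB v t))"
    if "W \<in> Obj C" "v \<in> Hom C W ?NB" "t \<in> pts W" for W v t
    using that ap_pts[OF that(1) o(1) that(2,3)] \<epsilon>_mem[OF U(1)] Nf_ev
    by (simp add: ap_comp[OF that(1) o that(2) Nf that(3)])
  have \<eta>': "\<epsilon> (pts Z) (Comp C T W (FObj N (pts Z)) (Comp C W Z (FObj N (pts Z)) (\<eta> Z) m) t) = Comp C T W Z m t"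
    if "W \<in> Obj C" "Z \<in> Obj C" "m \<in> Hom C W Z" "t \<in> pts W" for W Z m t
    using unit(2)[OF that(2)] ap_pts[OF that(1-4)]
    by (simp add: ap_comp[OF that(1,2) nabla_obj[OF pts_U[OF that(2)]] that(3) unit(1)[OF that(2)] that(4)])
  have sq: "Comp C W A ?NA (\<eta> A) h = Comp C W ?NB ?NA ?Nf v \<longleftrightarrow>
      (\<forall>t\<in>pts W. Comp C T B A f (\<epsilon> (pts B) (Comp C T W ?NB v t)) = Comp C T W A h t)"
    if W: "W \<in> Obj C" "h \<in> Hom C W A" "v \<in> Hom C W ?NB" for W h v
  proof
    assume eq: "Comp C W A ?NA (\<eta> A) h = Comp C W ?NB ?NA ?Nf v"
    show "\<forall>t\<in>pts W. Comp C T B A f (\<epsilon> (pts B) (Comp C T W ?NB v t)) = Comp C T W A h t"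
      using Nf'[OF W(1,3)] \<eta>'[OF W(1) A W(2)] by (simp add: eq)
  next
    assume "\<forall>t\<in>pts W. Comp C T B A f (\<epsilon> (pts B) (Comp C T W ?NB v t)) = Comp C T W A h t"
    then show "Comp C W A ?NA (\<eta> A) h = Comp C W ?NB ?NA ?Nf v"
      by - (rule nabla_eq[OF W(1) U(2) Comp_Hom[OF W(1) A o(2) W(2) unit(1)[OF A]] Comp_Hom[OF W(1) o W(3) Nf]],
        simp add: Nf'[OF W(1,3)] \<eta>'[OF W(1) A W(2)])
  qed
  have pt: "Comp C W B ?NB (\<eta> B) m = v \<longleftrightarrow> (\<forall>t\<in>pts W. Comp C T W B m t = \<epsilon> (pts B) (Comp C T W ?NB v t))"
    if W: "W \<in> Obj C" "m \<in> Hom C W B" "v \<in> Hom C W ?NB" for W m v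
  proof
    assume "Comp C W B ?NB (\<eta> B) m = v"
    then show "\<forall>t\<in>pts W. Comp C T W B m t = \<epsilon> (pts B) (Comp C T W ?NB v t)"
      using \<eta>'[OF W(1) B W(2)] by simp
  next
    assume "\<forall>t\<in>pts W. Comp C T W B m t = \<epsilon> (pts B) (Comp C T W ?NB v t)"
    then show "Comp C W B ?NB (\<eta> B) m = v"
      by - (rule nabla_eq[OF W(1) U(1) Comp_Hom[OF W(1) B o(1) W(2) unit(1)[OF B]] W(3)],
        simp add: \<eta>'[OF W(1) B W(2)])
  qed
  have iff: "closed_arrow C T N \<eta> B A f \<longleftrightarrow> is_pullback C B A ?NB ?NA f (\<eta> B) (\<eta> A) ?Nf"
    unfolding closed_arrow_def Let_def comp_functor_def hom_functor_def by simp
  show ?thesis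
  proof
    assume "closed_arrow C T N \<eta> B A f"
    then have pb: "is_pullback C B A ?NB ?NA f (\<eta> B) (\<eta> A) ?Nf" unfolding iff .
    show "cartesian B A f"
      unfolding cartesian_def
    proof (intro conjI ballI impI B A f)
      fix W h k assume W: "W \<in> Obj C" "h \<in> Hom C W A" and k: "k \<in> pts W \<rightarrow> pts B"
        and kh: "\<forall>t\<in>pts W. Comp C T B A f (k t) = Comp C T W A h t"
      obtain v where v: "v \<in> Hom C W ?NB" "\<And>t. t \<in> pts W \<Longrightarrow> \<epsilon> (pts B) (Comp C T W ?NB v t) = k t"
        using nabla_ex1[OF W(1) U(1) k] by blast
      have "Comp C W A ?NA (\<eta> A) h = Comp C W ?NB ?NA ?Nf v"
        unfolding sq[OF W v(1)] using kh v(2) by simp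
      note ex = pullback_ex1[OF pb W v(1) this]
      show "\<exists>!m. m \<in> Hom C W B \<and> Comp C W B A f m = h \<and> (\<forall>t\<in>pts W. Comp C T W B m t = k t)"
      proof (rule ex1_iff[OF _ ex], rule conj_cong[OF refl], rule conj_cong[OF refl])
        fix m assume "m \<in> Hom C W B"
        from pt[OF W(1) this v(1)] v(2)
        show "Comp C W B ?NB (\<eta> B) m = v \<longleftrightarrow> (\<forall>t\<in>pts W. Comp C T W B m t = k t)" by simp
      qed
    qed
  next
    assume cart: "cartesian B A f"
    have "Comp C B A ?NA (\<eta> A) f = Comp C B ?NB ?NA ?Nf (\<eta> B)"
      unfolding sq[OF B f unit(1)[OF B]] using unit(2)[OF B] by simp
    moreover have "\<exists>!m. m \<in> Hom C W B \<and> Comp C W B A f m = h \<and> Comp C W B ?NB (\<eta> B) m = v"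
      if W: "W \<in> Obj C" "h \<in> Hom C W A" "v \<in> Hom C W ?NB"
        and eq: "Comp C W A ?NA (\<eta> A) h = Comp C W ?NB ?NA ?Nf v" for W h v
    proof -
      have k: "(\<lambda>t. \<epsilon> (pts B) (Comp C T W ?NB v t)) \<in> pts W \<rightarrow> pts B"
        using \<epsilon>_mem[OF U(1)] ap_pts[OF W(1) o(1) W(3)] by blast
      have ex: "\<exists>!m. m \<in> Hom C W B \<and> Comp C W B A f m = h \<and>
          (\<forall>t\<in>pts W. Comp C T W B m t = \<epsilon> (pts B) (Comp C T W ?NB v t))"
        by (rule cartesian_ex1[OF cart W(1,2) k eq[unfolded sq[OF W]]])
      show ?thesis
        by (rule ex1_iff[OF _ ex], rule conj_cong[OF refl], rule conj_cong[OF refl],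
          rule pt[OF W(1) _ W(3), symmetric])
    qed
    ultimately show "closed_arrow C T N \<eta> B A f"
      unfolding iff is_pullback_def using A B f o unit Nf by (intro conjI ballI impI) auto
  qed
qed

lemma cartesianD:
  assumes "cartesian B A f"
  shows "B \<in> Obj C" "A \<in> Obj C" "f \<in> Hom C B A"
  using assms unfolding cartesian_def by blast+

lemma pullback_point:
  assumes P: "is_pullback C P X Y Z p q f g" and x: "x \<in> pts X" "y \<in> pts Y"
    and eq: "Comp C T X Z f x = Comp C T Y Z g y"
  obtains z where "z \<in> pts P" "Comp C T P X p z = x" "Comp C T P Y q z = y"
  using pullback_ex1[OF P T_obj x eq] by blast

text \<open>Pull \<eta> at \<open>Z\<close> back along \<nabla> of \<open>k\<close>. A point of the
  result is a point \<open>z\<close> with an element \<open>s\<close> such that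
  \<open>z = k s\<close>, thus just an element of \<open>S\<close>; and an arrow into it is an arrow
  into \<open>Z\<close> with a matching function into \<open>S\<close>. This is the source of
  objects with a prescribed set of points.\<close>

lemma ex_cartesian:
  assumes Z: "Z \<in> Obj C" and S: "S \<in> U" and k: "k \<in> S \<rightarrow> pts Z"
  obtains B f \<theta> where "cartesian B Z f" "bij_betw \<theta> S (pts B)" "\<And>s. s \<in> S \<Longrightarrow> Comp C T B Z f (\<theta> s) = k s"
proof -
  let ?NZ = "FObj N (pts Z)" and ?k = "restrict k S"
  let ?Nk = "FMap N S (pts Z) ?k"
  have U: "pts Z \<in> U" using pts_U Z by auto
  have o: "FObj N S \<in> Obj C" "?NZ \<in> Obj C" using nabla_obj U S by auto
  have k': "?k \<in> S \<rightarrow>\<^sub>E pts Z" using k by auto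
  note Nk = nabla_map(1)[OF S U k'] and Nk_ev = nabla_map(2)[OF S U k']
  obtain B f q where pb: "is_pullback C B Z (FObj N S) ?NZ f q (\<eta> Z) ?Nk"
    using ex_pullback[OF Z o unit(1)[OF Z] Nk] .
  note d = pullbackD[OF pb]
  have pt_iff: "Comp C T Z ?NZ (\<eta> Z) z = Comp C T (FObj N S) ?NZ ?Nk v \<longleftrightarrow> z = k (\<epsilon> S v)"
    if "z \<in> pts Z" "v \<in> pts (FObj N S)" for z v
  proof
    assume "Comp C T Z ?NZ (\<eta> Z) z = Comp C T (FObj N S) ?NZ ?Nk v"
    then show "z = k (\<epsilon> S v)" using unit(2)[OF Z that(1)] Nk_ev[OF that(2)] \<epsilon>_mem[OF S that(2)] by simp
  next
    assume "z = k (\<epsilon> S v)"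
    then show "Comp C T Z ?NZ (\<eta> Z) z = Comp C T (FObj N S) ?NZ ?Nk v"
      by - (rule \<epsilon>_inj[OF U ap_pts[OF Z o(2) unit(1)[OF Z] that(1)] ap_pts[OF o Nk that(2)]],
        use unit(2)[OF Z that(1)] Nk_ev[OF that(2)] \<epsilon>_mem[OF S that(2)] in simp)
  qed
  have fq: "Comp C T B Z f b = k (\<epsilon> S (Comp C T B (FObj N S) q b))" if "b \<in> pts B" for b
  proof -
    have "Comp C T Z ?NZ (\<eta> Z) (Comp C T B Z f b) = Comp C T (FObj N S) ?NZ ?Nk (Comp C T B (FObj N S) q b)"
      using d that by (simp add: ap_comp[symmetric])
    then show ?thesis using pt_iff ap_pts d that by blast
  qed
  have b_eq: "b = b'" if "b \<in> pts B" "b' \<in> pts B"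
    "\<epsilon> S (Comp C T B (FObj N S) q b) = \<epsilon> S (Comp C T B (FObj N S) q b')" for b b'
  proof (rule pullback_eq[OF pb T_obj that(1,2)])
    show "Comp C T B Z f b = Comp C T B Z f b'" using fq that by simp
    show "Comp C T B (FObj N S) q b = Comp C T B (FObj N S) q b'"
      by (rule \<epsilon>_inj[OF S _ _ that(3)]) (use ap_pts d that in auto)
  qed
  have "\<exists>b. b \<in> pts B \<and> \<epsilon> S (Comp C T B (FObj N S) q b) = s" if s: "s \<in> S" for s
  proof -
    obtain v where v: "v \<in> pts (FObj N S)" "\<epsilon> S v = s" using \<epsilon>_surj[OF S s] .
    have ks: "k s \<in> pts Z" using k s by blast
    have "Comp C T Z ?NZ (\<eta> Z) (k s) = Comp C T (FObj N S) ?NZ ?Nk v" using pt_iff[OF ks v(1)] v(2) by simp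
    from pullback_point[OF pb ks v(1) this] show ?thesis using v(2) by metis
  qed
  then obtain \<theta> where \<theta>: "\<And>s. s \<in> S \<Longrightarrow> \<theta> s \<in> pts B" "\<And>s. s \<in> S \<Longrightarrow> \<epsilon> S (Comp C T B (FObj N S) q (\<theta> s)) = s"
    by metis
  have "bij_betw \<theta> S (pts B)"
  proof (rule bij_betw_byWitness[where f' = "\<lambda>b. \<epsilon> S (Comp C T B (FObj N S) q b)"])
    show "\<forall>b\<in>pts B. \<theta> (\<epsilon> S (Comp C T B (FObj N S) q b)) = b"
      using \<theta> b_eq \<epsilon>_mem[OF S] ap_pts d by blast
    show "(\<lambda>b. \<epsilon> S (Comp C T B (FObj N S) q b)) ` pts B \<subseteq> S" using \<epsilon>_mem[OF S] ap_pts d by blast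
  qed (use \<theta> in auto)
  moreover have "Comp C T B Z f (\<theta> s) = k s" if "s \<in> S" for s using fq \<theta> that by simp
  moreover have "cartesian B Z f"
    unfolding cartesian_def
  proof (intro conjI ballI impI d(1,2,5))
    fix W h \<kappa> assume W: "W \<in> Obj C" "h \<in> Hom C W Z" and \<kappa>: "\<kappa> \<in> pts W \<rightarrow> pts B"
      and \<kappa>h: "\<forall>t\<in>pts W. Comp C T B Z f (\<kappa> t) = Comp C T W Z h t"
    have "(\<lambda>t. \<epsilon> S (Comp C T B (FObj N S) q (\<kappa> t))) \<in> pts W \<rightarrow> S"
      using \<epsilon>_mem[OF S] ap_pts[OF d(1,3,6)] \<kappa> by blast
    from nabla_ex1[OF W(1) S this] obtain v where v: "v \<in> Hom C W (FObj N S)"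
      "\<And>t. t \<in> pts W \<Longrightarrow> \<epsilon> S (Comp C T W (FObj N S) v t) = \<epsilon> S (Comp C T B (FObj N S) q (\<kappa> t))" by blast
    have "Comp C W Z ?NZ (\<eta> Z) h = Comp C W (FObj N S) ?NZ ?Nk v"
    proof (rule nabla_eq[OF W(1) U Comp_Hom[OF W(1) Z o(2) W(2) unit(1)[OF Z]] Comp_Hom[OF W(1) o v(1) Nk]])
      fix t assume t: "t \<in> pts W"
      have ht: "Comp C T W Z h t \<in> pts Z" and vt: "Comp C T W (FObj N S) v t \<in> pts (FObj N S)"
        using ap_pts t W Z o v by auto
      have "Comp C T W Z h t = k (\<epsilon> S (Comp C T W (FObj N S) v t))"
        using \<kappa>h fq[OF Pi_mem[OF \<kappa> t]] v(2)[OF t] t by simp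
      then have "Comp C T Z ?NZ (\<eta> Z) (Comp C T W Z h t) = Comp C T (FObj N S) ?NZ ?Nk (Comp C T W (FObj N S) v t)"
        using pt_iff[OF ht vt] by simp
      then show "\<epsilon> (pts Z) (Comp C T W ?NZ (Comp C W Z ?NZ (\<eta> Z) h) t)
          = \<epsilon> (pts Z) (Comp C T W ?NZ (Comp C W (FObj N S) ?NZ ?Nk v) t)"
        by (simp add: ap_comp[OF W(1) Z o(2) W(2) unit(1)[OF Z] t] ap_comp[OF W(1) o v(1) Nk t])
    qed
    from pullback_ex1[OF pb W v(1) this]
    have ex: "\<exists>!m. m \<in> Hom C W B \<and> Comp C W B Z f m = h \<and> Comp C W B (FObj N S) q m = v" .
    have iff: "Comp C W B (FObj N S) q m = v \<longleftrightarrow> (\<forall>t\<in>pts W. Comp C T W B m t = \<kappa> t)" if m: "m \<in> Hom C W B" for m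
    proof -
      note qm = ap_comp[OF W(1) d(1,3) m d(6)]
      show ?thesis
      proof
        assume "Comp C W B (FObj N S) q m = v"
        then have "\<epsilon> S (Comp C T B (FObj N S) q (Comp C T W B m t)) = \<epsilon> S (Comp C T B (FObj N S) q (\<kappa> t))"
          if "t \<in> pts W" for t using qm v(2) that by simp
        from b_eq[OF ap_pts[OF W(1) d(1) m] Pi_mem[OF \<kappa>] this]
        show "\<forall>t\<in>pts W. Comp C T W B m t = \<kappa> t" by blast
      next
        assume "\<forall>t\<in>pts W. Comp C T W B m t = \<kappa> t"
        then show "Comp C W B (FObj N S) q m = v"
          by - (rule nabla_eq[OF W(1) S Comp_Hom[OF W(1) d(1,3) m d(6)] v(1)], simp add: qm v(2))
      qed
    qed
    show "\<exists>!m. m \<in> Hom C W B \<and> Comp C W B Z f m = h \<and> (\<forall>t\<in>pts W. Comp C T W B m t = \<kappa> t)"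
      by (rule ex1_iff[OF _ ex], rule conj_cong[OF refl], rule conj_cong[OF refl], rule iff)
  qed
  ultimately show thesis using that by blast
qed

section \<open>Separated objects and faithfulness of global sections\<close>

lemma separated_eq:
  assumes G: "separated_object C T N \<eta> G" and W: "W \<in> Obj C" "g \<in> Hom C W G" "h \<in> Hom C W G"
    and eq: "\<And>t. t \<in> pts W \<Longrightarrow> Comp C T W G g t = Comp C T W G h t"
  shows "g = h"
proof -
  let ?NG = "FObj N (pts G)"
  have Go: "G \<in> Obj C" and mono: "is_monic C G ?NG (\<eta> G)"
    using G unfolding separated_object_def comp_functor_def hom_functor_def by auto
  note o = nabla_obj[OF pts_U[OF Go]] and \<eta> = unit(1)[OF Go]
  have "Comp C W G ?NG (\<eta> G) g = Comp C W G ?NG (\<eta> G) h"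
    by (rule nabla_eq[OF W(1) pts_U[OF Go] Comp_Hom[OF W(1) Go o W(2) \<eta>] Comp_Hom[OF W(1) Go o W(3) \<eta>]])
      (use eq in \<open>simp add: ap_comp[OF W(1) Go o W(2) \<eta>] ap_comp[OF W(1) Go o W(3) \<eta>]\<close>)
  then show ?thesis using mono W unfolding is_monic_def by blast
qed

text \<open>Named because both directions of the theorem establish it, by different arguments, and
  then share \<open>cartesianI_faithful\<close>.\<close>

definition global_sections_faithful :: bool where
  "global_sections_faithful \<longleftrightarrow> (\<forall>W\<in>Obj C. \<forall>X\<in>Obj C. \<forall>g\<in>Hom C W X. \<forall>h\<in>Hom C W X.
    (\<forall>t\<in>pts W. Comp C T W X g t = Comp C T W X h t) \<longrightarrow> g = h)"

text \<open>With faithful global sections both the triangle over \<open>Z\<close> and the uniqueness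
  of the lift can be read off at points, which leaves only the existence of an arrow that realizes
  \<open>k\<close>.\<close>

lemma cartesianI_faithful:
  assumes faithful: "global_sections_faithful"
    and B: "B \<in> Obj C" "Z \<in> Obj C" "f \<in> Hom C B Z"
    and lift: "\<And>W h k. W \<in> Obj C \<Longrightarrow> h \<in> Hom C W Z \<Longrightarrow> k \<in> pts W \<rightarrow> pts B \<Longrightarrow>
      (\<And>t. t \<in> pts W \<Longrightarrow> Comp C T B Z f (k t) = Comp C T W Z h t) \<Longrightarrow>
      \<exists>m\<in>Hom C W B. \<forall>t\<in>pts W. Comp C T W B m t = k t"
  shows "cartesian B Z f"
  unfolding cartesian_def
proof (intro conjI ballI impI B)
  note faithful = faithful[unfolded global_sections_faithful_def, rule_format]
  fix W h k assume W: "W \<in> Obj C" "h \<in> Hom C W Z" "k \<in> pts W \<rightarrow> pts B"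
    and kh: "\<forall>t\<in>pts W. Comp C T B Z f (k t) = Comp C T W Z h t"
  obtain m where m: "m \<in> Hom C W B" "\<And>t. t \<in> pts W \<Longrightarrow> Comp C T W B m t = k t"
    using lift[OF W] kh by blast
  show "\<exists>!m. m \<in> Hom C W B \<and> Comp C W B Z f m = h \<and> (\<forall>t\<in>pts W. Comp C T W B m t = k t)"
  proof (rule ex1I[of _ m], intro conjI ballI)
    show "Comp C W B Z f m = h"
      by (rule faithful[OF W(1) B(2) Comp_Hom[OF W(1) B(1,2) m(1) B(3)] W(2)])
        (use m kh in \<open>simp add: ap_comp[OF W(1) B(1,2) m(1) B(3)]\<close>)
    show "m' = m" if "m' \<in> Hom C W B \<and> Comp C W B Z f m' = h \<and> (\<forall>t\<in>pts W. Comp C T W B m' t = k t)" for m'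
      by (rule faithful[OF W(1) B(1) _ m(1)]) (use that m in auto)
  qed (use m in auto)
qed

text \<open>Composition with \<eta> forgets nothing about points, since \<epsilon> undoes it; so two
  arrows that \<eta> identifies agree at all points.\<close>

lemma separatedI:
  assumes G: "G \<in> Obj C" and faithful: "\<And>W g h. W \<in> Obj C \<Longrightarrow> g \<in> Hom C W G \<Longrightarrow> h \<in> Hom C W G \<Longrightarrow>
      (\<And>t. t \<in> pts W \<Longrightarrow> Comp C T W G g t = Comp C T W G h t) \<Longrightarrow> g = h"
  shows "separated_object C T N \<eta> G"
proof -
  let ?NG = "FObj N (pts G)"
  note o = nabla_obj[OF pts_U[OF G]] and \<eta> = unit(1)[OF G]
  have "is_monic C G ?NG (\<eta> G)"
    unfolding is_monic_def
  proof (intro conjI \<eta> ballI impI)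
    fix W g h assume W: "W \<in> Obj C" "g \<in> Hom C W G" "h \<in> Hom C W G"
      and eq: "Comp C W G ?NG (\<eta> G) g = Comp C W G ?NG (\<eta> G) h"
    show "g = h"
    proof (rule faithful[OF W])
      fix t assume t: "t \<in> pts W"
      have "Comp C T G ?NG (\<eta> G) (Comp C T W G g t) = Comp C T G ?NG (\<eta> G) (Comp C T W G h t)"
        unfolding ap_comp[OF W(1) G o W(2) \<eta> t, symmetric] ap_comp[OF W(1) G o W(3) \<eta> t, symmetric] eq ..
      then have "\<epsilon> (pts G) (Comp C T G ?NG (\<eta> G) (Comp C T W G g t)) = \<epsilon> (pts G) (Comp C T G ?NG (\<eta> G) (Comp C T W G h t))"
        by (rule arg_cong)
      then show "Comp C T W G g t = Comp C T W G h t"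
        unfolding unit(2)[OF G ap_pts[OF W(1) G W(2) t]] unit(2)[OF G ap_pts[OF W(1) G W(3) t]] .
    qed
  qed
  then show ?thesis unfolding separated_object_def comp_functor_def hom_functor_def using G by simp
qed

end

section \<open>Local categories with a separated discrete generic object\<close>

locale sdg_category = local_cat U C T N \<eta> \<epsilon>
  for U :: "'u set set" and C :: "('o, 'u) cat" and T N \<eta> \<epsilon> +
  fixes G :: 'o
  assumes wlcc: "weakly_locally_cartesian_closed C"
    and separated: "separated_object C T N \<eta> G"
    and discrete: "discrete_object C T N \<eta> G"
    and generic: "generic_object C T N \<eta> G"
begin

section \<open>Consequences of genericity and separatedness\<close>

lemma G_obj: "G \<in> Obj C"
  using generic unfolding generic_object_def by blast

abbreviation A :: "'u set" where "A \<equiv> pts G"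

lemma A_U: "A \<in> U"
  by (rule pts_U[OF G_obj])

lemma ex_code: "X \<in> Obj C \<Longrightarrow> \<exists>c. cartesian X G c"
  using generic unfolding generic_object_def closed_iff by blast

lemma discrete_ext:
  assumes e: "cartesian D X e" and f: "f \<in> Hom C D G"
    and onto: "\<And>x. x \<in> pts X \<Longrightarrow> \<exists>d\<in>pts D. Comp C T D X e d = x"
  obtains g where "g \<in> Hom C X G" "Comp C D X G g e = f"
proof -
  note d = cartesianD[OF e]
  have "(\<lambda>d\<in>pts D. Comp C T D X e d) ` pts D = pts X"
    using onto ap_pts[OF d] by (force simp: image_iff)
  then have "\<exists>!g. g \<in> Hom C X G \<and> Comp C D X G g e = f"
    using discrete d e f unfolding discrete_object_def closed_iff by (simp add: hom_functor_def)
  then show thesis using that by blast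
qed

text \<open>Faithfulness spreads from \<open>G\<close> to all objects: followed by a closed arrow
  \<open>c\<close> into \<open>G\<close>, the two arrows agree by separatedness, and an arrow into
  \<open>X\<close> is determined by its composite with \<open>c\<close> and its values at
  points.\<close>

lemma faithful:
  assumes X: "W \<in> Obj C" "X \<in> Obj C" "g \<in> Hom C W X" "h \<in> Hom C W X"
    and eq: "\<And>t. t \<in> pts W \<Longrightarrow> Comp C T W X g t = Comp C T W X h t"
  shows "g = h"
proof -
  obtain c where c: "cartesian X G c" using ex_code X by blast
  note d = cartesianD[OF c]
  have "Comp C W X G c g = Comp C W X G c h"
    by (rule separated_eq[OF separated X(1) Comp_Hom[OF X(1,2) G_obj X(3) d(3)] Comp_Hom[OF X(1,2) G_obj X(4) d(3)]])
      (use eq in \<open>simp add: ap_comp[OF X(1,2) G_obj X(3) d(3)] ap_comp[OF X(1,2) G_obj X(4) d(3)]\<close>)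
  moreover have "(\<lambda>t. Comp C T W X h t) \<in> pts W \<rightarrow> pts X" using ap_pts[OF X(1,2,4)] by blast
  moreover have "\<forall>t\<in>pts W. Comp C T X G c (Comp C T W X h t) = Comp C T W G (Comp C W X G c h) t"
    by (simp add: ap_comp[OF X(1,2) G_obj X(4) d(3)])
  ultimately have "\<exists>!m. m \<in> Hom C W X \<and> Comp C W X G c m = Comp C W X G c h \<and>
      (\<forall>t\<in>pts W. Comp C T W X m t = Comp C T W X h t)"
    using cartesian_ex1[OF c X(1) Comp_Hom[OF X(1,2) G_obj X(4) d(3)]] by blast
  then show ?thesis using X eq \<open>Comp C W X G c g = Comp C W X G c h\<close> by blast
qed

lemma cartesian_lift:
  assumes "cartesian B Z f" "W \<in> Obj C" "h \<in> Hom C W Z" "k \<in> pts W \<rightarrow> pts B"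
    and "\<And>t. t \<in> pts W \<Longrightarrow> Comp C T B Z f (k t) = Comp C T W Z h t"
  obtains m where "m \<in> Hom C W B" "\<And>t. t \<in> pts W \<Longrightarrow> Comp C T W B m t = k t"
  using cartesian_ex1[OF assms(1-4)] assms(5) by blast

lemma global_sections_faithful: "global_sections_faithful"
  unfolding global_sections_faithful_def by (intro ballI impI, rule faithful) (assumption | erule (1) bspec)+

lemmas cartesianI = cartesianI_faithful[OF global_sections_faithful]

lemma cartesian_Ide: "Z \<in> Obj C \<Longrightarrow> cartesian Z Z (Ide C Z)"
proof (rule cartesianI)
  fix W h k assume Z: "Z \<in> Obj C" and W: "W \<in> Obj C" "h \<in> Hom C W Z" "k \<in> pts W \<rightarrow> pts Z"
    and kh: "\<And>t. t \<in> pts W \<Longrightarrow> Comp C T Z Z (Ide C Z) (k t) = Comp C T W Z h t"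
  have "Comp C T W Z h t = k t" if "t \<in> pts W" for t
    using kh[OF that] Comp_Ide_left[OF T_obj Z Pi_mem[OF W(3) that]] by simp
  then show "\<exists>m\<in>Hom C W Z. \<forall>t\<in>pts W. Comp C T W Z m t = k t" using W by blast
qed (auto intro: Ide_Hom)

text \<open>The case of an inclusion in \<open>ex_cartesian\<close>: a set of points becomes a
  closed subobject, and \<open>\<theta>\<close> inverts \<open>f\<close> on points.\<close>

lemma ex_sub:
  assumes Z: "Z \<in> Obj C" and S: "S \<subseteq> pts Z"
  obtains B f \<theta> where "cartesian B Z f" "\<forall>b\<in>pts B. Comp C T B Z f b \<in> S"
    "\<forall>s\<in>S. \<theta> s \<in> pts B" "\<forall>s\<in>S. Comp C T B Z f (\<theta> s) = s"
    "\<forall>b\<in>pts B. \<theta> (Comp C T B Z f b) = b"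
proof -
  have "S \<in> U" using S pts_U[OF Z] subset_U by blast
  moreover have "id \<in> S \<rightarrow> pts Z" using S by auto
  ultimately obtain B f \<theta> where B: "cartesian B Z f" "bij_betw \<theta> S (pts B)"
    "\<And>s. s \<in> S \<Longrightarrow> Comp C T B Z f (\<theta> s) = id s" using ex_cartesian[OF Z] by blast
  have surj: "\<exists>s\<in>S. b = \<theta> s" if "b \<in> pts B" for b using B(2) that unfolding bij_betw_def by blast
  have mem: "\<theta> s \<in> pts B" if "s \<in> S" for s using B(2) that unfolding bij_betw_def by blast
  show thesis
  proof (rule that[OF B(1)]; intro ballI)
    show "Comp C T B Z f b \<in> S" "\<theta> (Comp C T B Z f b) = b" if "b \<in> pts B" for b
      using surj[OF that] B(3) by auto
  qed (use mem B(3) in auto)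
qed

definition is_product :: "'o \<Rightarrow> 'o \<Rightarrow> 'o \<Rightarrow> 'u \<Rightarrow> 'u \<Rightarrow> bool" where
  "is_product P X Y p q \<longleftrightarrow> (\<exists>f g. is_pullback C P X Y T p q f g)"

lemma ex_product:
  assumes X: "X \<in> Obj C" "Y \<in> Obj C"
  obtains P p q where "is_product P X Y p q"
proof -
  obtain f g where f: "f \<in> Hom C X T" "g \<in> Hom C Y T" using ex_terminal X by blast
  obtain P p q where "is_pullback C P X Y T p q f g" using ex_pullback[OF X T_obj f] .
  then show thesis using that unfolding is_product_def by blast
qed

lemma productD:
  assumes "is_product P X Y p q"
  shows "P \<in> Obj C" "X \<in> Obj C" "Y \<in> Obj C" "p \<in> Hom C P X" "q \<in> Hom C P Y"
  using assms unfolding is_product_def by (auto dest: pullbackD)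

lemma product_pair:
  assumes P: "is_product P X Y p q" and W: "W \<in> Obj C" "h \<in> Hom C W X" "k \<in> Hom C W Y"
  obtains m where "m \<in> Hom C W P" "Comp C W P X p m = h" "Comp C W P Y q m = k"
proof -
  obtain f g where pb: "is_pullback C P X Y T p q f g" using P unfolding is_product_def by blast
  note d = pullbackD[OF pb]
  have "Comp C W X T f h = Comp C W Y T g k"
    using ex_terminal[OF W(1)] Comp_Hom[OF W(1) d(2,4) W(2) d(7)] Comp_Hom[OF W(1) d(3,4) W(3) d(8)]
    by blast
  from pullback_ex1[OF pb W this] show thesis using that by blast
qed

lemma product_eq:
  assumes "is_product P X Y p q" "z \<in> pts P" "z' \<in> pts P"
    and "Comp C T P X p z = Comp C T P X p z'" "Comp C T P Y q z = Comp C T P Y q z'"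
  shows "z = z'"
  using assms pullback_eq[OF _ T_obj] unfolding is_product_def by blast

text \<open>
  The relation of trackability that the arrows into \<open>G\<close> define: by discreteness it depends only
  on the graph of \<open>p s \<mapsto> q s\<close>.
\<close>

definition trk :: "'x set \<Rightarrow> ('x \<Rightarrow> 'u) \<Rightarrow> ('x \<Rightarrow> 'u) \<Rightarrow> bool" where
  "trk S p q \<longleftrightarrow> (\<exists>X c h. cartesian X G c \<and> h \<in> Hom C X G \<and>
    (\<forall>s\<in>S. \<exists>x\<in>pts X. Comp C T X G c x = p s \<and> Comp C T X G h x = q s))"

lemma trkI:
  assumes "cartesian X G c" "h \<in> Hom C X G"
    and "\<And>s. s \<in> S \<Longrightarrow> \<exists>x\<in>pts X. Comp C T X G c x = p s \<and> Comp C T X G h x = q s"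
  shows "trk S p q"
  using assms unfolding trk_def by blast

text \<open>This is where discreteness enters. Let \<open>B\<close> be the closed subobject of
  \<open>G\<close> whose points are the codes that \<open>c\<close> takes. Then \<open>c\<close>
  factors through an arrow \<open>e\<close> into \<open>B\<close> that is closed and onto on points,
  so \<open>h\<close> descends to \<open>g\<close> on \<open>B\<close>. Also \<open>d\<close>
  factors through \<open>B\<close>, because each of its values is some \<open>p s\<close>. The
  required arrow is \<open>g\<close> after that factor of \<open>d\<close>.\<close>

lemma trk_extend:
  assumes trk: "trk S p q" and Y: "Y \<in> Obj C" "d \<in> Hom C Y G"
    and dp: "\<And>y. y \<in> pts Y \<Longrightarrow> \<exists>s\<in>S. Comp C T Y G d y = p s"
  obtains h where "h \<in> Hom C Y G"
    "\<And>y s. y \<in> pts Y \<Longrightarrow> s \<in> S \<Longrightarrow> Comp C T Y G d y = p s \<Longrightarrow> Comp C T Y G h y = q s"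
proof -
  obtain X c h where c: "cartesian X G c" and h: "h \<in> Hom C X G"
    and S: "\<And>s. s \<in> S \<Longrightarrow> \<exists>x\<in>pts X. Comp C T X G c x = p s \<and> Comp C T X G h x = q s"
    using trk unfolding trk_def by blast
  note X = cartesianD[OF c]
  let ?W = "(\<lambda>x. Comp C T X G c x) ` pts X"
  have W: "?W \<subseteq> pts G" using ap_pts[OF X] by blast
  obtain B f \<theta> where f: "cartesian B G f" and sub: "\<forall>b\<in>pts B. Comp C T B G f b \<in> ?W"
    "\<forall>s\<in>?W. \<theta> s \<in> pts B" "\<forall>s\<in>?W. Comp C T B G f (\<theta> s) = s"
    "\<forall>b\<in>pts B. \<theta> (Comp C T B G f b) = b"
    using ex_sub[OF G_obj W] .
  note fb = bspec[OF sub(1)] and \<theta> = bspec[OF sub(2)] bspec[OF sub(3)] and \<theta>f = bspec[OF sub(4)]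
  note B = cartesianD[OF f]
  have k: "(\<lambda>x. \<theta> (Comp C T X G c x)) \<in> pts X \<rightarrow> pts B" using \<theta>(1) by simp
  have "Comp C T B G f (\<theta> (Comp C T X G c x)) = Comp C T X G c x" if "x \<in> pts X" for x
    using \<theta>(2) that by simp
  from cartesian_lift[OF f X(1,3) k this]
  obtain e where e: "e \<in> Hom C X B" "\<And>x. x \<in> pts X \<Longrightarrow> Comp C T X B e x = \<theta> (Comp C T X G c x)"
    by blast
  \<comment> \<open>\<open>e\<close> inherits closedness from \<open>c\<close>, because
    \<open>f\<close> after \<open>e\<close> has the same values at points as
    \<open>c\<close>.\<close>
  have "cartesian X B e"
  proof (rule cartesianI[OF X(1) B(1) e(1)])
    fix V g k assume V: "V \<in> Obj C" "g \<in> Hom C V B" "k \<in> pts V \<rightarrow> pts X"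
      and kg: "\<And>t. t \<in> pts V \<Longrightarrow> Comp C T X B e (k t) = Comp C T V B g t"
    have "Comp C T X G c (k t) = Comp C T V G (Comp C V B G f g) t" if t: "t \<in> pts V" for t
    proof -
      have "k t \<in> pts X" using V t by blast
      then have "Comp C T B G f (Comp C T X B e (k t)) = Comp C T X G c (k t)"
        using e(2) \<theta>(2) by simp
      then show ?thesis using kg[OF t] by (simp add: ap_comp[OF V(1) B(1) G_obj V(2) B(3) t])
    qed
    from cartesian_lift[OF c V(1) Comp_Hom[OF V(1) B(1) G_obj V(2) B(3)] V(3) this]
    show "\<exists>m\<in>Hom C V X. \<forall>t\<in>pts V. Comp C T V X m t = k t" by metis
  qed
  moreover have "\<exists>x\<in>pts X. Comp C T X B e x = b" if b: "b \<in> pts B" for b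
  proof -
    obtain x where x: "x \<in> pts X" "Comp C T B G f b = Comp C T X G c x" using fb[OF b] by blast
    then have "Comp C T X B e x = b" using e(2) \<theta>f[OF b] by simp
    then show ?thesis using x by blast
  qed
  ultimately obtain g where g: "g \<in> Hom C B G" "Comp C X B G g e = h"
    using discrete_ext[OF _ h] by blast
  have dW: "Comp C T Y G d y \<in> ?W" if y: "y \<in> pts Y" for y
  proof -
    obtain s where s: "s \<in> S" "Comp C T Y G d y = p s" using dp[OF y] by blast
    obtain x where "x \<in> pts X" "Comp C T X G c x = p s" using S[OF s(1)] by blast
    then show ?thesis using s(2) by (auto intro!: image_eqI[of _ _ x])
  qed
  have k: "(\<lambda>y. \<theta> (Comp C T Y G d y)) \<in> pts Y \<rightarrow> pts B" using \<theta>(1) dW by simp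
  have "Comp C T B G f (\<theta> (Comp C T Y G d y)) = Comp C T Y G d y" if "y \<in> pts Y" for y
    using \<theta>(2) dW that by simp
  from cartesian_lift[OF f Y k this]
  obtain d' where d': "d' \<in> Hom C Y B" "\<And>y. y \<in> pts Y \<Longrightarrow> Comp C T Y B d' y = \<theta> (Comp C T Y G d y)"
    by blast
  show thesis
  proof (rule that[OF Comp_Hom[OF Y(1) B(1) G_obj d'(1) g(1)]])
    fix y s assume y: "y \<in> pts Y" and s: "s \<in> S" and dy: "Comp C T Y G d y = p s"
    obtain x where x: "x \<in> pts X" "Comp C T X G c x = p s" "Comp C T X G h x = q s" using S[OF s] by blast
    have "Comp C T Y G (Comp C Y B G g d') y = Comp C T B G g (\<theta> (p s))"
      using d'(2)[OF y] dy by (simp add: ap_comp[OF Y(1) B(1) G_obj d'(1) g(1) y])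
    also have "\<dots> = Comp C T X G (Comp C X B G g e) x"
      using e(2)[OF x(1)] x(2) by (simp add: ap_comp[OF X(1) B(1) G_obj e(1) g(1) x(1)])
    finally show "Comp C T Y G (Comp C Y B G g d') y = q s" using g(2) x(3) by simp
  qed
qed

lemma trk_mem:
  assumes "trk S p q" "s \<in> S"
  shows "p s \<in> A" "q s \<in> A"
proof -
  obtain X c h x where c: "cartesian X G c" and h: "h \<in> Hom C X G" and x: "x \<in> pts X"
    and eq: "Comp C T X G c x = p s" "Comp C T X G h x = q s"
    using assms unfolding trk_def by blast
  note X = cartesianD[OF c]
  show "p s \<in> A" using ap_pts[OF X x] eq by simp
  show "q s \<in> A" using ap_pts[OF X(1,2) h x] eq by simp
qed

text \<open>Regard the code \<open>p s\<close> as an arrow from \<open>T\<close> to \<open>G\<close>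
  and extend the tracking along it: the resulting arrow has a single value at the point of
  \<open>T\<close>, equal to both \<open>q s\<close> and \<open>q s'\<close>.\<close>

lemma trk_fun:
  assumes trk: "trk S p q" and s: "s \<in> S" "s' \<in> S" and eq: "p s = p s'"
  shows "q s = q s'"
proof -
  have ps: "p s \<in> Hom C T G" using trk_mem[OF trk s(1)] by simp
  have id: "Comp C T T G (p s) y = p s" if "y \<in> pts T" for y
    using that Comp_Ide_right[OF T_obj G_obj ps] by (simp add: pts_T)
  obtain h where h: "h \<in> Hom C T G"
    "\<And>y s'. y \<in> pts T \<Longrightarrow> s' \<in> S \<Longrightarrow> Comp C T T G (p s) y = p s' \<Longrightarrow> Comp C T T G h y = q s'"
    using trk_extend[OF trk T_obj ps] id s(1) by blast
  have "Ide C T \<in> pts T" by (simp add: pts_T)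
  from h(2)[OF this s(1) id[OF this]] h(2)[OF this s(2)] id[OF this] eq show ?thesis by simp
qed

text \<open>Provides the object on which a function tracked from the given codes becomes an arrow,
  by \<open>trk_extend\<close>.\<close>

lemma trk_object:
  assumes p: "\<And>s. s \<in> S \<Longrightarrow> p s \<in> A"
  obtains X c where "cartesian X G c" "\<And>x. x \<in> pts X \<Longrightarrow> \<exists>s\<in>S. Comp C T X G c x = p s"
    "\<And>s. s \<in> S \<Longrightarrow> \<exists>x\<in>pts X. Comp C T X G c x = p s"
proof -
  have "p ` S \<subseteq> pts G" using p by blast
  from ex_sub[OF G_obj this] obtain B f \<theta> where B: "cartesian B G f" "\<forall>b\<in>pts B. Comp C T B G f b \<in> p ` S"
    "\<forall>s\<in>p ` S. \<theta> s \<in> pts B" "\<forall>s\<in>p ` S. Comp C T B G f (\<theta> s) = s" by metis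
  then show thesis by (intro that[OF B(1)]) blast+
qed

lemma trk_reindex: "trk S p q \<Longrightarrow> (\<And>s. s \<in> S' \<Longrightarrow> f s \<in> S) \<Longrightarrow> trk S' (\<lambda>s. p (f s)) (\<lambda>s. q (f s))"
  unfolding trk_def by meson

lemma trk_cong: "trk S p q \<Longrightarrow> (\<And>s. s \<in> S \<Longrightarrow> p s = p' s) \<Longrightarrow> (\<And>s. s \<in> S \<Longrightarrow> q s = q' s) \<Longrightarrow> trk S p' q'"
  unfolding trk_def by (metis (no_types, lifting))

lemma trk_arrow:
  assumes h: "h \<in> Hom C G G" and p: "\<And>s. s \<in> S \<Longrightarrow> p s \<in> A"
  shows "trk S p (\<lambda>s. Comp C T G G h (p s))"
  by (rule trkI[OF cartesian_Ide[OF G_obj] h]) (use p Comp_Ide_left[OF T_obj G_obj] in blast)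

lemma trk_refl: "(\<And>s. s \<in> S \<Longrightarrow> p s \<in> A) \<Longrightarrow> trk S p p"
  by (rule trk_cong[OF trk_arrow[OF Ide_Hom[OF G_obj]]]) (auto simp: Comp_Ide_left[OF T_obj G_obj])

lemma trk_const:
  assumes a: "a \<in> A" and p: "\<And>s. s \<in> S \<Longrightarrow> p s \<in> A"
  shows "trk S p (\<lambda>_. a)"
proof -
  obtain t where t: "t \<in> Hom C G T" using ex_terminal[OF G_obj] by blast
  have "Comp C T G G (Comp C G T G a t) x = a" if x: "x \<in> A" for x
    using ap_pts[OF G_obj T_obj t x] Comp_Ide_right[OF T_obj G_obj a]
    by (simp add: ap_comp[OF G_obj T_obj G_obj t a x] pts_T)
  then show ?thesis
    by (intro trk_cong[OF trk_arrow[OF Comp_Hom[OF G_obj T_obj G_obj t a] p]]) (auto simp: p)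
qed

text \<open>Realize the codes \<open>p s\<close> by an object, extend \<open>q\<close> to an arrow
  on it, and extend \<open>r\<close> along that arrow.\<close>

lemma trk_trans:
  assumes pq: "trk S p q" and qr: "trk S q r"
  shows "trk S p r"
proof -
  obtain X c where c: "cartesian X G c" and X1: "\<And>x. x \<in> pts X \<Longrightarrow> \<exists>s\<in>S. Comp C T X G c x = p s"
    and X2: "\<And>s. s \<in> S \<Longrightarrow> \<exists>x\<in>pts X. Comp C T X G c x = p s"
    using trk_object[of S p] trk_mem[OF pq] by metis
  note X = cartesianD[OF c]
  obtain h where h: "h \<in> Hom C X G"
    "\<And>x s. x \<in> pts X \<Longrightarrow> s \<in> S \<Longrightarrow> Comp C T X G c x = p s \<Longrightarrow> Comp C T X G h x = q s"
    using trk_extend[OF pq X(1,3) X1] by blast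
  have "\<exists>s\<in>S. Comp C T X G h x = q s" if "x \<in> pts X" for x using X1[OF that] h(2)[OF that] by blast
  from trk_extend[OF qr X(1) h(1) this] obtain g where g: "g \<in> Hom C X G"
    "\<And>x s. x \<in> pts X \<Longrightarrow> s \<in> S \<Longrightarrow> Comp C T X G h x = q s \<Longrightarrow> Comp C T X G g x = r s"
    by blast
  show ?thesis
    by (rule trkI[OF c g(1)]) (use X2 h(2) g(2) in blast)
qed

lemma A_nonempty: obtains a where "a \<in> A"
proof -
  obtain c where "cartesian T G c" using ex_code[OF T_obj] by blast
  then show thesis using cartesianD that by blast
qed

end

section \<open>Pairing of codes, the universal partial function and application\<close>

locale sdg_pair = sdg_category U C T N \<eta> \<epsilon> G
  for U :: "'u set set" and C :: "('o, 'u) cat" and T N \<eta> \<epsilon> G +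
  fixes GG \<pi>\<^sub>1 \<pi>\<^sub>2 \<kappa>
  assumes GG: "is_product GG G G \<pi>\<^sub>1 \<pi>\<^sub>2" and \<kappa>: "cartesian GG G \<kappa>"
begin

lemmas GG_obj = cartesianD(1)[OF \<kappa>] and \<kappa>_hom = cartesianD(3)[OF \<kappa>]
  and \<pi>\<^sub>1 = productD(4)[OF GG] and \<pi>\<^sub>2 = productD(5)[OF GG] and GG_pt_eq = product_eq[OF GG]

text \<open>A pair is coded by the value of the closed arrow \<open>\<kappa>\<close> at the
  corresponding point of the product; closedness of \<open>\<kappa>\<close> is what makes the
  projections tracked.\<close>

definition pr :: "'u \<Rightarrow> 'u \<Rightarrow> 'u" where
  "pr a b = Comp C T GG G \<kappa> (THE z. z \<in> pts GG \<and> Comp C T GG G \<pi>\<^sub>1 z = a \<and> Comp C T GG G \<pi>\<^sub>2 z = b)"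

lemma pr_eq: "z \<in> pts GG \<Longrightarrow> pr (Comp C T GG G \<pi>\<^sub>1 z) (Comp C T GG G \<pi>\<^sub>2 z) = Comp C T GG G \<kappa> z"
proof -
  assume z: "z \<in> pts GG"
  have "(THE z'. z' \<in> pts GG \<and> Comp C T GG G \<pi>\<^sub>1 z' = Comp C T GG G \<pi>\<^sub>1 z \<and> Comp C T GG G \<pi>\<^sub>2 z' = Comp C T GG G \<pi>\<^sub>2 z) = z"
    by (rule the_equality) (use z GG_pt_eq in auto)
  then show ?thesis unfolding pr_def by simp
qed

lemma ex_GG_pt:
  assumes "a \<in> A" "b \<in> A"
  obtains z where "z \<in> pts GG" "Comp C T GG G \<pi>\<^sub>1 z = a" "Comp C T GG G \<pi>\<^sub>2 z = b"
  using product_pair[OF GG T_obj assms] .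

lemma pr_mem: "a \<in> A \<Longrightarrow> b \<in> A \<Longrightarrow> pr a b \<in> A"
  by (erule ex_GG_pt, assumption) (use pr_eq ap_pts[OF GG_obj G_obj \<kappa>_hom] in auto)

lemma pr_arrow:
  assumes X: "X \<in> Obj C" "h \<in> Hom C X G" "k \<in> Hom C X G"
  obtains m where "m \<in> Hom C X GG" "Comp C X GG G \<pi>\<^sub>1 m = h" "Comp C X GG G \<pi>\<^sub>2 m = k"
    "\<forall>x\<in>pts X. Comp C T X G (Comp C X GG G \<kappa> m) x = pr (Comp C T X G h x) (Comp C T X G k x)"
proof -
  obtain m where m: "m \<in> Hom C X GG" "Comp C X GG G \<pi>\<^sub>1 m = h" "Comp C X GG G \<pi>\<^sub>2 m = k"
    using product_pair[OF GG X] .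
  have "Comp C T X G (Comp C X GG G \<kappa> m) x = pr (Comp C T X G h x) (Comp C T X G k x)" if x: "x \<in> pts X" for x
    using pr_eq[OF ap_pts[OF X(1) GG_obj m(1) x]] unfolding m(2,3)[symmetric]
    by (simp add: ap_comp[OF X(1) GG_obj G_obj m(1) \<kappa>_hom x]
        ap_comp[OF X(1) GG_obj G_obj m(1) \<pi>\<^sub>1 x] ap_comp[OF X(1) GG_obj G_obj m(1) \<pi>\<^sub>2 x])
  then show thesis using that m by blast
qed

lemma trk_fst: "(\<And>s. s \<in> S \<Longrightarrow> q s \<in> A \<and> r s \<in> A) \<Longrightarrow> trk S (\<lambda>s. pr (q s) (r s)) q"
  by (rule trkI[OF \<kappa> \<pi>\<^sub>1]) (metis ex_GG_pt pr_eq)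

lemma trk_snd: "(\<And>s. s \<in> S \<Longrightarrow> q s \<in> A \<and> r s \<in> A) \<Longrightarrow> trk S (\<lambda>s. pr (q s) (r s)) r"
  by (rule trkI[OF \<kappa> \<pi>\<^sub>2]) (metis ex_GG_pt pr_eq)

lemma trk_pr:
  assumes q: "trk S p q" and r: "trk S p r"
  shows "trk S p (\<lambda>s. pr (q s) (r s))"
proof -
  obtain X c where c: "cartesian X G c" and X1: "\<And>x. x \<in> pts X \<Longrightarrow> \<exists>s\<in>S. Comp C T X G c x = p s"
    and X2: "\<And>s. s \<in> S \<Longrightarrow> \<exists>x\<in>pts X. Comp C T X G c x = p s"
    using trk_object[of S p] trk_mem[OF q] by metis
  note X = cartesianD[OF c]
  obtain h where h: "h \<in> Hom C X G"
    "\<And>x s. x \<in> pts X \<Longrightarrow> s \<in> S \<Longrightarrow> Comp C T X G c x = p s \<Longrightarrow> Comp C T X G h x = q s"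
    using trk_extend[OF q X(1,3) X1] by blast
  obtain k where k: "k \<in> Hom C X G"
    "\<And>x s. x \<in> pts X \<Longrightarrow> s \<in> S \<Longrightarrow> Comp C T X G c x = p s \<Longrightarrow> Comp C T X G k x = r s"
    using trk_extend[OF r X(1,3) X1] by blast
  obtain m where m: "m \<in> Hom C X GG"
    "\<forall>x\<in>pts X. Comp C T X G (Comp C X GG G \<kappa> m) x = pr (Comp C T X G h x) (Comp C T X G k x)"
    using pr_arrow[OF X(1) h(1) k(1)] by blast
  show ?thesis
  proof (rule trkI[OF c Comp_Hom[OF X(1) GG_obj G_obj m(1) \<kappa>_hom]])
    fix s assume s: "s \<in> S"
    obtain x where x: "x \<in> pts X" "Comp C T X G c x = p s" using X2[OF s] by blast
    then show "\<exists>x\<in>pts X. Comp C T X G c x = p s \<and> Comp C T X G (Comp C X GG G \<kappa> m) x = pr (q s) (r s)"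
      using bspec[OF m(2) x(1)] h(2)[OF x(1) s x(2)] k(2)[OF x(1) s x(2)] by auto
  qed
qed

text \<open>
  Weak local cartesian closure applied to the object of pairs \<open>a \<in> S \<subseteq> A\<close>, displayed over
  \<open>\<nabla>(Pow A)\<close>, yields a weakly universal family of partial functions from \<open>A\<close> to \<open>A\<close>. A code
  of a member of the family is an arrow into \<open>G\<close>, and discreteness makes
  application depend on the code only.
\<close>

lemma ex_universal_partial_function:
  obtains P \<alpha> \<beta> w where "P \<in> Obj C" "\<alpha> \<in> Hom C P G" "\<beta> \<in> Hom C P G" "w \<in> Hom C P G"
    "trk (pts P) (\<lambda>t. pr (Comp C T P G \<alpha> t) (Comp C T P G \<beta> t)) (\<lambda>t. Comp C T P G w t)"
    "\<forall>D v. D \<subseteq> A \<times> A \<longrightarrow> trk D (\<lambda>(a, b). pr a b) v \<longrightarrow> (\<exists>c\<in>Hom C G G. \<forall>(a, b)\<in>D. \<exists>t\<in>pts P.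
      Comp C T P G \<alpha> t = Comp C T G G c a \<and> Comp C T P G \<beta> t = b \<and> Comp C T P G w t = v (a, b))"
proof -
  \<comment> \<open>Members of \<open>U\<close> consist of elements of \<open>'u\<close>, so subsets
    of \<open>A\<close> are named by elements of a set \<open>Y\<close> through the injection
    \<open>j\<close>.\<close>
  obtain Y where Y: "Y \<in> U" "Pow A \<lesssim> Y" using Pow_U[OF A_U] by (elim bexE)
  then obtain j where j: "inj_on j (Pow A)" "j ` Pow A \<subseteq> Y" unfolding lepoll_def by (elim exE conjE)
  let ?I = "FObj N Y"
  have I: "?I \<in> Obj C" using nabla_obj[OF Y(1)] .
  obtain M g1 g2 where M_prod: "is_product M G ?I g1 g2" using ex_product[OF G_obj I] .
  note M = productD(1)[OF M_prod] and g1 = productD(4)[OF M_prod] and g2 = productD(5)[OF M_prod]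
  \<comment> \<open>The membership relation: the points of \<open>J\<close> are pairs of an element
    and a subset of \<open>A\<close> containing it. \<open>u\<close> gives the name of the subset
    and \<open>\<beta>0\<close> the element.\<close>
  define SJ where "SJ = {z \<in> pts M. \<exists>S\<subseteq>A. \<epsilon> Y (Comp C T M ?I g2 z) = j S \<and> Comp C T M G g1 z \<in> S}"
  have SJ: "SJ \<subseteq> pts M" unfolding SJ_def by blast
  obtain J \<iota> \<theta> where \<iota>: "cartesian J M \<iota>" and J_sub:
    "\<forall>b\<in>pts J. Comp C T J M \<iota> b \<in> SJ" "\<forall>s\<in>SJ. \<theta> s \<in> pts J" "\<forall>s\<in>SJ. Comp C T J M \<iota> (\<theta> s) = s"
    "\<forall>b\<in>pts J. \<theta> (Comp C T J M \<iota> b) = b"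
    using ex_sub[OF M SJ] .
  note \<iota>_mem = bspec[OF J_sub(1)] and \<theta> = bspec[OF J_sub(2)] bspec[OF J_sub(3)]
  note J = cartesianD(1)[OF \<iota>] and \<iota>_hom = cartesianD(3)[OF \<iota>]
  define u where "u = Comp C J M ?I g2 \<iota>"
  define \<beta>0 where "\<beta>0 = Comp C J M G g1 \<iota>"
  have u: "u \<in> Hom C J ?I" unfolding u_def by (rule Comp_Hom[OF J M I \<iota>_hom g2])
  have \<beta>0: "\<beta>0 \<in> Hom C J G" unfolding \<beta>0_def by (rule Comp_Hom[OF J M G_obj \<iota>_hom g1])
  have u_ap: "Comp C T J ?I u y = Comp C T M ?I g2 (Comp C T J M \<iota> y)" if "y \<in> pts J" for y
    unfolding u_def by (rule ap_comp[OF J M I \<iota>_hom g2 that])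
  have \<beta>0_ap: "Comp C T J G \<beta>0 y = Comp C T M G g1 (Comp C T J M \<iota> y)" if "y \<in> pts J" for y
    unfolding \<beta>0_def by (rule ap_comp[OF J M G_obj \<iota>_hom g1 that])
  \<comment> \<open>With \<open>B\<close> the product of \<open>J\<close> and \<open>G\<close>, a
    section of \<open>b\<close> over the fibre of \<open>u\<close> at a subset is a function from
    that subset to \<open>G\<close>.\<close>
  obtain B b b2 where B_prod: "is_product B J G b b2" using ex_product[OF J G_obj] .
  note B = productD(1)[OF B_prod] and b = productD(4)[OF B_prod] and b2 = productD(5)[OF B_prod]
  obtain R r P p q w0 where P: "is_pullback C P J R ?I p q u r" and w0: "w0 \<in> Hom C P B" "Comp C P B J b w0 = p"
    and univ: "\<forall>X\<in>Obj C. \<forall>x\<in>Hom C X ?I. \<exists>P' p' q'. is_pullback C P' J X ?I p' q' u x \<and>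
      (\<forall>m\<in>Hom C P' B. Comp C P' B J b m = p' \<longrightarrow>
        (\<exists>k\<in>Hom C X R. Comp C X R ?I r k = x \<and> (\<exists>n\<in>Hom C P' P. Comp C P' P J p n = p' \<and>
          Comp C P' P R q n = Comp C P' X R k q' \<and> Comp C P' P B w0 n = m)))"
    using weakly_locally_cartesian_closedD[OF wlcc B b J I u] by (elim exE conjE)
  note dP = pullbackD[OF P]
  note Po = dP(1) and R = dP(3) and p = dP(5) and q = dP(6) and r = dP(8)
  obtain \<rho> where \<rho>: "cartesian R G \<rho>" using ex_code[OF R] by blast
  note \<rho>_hom = cartesianD(3)[OF \<rho>]
  \<comment> \<open>At a point of \<open>P\<close>, \<open>\<alpha>\<close> is the code of a
    function, \<open>\<beta>\<close> the argument and \<open>w\<close> the value.\<close>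
  define \<alpha> \<beta> w where "\<alpha> = Comp C P R G \<rho> q" and "\<beta> = Comp C P J G \<beta>0 p" and "w = Comp C P B G b2 w0"
  have \<alpha>: "\<alpha> \<in> Hom C P G" unfolding \<alpha>_def by (rule Comp_Hom[OF Po R G_obj q \<rho>_hom])
  have \<beta>: "\<beta> \<in> Hom C P G" unfolding \<beta>_def by (rule Comp_Hom[OF Po J G_obj p \<beta>0])
  have w: "w \<in> Hom C P G" unfolding w_def by (rule Comp_Hom[OF Po B G_obj w0(1) b2])
  have \<alpha>_ap: "Comp C T P G \<alpha> t = Comp C T R G \<rho> (Comp C T P R q t)" if "t \<in> pts P" for t
    unfolding \<alpha>_def by (rule ap_comp[OF Po R G_obj q \<rho>_hom that])
  have \<beta>_ap: "Comp C T P G \<beta> t = Comp C T J G \<beta>0 (Comp C T P J p t)" if "t \<in> pts P" for t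
    unfolding \<beta>_def by (rule ap_comp[OF Po J G_obj p \<beta>0 that])
  have w_ap: "Comp C T P G w t = Comp C T B G b2 (Comp C T P B w0 t)" if "t \<in> pts P" for t
    unfolding w_def by (rule ap_comp[OF Po B G_obj w0(1) b2 that])
  obtain m where m: "m \<in> Hom C P GG" "Comp C P GG G \<pi>\<^sub>1 m = \<alpha>" "Comp C P GG G \<pi>\<^sub>2 m = \<beta>"
    "\<forall>t\<in>pts P. Comp C T P G (Comp C P GG G \<kappa> m) t = pr (Comp C T P G \<alpha> t) (Comp C T P G \<beta> t)"
    using pr_arrow[OF Po \<alpha> \<beta>] .
  have \<kappa>m: "Comp C P GG G \<kappa> m \<in> Hom C P G" by (rule Comp_Hom[OF Po GG_obj G_obj m(1) \<kappa>_hom])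
  \<comment> \<open>Closedness of the paired codes: an arrow into the pullback \<open>P\<close> is
    assembled from a lift into \<open>R\<close> along \<open>\<rho>\<close> and a lift into
    \<open>J\<close> along \<open>\<iota>\<close>. For the latter, the code \<open>h2\<close> gives
    only the element; the name of the subset is supplied by \<open>r\<close> after the lift
    \<open>v\<close>.\<close>
  have cart: "cartesian P G (Comp C P GG G \<kappa> m)"
  proof (rule cartesianI[OF Po G_obj \<kappa>m])
    fix W h k assume W: "W \<in> Obj C" "h \<in> Hom C W G" and k: "k \<in> pts W \<rightarrow> pts P"
      and kh: "\<And>t. t \<in> pts W \<Longrightarrow> Comp C T P G (Comp C P GG G \<kappa> m) (k t) = Comp C T W G h t"
    have kt: "k t \<in> pts P" if "t \<in> pts W" for t using k that by blast
    have k1: "(\<lambda>t. Comp C T P GG m (k t)) \<in> pts W \<rightarrow> pts GG" using ap_pts[OF Po GG_obj m(1) kt] by blast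
    have "Comp C T GG G \<kappa> (Comp C T P GG m (k t)) = Comp C T W G h t" if "t \<in> pts W" for t
      using kh[OF that] unfolding ap_comp[OF Po GG_obj G_obj m(1) \<kappa>_hom kt[OF that]] .
    from cartesian_lift[OF \<kappa> W k1 this] obtain h' where h': "h' \<in> Hom C W GG"
      "\<And>t. t \<in> pts W \<Longrightarrow> Comp C T W GG h' t = Comp C T P GG m (k t)"
      by blast
    define h1 h2 where "h1 = Comp C W GG G \<pi>\<^sub>1 h'" and "h2 = Comp C W GG G \<pi>\<^sub>2 h'"
    have h12: "h1 \<in> Hom C W G" "h2 \<in> Hom C W G"
      unfolding h1_def h2_def by (rule Comp_Hom[OF W(1) GG_obj G_obj h'(1) \<pi>\<^sub>1], rule Comp_Hom[OF W(1) GG_obj G_obj h'(1) \<pi>\<^sub>2])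
    have h1_ap: "Comp C T W G h1 t = Comp C T R G \<rho> (Comp C T P R q (k t))" if t: "t \<in> pts W" for t
      unfolding h1_def ap_comp[OF W(1) GG_obj G_obj h'(1) \<pi>\<^sub>1 t] h'(2)[OF t]
        ap_comp[OF Po GG_obj G_obj m(1) \<pi>\<^sub>1 kt[OF t], symmetric] m(2) by (rule \<alpha>_ap[OF kt[OF t]])
    have h2_ap: "Comp C T W G h2 t = Comp C T J G \<beta>0 (Comp C T P J p (k t))" if t: "t \<in> pts W" for t
      unfolding h2_def ap_comp[OF W(1) GG_obj G_obj h'(1) \<pi>\<^sub>2 t] h'(2)[OF t]
        ap_comp[OF Po GG_obj G_obj m(1) \<pi>\<^sub>2 kt[OF t], symmetric] m(3) by (rule \<beta>_ap[OF kt[OF t]])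
    have "(\<lambda>t. Comp C T P R q (k t)) \<in> pts W \<rightarrow> pts R" using ap_pts[OF Po R q kt] by blast
    from cartesian_lift[OF \<rho> W(1) h12(1) this h1_ap[symmetric]]
    obtain v where v: "v \<in> Hom C W R" "\<And>t. t \<in> pts W \<Longrightarrow> Comp C T W R v t = Comp C T P R q (k t)"
      by blast
    have rv: "Comp C W R ?I r v \<in> Hom C W ?I" by (rule Comp_Hom[OF W(1) R I v(1) r])
    have rv_ap: "Comp C T W ?I (Comp C W R ?I r v) t = Comp C T J ?I u (Comp C T P J p (k t))" if t: "t \<in> pts W" for t
      unfolding ap_comp[OF W(1) R I v(1) r t] v(2)[OF t] ap_comp[OF Po R I q r kt[OF t], symmetric]
        ap_comp[OF Po J I p u kt[OF t], symmetric] dP(9) ..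
    obtain y where y: "y \<in> Hom C W M" "Comp C W M G g1 y = h2" "Comp C W M ?I g2 y = Comp C W R ?I r v"
      using product_pair[OF M_prod W(1) h12(2) rv] .
    have pk: "Comp C T P J p (k t) \<in> pts J" if "t \<in> pts W" for t using ap_pts[OF Po J p kt[OF that]] .
    have y_ap: "Comp C T J M \<iota> (Comp C T P J p (k t)) = Comp C T W M y t" if t: "t \<in> pts W" for t
    proof (rule product_eq[OF M_prod ap_pts[OF J M \<iota>_hom pk[OF t]] ap_pts[OF W(1) M y(1) t]])
      show "Comp C T M G g1 (Comp C T J M \<iota> (Comp C T P J p (k t))) = Comp C T M G g1 (Comp C T W M y t)"
        unfolding ap_comp[OF W(1) M G_obj y(1) g1 t, symmetric] y(2) h2_ap[OF t] \<beta>0_ap[OF pk[OF t]] ..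
      show "Comp C T M ?I g2 (Comp C T J M \<iota> (Comp C T P J p (k t))) = Comp C T M ?I g2 (Comp C T W M y t)"
        unfolding ap_comp[OF W(1) M I y(1) g2 t, symmetric] y(3) rv_ap[OF t] u_ap[OF pk[OF t]] ..
    qed
    have "(\<lambda>t. Comp C T P J p (k t)) \<in> pts W \<rightarrow> pts J" using pk by blast
    from cartesian_lift[OF \<iota> W(1) y(1) this y_ap] obtain y' where y': "y' \<in> Hom C W J"
      "\<And>t. t \<in> pts W \<Longrightarrow> Comp C T W J y' t = Comp C T P J p (k t)" by blast
    have "Comp C W J ?I u y' = Comp C W R ?I r v"
      by (rule faithful[OF W(1) I Comp_Hom[OF W(1) J I y'(1) u] rv])
        (simp add: rv_ap ap_comp[OF W(1) J I y'(1) u] y'(2))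
    from pullback_ex1[OF P W(1) y'(1) v(1) this] obtain n where n: "n \<in> Hom C W P"
      "Comp C W P J p n = y'" "Comp C W P R q n = v" by blast
    have "Comp C T W P n t = k t" if t: "t \<in> pts W" for t
      by (rule pullback_eq[OF P T_obj ap_pts[OF W(1) Po n(1) t] kt[OF t]])
        (simp_all add: ap_comp[OF W(1) Po J n(1) p t, symmetric] ap_comp[OF W(1) Po R n(1) q t, symmetric]
          n(2,3) y'(2)[OF t] v(2)[OF t])
    then show "\<exists>n\<in>Hom C W P. \<forall>t\<in>pts W. Comp C T W P n t = k t" using n(1) by blast
  qed
  have trk: "trk (pts P) (\<lambda>t. pr (Comp C T P G \<alpha> t) (Comp C T P G \<beta> t)) (\<lambda>t. Comp C T P G w t)"
    by (rule trkI[OF cart w]) (use m(4) in blast)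
  have "\<exists>c\<in>Hom C G G. \<forall>(a, b)\<in>D. \<exists>t\<in>pts P.
      Comp C T P G \<alpha> t = Comp C T G G c a \<and> Comp C T P G \<beta> t = b \<and> Comp C T P G w t = v (a, b)"
    if D: "D \<subseteq> A \<times> A" and trkD: "trk D (\<lambda>(a, b). pr a b) v" for D v
  proof -
    \<comment> \<open>The function coded at \<open>a\<close> is to have the slice of
      \<open>D\<close> at \<open>a\<close> as its domain. Any assignment of domains is an arrow into
      \<nabla> of \<open>Y\<close>.\<close>
    have "(\<lambda>a. j {b. (a, b) \<in> D}) \<in> pts G \<rightarrow> Y"
    proof (rule Pi_I)
      fix a
      have "{b. (a, b) \<in> D} \<in> Pow A" using D by blast
      then show "j {b. (a, b) \<in> D} \<in> Y" using j(2) by blast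
    qed
    from nabla_ex1[OF G_obj Y(1) this] obtain x where x: "x \<in> Hom C G ?I"
      "\<And>a. a \<in> A \<Longrightarrow> \<epsilon> Y (Comp C T G ?I x a) = j {b. (a, b) \<in> D}" by blast
    from bspec[OF bspec[OF univ G_obj] x(1)]
    obtain P' p' q' where P': "is_pullback C P' J G ?I p' q' u x"
      and lift: "\<forall>m\<in>Hom C P' B. Comp C P' B J b m = p' \<longrightarrow>
        (\<exists>k\<in>Hom C G R. Comp C G R ?I r k = x \<and> (\<exists>n\<in>Hom C P' P. Comp C P' P J p n = p' \<and>
          Comp C P' P R q n = Comp C P' G R k q' \<and> Comp C P' P B w0 n = m))"
      by (elim exE conjE)
    note d' = pullbackD[OF P']
    note P'o = d'(1) and p' = d'(5) and q' = d'(6)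
    define \<beta>' where "\<beta>' = Comp C P' J G \<beta>0 p'"
    have \<beta>': "\<beta>' \<in> Hom C P' G" unfolding \<beta>'_def by (rule Comp_Hom[OF P'o J G_obj p' \<beta>0])
    have \<beta>'_ap: "Comp C T P' G \<beta>' t = Comp C T J G \<beta>0 (Comp C T P' J p' t)" if "t \<in> pts P'" for t
      unfolding \<beta>'_def by (rule ap_comp[OF P'o J G_obj p' \<beta>0 that])
    obtain d0 where d0: "d0 \<in> Hom C P' GG"
      "\<forall>t\<in>pts P'. Comp C T P' G (Comp C P' GG G \<kappa> d0) t = pr (Comp C T P' G q' t) (Comp C T P' G \<beta>' t)"
      using pr_arrow[OF P'o q' \<beta>'] by blast
    \<comment> \<open>Pulling \<open>J\<close> back along \<open>x\<close> makes the points of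
      \<open>P'\<close> stand for the pairs in \<open>D\<close>; injectivity of \<open>j\<close>
      recovers the slice from its name.\<close>
    have in_D: "(Comp C T P' G q' t, Comp C T P' G \<beta>' t) \<in> D" if t: "t \<in> pts P'" for t
    proof -
      have pt: "Comp C T P' J p' t \<in> pts J" using ap_pts[OF P'o J p' t] .
      obtain S where S: "S \<subseteq> A" "\<epsilon> Y (Comp C T J ?I u (Comp C T P' J p' t)) = j S"
        "Comp C T J G \<beta>0 (Comp C T P' J p' t) \<in> S"
        using \<iota>_mem[OF pt] unfolding SJ_def u_ap[OF pt] \<beta>0_ap[OF pt] by blast
      have "Comp C T J ?I u (Comp C T P' J p' t) = Comp C T G ?I x (Comp C T P' G q' t)"
        unfolding ap_comp[OF P'o J I p' u t, symmetric] ap_comp[OF P'o G_obj I q' x(1) t, symmetric] d'(9) ..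
      then have "j S = j {b. (Comp C T P' G q' t, b) \<in> D}"
        using S(2) x(2)[OF ap_pts[OF P'o G_obj q' t]] by simp
      moreover have "{b. (Comp C T P' G q' t, b) \<in> D} \<subseteq> A" using D by blast
      ultimately have "S = {b. (Comp C T P' G q' t, b) \<in> D}" using inj_onD[OF j(1)] S(1) by blast
      then show ?thesis using S(3) \<beta>'_ap[OF t] by simp
    qed
    have d0_D: "\<exists>s\<in>D. Comp C T P' G (Comp C P' GG G \<kappa> d0) t = (case s of (a, b) \<Rightarrow> pr a b)" if "t \<in> pts P'" for t
      using in_D[OF that] bspec[OF d0(2) that] by (intro bexI[of _ "(Comp C T P' G q' t, Comp C T P' G \<beta>' t)"]) simp_all
    obtain v' where v': "v' \<in> Hom C P' G"
      "\<And>t s. t \<in> pts P' \<Longrightarrow> s \<in> D \<Longrightarrow> Comp C T P' G (Comp C P' GG G \<kappa> d0) t = (case s of (a, b) \<Rightarrow> pr a b) \<Longrightarrow>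
        Comp C T P' G v' t = v s"
      using trk_extend[OF trkD P'o Comp_Hom[OF P'o GG_obj G_obj d0(1) \<kappa>_hom] d0_D] by blast
    \<comment> \<open>By \<open>trk_extend\<close> the tracked function \<open>v\<close> has become
      an arrow \<open>v'\<close> on \<open>P'\<close>. Together with \<open>p'\<close> it is an
      arrow into \<open>B\<close> over \<open>J\<close>, to which weak universality applies.\<close>
    obtain m0 where m0: "m0 \<in> Hom C P' B" "Comp C P' B J b m0 = p'" "Comp C P' B G b2 m0 = v'"
      using product_pair[OF B_prod P'o p' v'(1)] .
    obtain k n where k: "k \<in> Hom C G R" "Comp C G R ?I r k = x" and n: "n \<in> Hom C P' P" "Comp C P' P J p n = p'"
      "Comp C P' P R q n = Comp C P' G R k q'" "Comp C P' P B w0 n = m0"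
      using lift[rule_format, OF m0(1,2)] by blast
    have "\<exists>t\<in>pts P. Comp C T P G \<alpha> t = Comp C T G G (Comp C G R G \<rho> k) a \<and> Comp C T P G \<beta> t = c \<and> Comp C T P G w t = v (a, c)"
      if ac: "(a, c) \<in> D" for a c
    proof -
      have a: "a \<in> pts G" and c: "c \<in> pts G" using D ac by auto
      obtain z where z: "z \<in> pts M" "Comp C T M G g1 z = c" "Comp C T M ?I g2 z = Comp C T G ?I x a"
        using product_pair[OF M_prod T_obj c ap_pts[OF G_obj I x(1) a]] .
      have "{b. (a, b) \<in> D} \<subseteq> A" using D by blast
      then have zS: "z \<in> SJ" unfolding SJ_def using z x(2)[OF a] ac by auto
      note y = \<theta>[OF zS]
      have "Comp C T J ?I u (\<theta> z) = Comp C T G ?I x a" unfolding u_ap[OF y(1)] y(2) z(3) ..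
      from pullback_point[OF P' y(1) a this] obtain t' where t': "t' \<in> pts P'" "Comp C T P' J p' t' = \<theta> z"
        "Comp C T P' G q' t' = a" by blast
      let ?t = "Comp C T P' P n t'"
      have t: "?t \<in> pts P" using ap_pts[OF P'o Po n(1) t'(1)] .
      have \<beta>'t: "Comp C T P' G \<beta>' t' = c" unfolding \<beta>'_ap[OF t'(1)] t'(2) \<beta>0_ap[OF y(1)] y(2) z(2) ..
      have "Comp C T P R q ?t = Comp C T G R k a"
        unfolding ap_comp[OF P'o Po R n(1) q t'(1), symmetric] n(3) ap_comp[OF P'o G_obj R q' k(1) t'(1)] t'(3) ..
      then have "Comp C T P G \<alpha> ?t = Comp C T G G (Comp C G R G \<rho> k) a"
        unfolding \<alpha>_ap[OF t] ap_comp[OF G_obj R G_obj k(1) \<rho>_hom a] by simp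
      moreover have "Comp C T P G \<beta> ?t = c"
        unfolding \<beta>_ap[OF t] ap_comp[OF P'o Po J n(1) p t'(1), symmetric] n(2) \<beta>'_ap[OF t'(1), symmetric] by (rule \<beta>'t)
      moreover have "Comp C T P G w ?t = v (a, c)"
      proof -
        have "Comp C T P G w ?t = Comp C T P' G v' t'"
          unfolding w_ap[OF t] ap_comp[OF P'o Po B n(1) w0(1) t'(1), symmetric] n(4)
            ap_comp[OF P'o B G_obj m0(1) b2 t'(1), symmetric] m0(3) ..
        also have "\<dots> = v (a, c)" by (rule v'(2)[OF t'(1) ac]) (simp add: bspec[OF d0(2) t'(1)] t'(3) \<beta>'t)
        finally show ?thesis .
      qed
      ultimately show ?thesis using t by blast
    qed
    then show ?thesis using Comp_Hom[OF G_obj R G_obj k(1) \<rho>_hom]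
      by (intro bexI[of _ "Comp C G R G \<rho> k"]) auto
  qed
  then show thesis using that[OF Po \<alpha> \<beta> w trk] by blast
qed

text \<open>Several points of \<open>P\<close> may share the codes of function and argument. That
  \<open>w\<close> takes one value on them is \<open>trk_fun\<close>, applied to the tracking of
  \<open>w\<close> from the paired codes.\<close>

lemma ex_application:
  obtains app :: "'u \<Rightarrow> 'u \<Rightarrow> 'u option" where
    "\<And>a b v. app a b = Some v \<Longrightarrow> a \<in> A \<and> b \<in> A \<and> v \<in> A"
    "trk {(a, b). app a b \<noteq> None} (\<lambda>(a, b). pr a b) (\<lambda>(a, b). the (app a b))"
    "\<And>D v. D \<subseteq> A \<times> A \<Longrightarrow> trk D (\<lambda>(a, b). pr a b) v \<Longrightarrow>
      \<exists>c\<in>Hom C G G. \<forall>(a, b)\<in>D. app (Comp C T G G c a) b = Some (v (a, b))"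
proof -
  obtain P \<alpha> \<beta> w where P: "P \<in> Obj C" "\<alpha> \<in> Hom C P G" "\<beta> \<in> Hom C P G" "w \<in> Hom C P G"
    and trk: "trk (pts P) (\<lambda>t. pr (Comp C T P G \<alpha> t) (Comp C T P G \<beta> t)) (\<lambda>t. Comp C T P G w t)"
    and univ: "\<forall>D v. D \<subseteq> A \<times> A \<longrightarrow> trk D (\<lambda>(a, b). pr a b) v \<longrightarrow> (\<exists>c\<in>Hom C G G. \<forall>(a, b)\<in>D. \<exists>t\<in>pts P.
      Comp C T P G \<alpha> t = Comp C T G G c a \<and> Comp C T P G \<beta> t = b \<and> Comp C T P G w t = v (a, b))"
    using ex_universal_partial_function .
  define code where "code a b t \<longleftrightarrow> t \<in> pts P \<and> Comp C T P G \<alpha> t = a \<and> Comp C T P G \<beta> t = b" for a b t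
  define app where "app a b = (if \<exists>t. code a b t then Some (Comp C T P G w (SOME t. code a b t)) else None)" for a b
  have app: "app a b = Some (Comp C T P G w t)" if t: "code a b t" for a b t
  proof -
    have t': "code a b (SOME t. code a b t)" using t by (rule someI)
    have "Comp C T P G w (SOME t. code a b t) = Comp C T P G w t"
      by (rule trk_fun[OF trk]) (use t t' in \<open>simp_all add: code_def\<close>)
    then show ?thesis unfolding app_def using t by auto
  qed
  have appD: "\<exists>t. code a b t \<and> Comp C T P G w t = v" if v: "app a b = Some v" for a b v
  proof -
    obtain t where t: "code a b t" using v unfolding app_def by (auto split: if_splits)
    then show ?thesis using app[OF t] v by auto
  qed
  show thesis
  proof (rule that[of app])
    show "a \<in> A \<and> b \<in> A \<and> v \<in> A" if v: "app a b = Some v" for a b v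
    proof -
      obtain t where t: "t \<in> pts P" "Comp C T P G \<alpha> t = a" "Comp C T P G \<beta> t = b" "Comp C T P G w t = v"
        using appD[OF v] unfolding code_def by blast
      show ?thesis
        using ap_pts[OF P(1) G_obj P(2) t(1)] ap_pts[OF P(1) G_obj P(3) t(1)] ap_pts[OF P(1) G_obj P(4) t(1)]
        unfolding t(2-4) by blast
    qed
    define f where "f = (\<lambda>(a, b). SOME t. code a b t)"
    have f: "code a b (f (a, b))" if "app a b \<noteq> None" for a b
    proof -
      have "\<exists>t. code a b t" using that unfolding app_def by (auto split: if_splits)
      then show ?thesis unfolding f_def prod.case by (rule someI_ex)
    qed
    have "trk {(a, b). app a b \<noteq> None} (\<lambda>s. pr (Comp C T P G \<alpha> (f s)) (Comp C T P G \<beta> (f s))) (\<lambda>s. Comp C T P G w (f s))"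
    proof (rule trk_reindex[OF trk])
      fix s assume "s \<in> {(a, b). app a b \<noteq> None}"
      then obtain a b where "s = (a, b)" "app a b \<noteq> None" by blast
      then show "f s \<in> pts P" using f[of a b] unfolding code_def by simp
    qed
    then show "trk {(a, b). app a b \<noteq> None} (\<lambda>(a, b). pr a b) (\<lambda>(a, b). the (app a b))"
    proof (rule trk_cong)
      fix s assume "s \<in> {(a, b). app a b \<noteq> None}"
      then obtain a b where s: "s = (a, b)" and ne: "app a b \<noteq> None" by blast
      show "pr (Comp C T P G \<alpha> (f s)) (Comp C T P G \<beta> (f s)) = (case s of (a, b) \<Rightarrow> pr a b)"
        using f[OF ne] unfolding s code_def by simp
      show "Comp C T P G w (f s) = (case s of (a, b) \<Rightarrow> the (app a b))"
        using app[OF f[OF ne]] unfolding s by simp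
    qed
    show "\<exists>c\<in>Hom C G G. \<forall>(a, b)\<in>D. app (Comp C T G G c a) b = Some (v (a, b))"
      if D: "D \<subseteq> A \<times> A" "trk D (\<lambda>(a, b). pr a b) v" for D v
    proof -
      obtain c where c: "c \<in> Hom C G G" "\<forall>(a, b)\<in>D. \<exists>t\<in>pts P.
          Comp C T P G \<alpha> t = Comp C T G G c a \<and> Comp C T P G \<beta> t = b \<and> Comp C T P G w t = v (a, b)"
        using univ[rule_format, OF D] by (elim bexE)
      have "app (Comp C T G G c a) b = Some (v (a, b))" if ab: "(a, b) \<in> D" for a b
      proof -
        obtain t where t: "code (Comp C T G G c a) b t" "Comp C T P G w t = v (a, b)"
          using bspec[OF c(2) ab] unfolding code_def prod.case by blast
        show ?thesis using app[OF t(1)] t(2) by simp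
      qed
      then have "\<forall>(a, b)\<in>D. app (Comp C T G G c a) b = Some (v (a, b))" by blast
      then show ?thesis using c(1) by (rule bexI)
    qed
  qed
qed

end

section \<open>Partial combinatory algebras\<close>

locale pca_structure =
  fixes A :: "'u set" and app :: "'u \<Rightarrow> 'u \<Rightarrow> 'u option"
  assumes pca: "pca A app"
begin

lemma app_mem: "a \<in> A \<Longrightarrow> b \<in> A \<Longrightarrow> app a b = Some c \<Longrightarrow> c \<in> A"
  using pca unfolding pca_def partial_applicative_structure_def by blast

lemma polynomial_realizer:
  assumes "polynomial_over A (Suc n) t"
  obtains e where "e \<in> A" "\<forall>as a v. length as = n \<longrightarrow> set as \<subseteq> A \<longrightarrow> app_list app e as \<noteq> None \<and>
    (a \<in> A \<longrightarrow> eval_polynomial app (as @ [a]) t = Some v \<longrightarrow> app_list app e (as @ [a]) = Some v)"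
proof -
  obtain e where "e \<in> A" "\<forall>as. length as = n \<and> set as \<subseteq> A \<longrightarrow> app_list app e as \<noteq> None \<and>
      (\<forall>a\<in>A. eval_polynomial app (as @ [a]) t \<preceq> app_list app e (as @ [a]))"
    using pca assms unfolding pca_def by blast
  then show thesis using that unfolding refines_def by blast
qed

lemma realizer1:
  assumes "polynomial_over A 1 t"
  obtains e where "e \<in> A" "\<forall>a\<in>A. \<forall>v. eval_polynomial app [a] t = Some v \<longrightarrow> app e a = Some v"
proof -
  obtain e where e: "e \<in> A" "\<forall>as a v. length as = 0 \<longrightarrow> set as \<subseteq> A \<longrightarrow> app_list app e as \<noteq> None \<and>
      (a \<in> A \<longrightarrow> eval_polynomial app (as @ [a]) t = Some v \<longrightarrow> app_list app e (as @ [a]) = Some v)"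
    using polynomial_realizer[of 0 t] assms by auto
  then have "\<forall>a\<in>A. \<forall>v. eval_polynomial app [a] t = Some v \<longrightarrow> app e a = Some v"
    by (simp add: app_list_def papp_def)
  then show thesis using that e(1) by blast
qed

lemma realizer2:
  assumes "polynomial_over A 2 t"
  obtains e where "e \<in> A" "\<forall>a\<in>A. \<exists>c\<in>A. app e a = Some c \<and>
    (\<forall>b\<in>A. \<forall>v. eval_polynomial app [a, b] t = Some v \<longrightarrow> app c b = Some v)"
proof -
  obtain e where e: "e \<in> A" "\<forall>as a v. length as = 1 \<longrightarrow> set as \<subseteq> A \<longrightarrow> app_list app e as \<noteq> None \<and>
      (a \<in> A \<longrightarrow> eval_polynomial app (as @ [a]) t = Some v \<longrightarrow> app_list app e (as @ [a]) = Some v)"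
    using polynomial_realizer[of 1 t] assms by (auto simp: numeral_2_eq_2)
  have "\<exists>c\<in>A. app e a = Some c \<and> (\<forall>b\<in>A. \<forall>v. eval_polynomial app [a, b] t = Some v \<longrightarrow> app c b = Some v)"
    if a: "a \<in> A" for a
  proof -
    obtain c where c: "app e a = Some c" using e(2)[rule_format, of "[a]"] a by (auto simp: app_list_def papp_def)
    have "app c b = Some v" if "b \<in> A" "eval_polynomial app [a, b] t = Some v" for b v
      using e(2)[rule_format, of "[a]" b v] that a c by (simp add: app_list_def papp_def)
    then show ?thesis using c app_mem[OF e(1) a c] by blast
  qed
  then show thesis using that[OF e(1)] by blast
qed

lemma realizer3:
  assumes "polynomial_over A 3 t"
  obtains e where "e \<in> A" "\<forall>a\<in>A. \<forall>b\<in>A. \<exists>c\<in>A. \<exists>d\<in>A. app e a = Some c \<and> app c b = Some d \<and>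
    (\<forall>x\<in>A. \<forall>v. eval_polynomial app [a, b, x] t = Some v \<longrightarrow> app d x = Some v)"
proof -
  obtain e where e: "e \<in> A" "\<forall>as a v. length as = 2 \<longrightarrow> set as \<subseteq> A \<longrightarrow> app_list app e as \<noteq> None \<and>
      (a \<in> A \<longrightarrow> eval_polynomial app (as @ [a]) t = Some v \<longrightarrow> app_list app e (as @ [a]) = Some v)"
    using polynomial_realizer[of 2 t] assms by (auto simp: numeral_2_eq_2 numeral_3_eq_3)
  have "\<exists>c\<in>A. \<exists>d\<in>A. app e a = Some c \<and> app c b = Some d \<and>
      (\<forall>x\<in>A. \<forall>v. eval_polynomial app [a, b, x] t = Some v \<longrightarrow> app d x = Some v)"
    if a: "a \<in> A" and b: "b \<in> A" for a b
  proof -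
    obtain d where "app_list app e [a, b] = Some d" using e(2)[rule_format, of "[a, b]"] a b by auto
    then obtain c where c: "app e a = Some c" and d: "app c b = Some d"
      by (cases "app e a") (auto simp: app_list_def papp_def)
    have "app d x = Some v" if "x \<in> A" "eval_polynomial app [a, b, x] t = Some v" for x v
      using e(2)[rule_format, of "[a, b]" x v] that a b c d by (simp add: app_list_def papp_def)
    moreover have "c \<in> A" by (rule app_mem[OF e(1) a c])
    moreover have "d \<in> A" by (rule app_mem[OF \<open>c \<in> A\<close> b d])
    ultimately show ?thesis using c d by blast
  qed
  then show thesis using that[OF e(1)] by blast
qed

section \<open>Tracked functions, pairing and currying in the algebra\<close>

definition tracked :: "'x set \<Rightarrow> ('x \<Rightarrow> 'u) \<Rightarrow> ('x \<Rightarrow> 'u) \<Rightarrow> bool" where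
  "tracked S p q \<longleftrightarrow> (\<exists>e\<in>A. \<forall>s\<in>S. app e (p s) = Some (q s))"

lemma tracked_polynomial:
  assumes t: "polynomial_over A 1 t" and p: "\<And>s. s \<in> S \<Longrightarrow> p s \<in> A"
    and q: "\<And>s. s \<in> S \<Longrightarrow> eval_polynomial app [p s] t = Some (q s)"
  shows "tracked S p q"
proof -
  obtain e where "e \<in> A" "\<forall>a\<in>A. \<forall>v. eval_polynomial app [a] t = Some v \<longrightarrow> app e a = Some v"
    using realizer1[OF t] .
  then show ?thesis using p q unfolding tracked_def by blast
qed

lemma tracked_refl: "(\<And>s. s \<in> S \<Longrightarrow> p s \<in> A) \<Longrightarrow> tracked S p p"
  by (rule tracked_polynomial[of "Var 0"]) simp_all

lemma tracked_const: "a \<in> A \<Longrightarrow> (\<And>s. s \<in> S \<Longrightarrow> p s \<in> A) \<Longrightarrow> tracked S p (\<lambda>_. a)"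
  by (rule tracked_polynomial[of "Const a"]) simp_all

lemma tracked_mem: "tracked S p q \<Longrightarrow> s \<in> S \<Longrightarrow> p s \<in> A \<Longrightarrow> q s \<in> A"
  unfolding tracked_def using app_mem by blast

lemma tracked_trans:
  assumes p: "\<And>s. s \<in> S \<Longrightarrow> p s \<in> A" and "tracked S p q" "tracked S q r"
  shows "tracked S p r"
proof -
  obtain d e where "d \<in> A" "e \<in> A" "\<forall>s\<in>S. app d (p s) = Some (q s)" "\<forall>s\<in>S. app e (q s) = Some (r s)"
    using assms(2,3) unfolding tracked_def by blast
  then show ?thesis
    by (intro tracked_polynomial[of "App (Const e) (App (Const d) (Var 0))"] p) (simp_all add: papp_def)
qed

lemma tracked_reindex: "tracked S p q \<Longrightarrow> (\<And>s. s \<in> S' \<Longrightarrow> f s \<in> S) \<Longrightarrow> tracked S' (\<lambda>s. p (f s)) (\<lambda>s. q (f s))"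
  unfolding tracked_def by blast

lemma tracked_cong:
  "tracked S p q \<Longrightarrow> (\<And>s. s \<in> S \<Longrightarrow> p s = p' s) \<Longrightarrow> (\<And>s. s \<in> S \<Longrightarrow> q s = q' s) \<Longrightarrow> tracked S p' q'"
  unfolding tracked_def by simp

lemma A_nonempty: obtains a where "a \<in> A"
  using realizer1[of "Var 0"] by (metis polynomial_over.simps(1) less_one)

text \<open>The Church pairing, which takes \<open>a\<close>, \<open>b\<close> and \<open>x\<close>
  to \<open>x a b\<close>, so that a pair applied to a selector returns a component. It is fixed
  once and for all because codes of pairs must be computed uniformly.\<close>

definition pairing :: 'u where
  "pairing = (SOME e. e \<in> A \<and> (\<forall>a\<in>A. \<forall>b\<in>A. \<exists>c\<in>A. \<exists>d\<in>A. app e a = Some c \<and> app c b = Some d \<and>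
    (\<forall>x\<in>A. \<forall>v. papp app (app x a) (Some b) = Some v \<longrightarrow> app d x = Some v)))"

lemma pairing: "pairing \<in> A" "a \<in> A \<Longrightarrow> b \<in> A \<Longrightarrow> \<exists>c\<in>A. \<exists>d\<in>A. app pairing a = Some c \<and> app c b = Some d \<and>
    (\<forall>x\<in>A. \<forall>v. papp app (app x a) (Some b) = Some v \<longrightarrow> app d x = Some v)"
proof -
  have "polynomial_over A 3 (App (App (Var 2) (Var 0)) (Var 1))" by simp
  from realizer3[OF this] obtain e where e: "e \<in> A" "\<forall>a\<in>A. \<forall>b\<in>A. \<exists>c\<in>A. \<exists>d\<in>A. app e a = Some c \<and> app c b = Some d \<and>
    (\<forall>x\<in>A. \<forall>v. eval_polynomial app [a, b, x] (App (App (Var 2) (Var 0)) (Var 1)) = Some v \<longrightarrow> app d x = Some v)" .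
  have "papp app (Some x) (Some a) = app x a" for x a by (simp add: papp_def)
  then have "\<exists>e. e \<in> A \<and> (\<forall>a\<in>A. \<forall>b\<in>A. \<exists>c\<in>A. \<exists>d\<in>A. app e a = Some c \<and> app c b = Some d \<and>
    (\<forall>x\<in>A. \<forall>v. papp app (app x a) (Some b) = Some v \<longrightarrow> app d x = Some v))"
    using e by (intro exI[of _ e]) simp
  from someI_ex[OF this]
  show "pairing \<in> A" "a \<in> A \<Longrightarrow> b \<in> A \<Longrightarrow> \<exists>c\<in>A. \<exists>d\<in>A. app pairing a = Some c \<and> app c b = Some d \<and>
    (\<forall>x\<in>A. \<forall>v. papp app (app x a) (Some b) = Some v \<longrightarrow> app d x = Some v)"
    unfolding pairing_def by blast+
qed

definition pr :: "'u \<Rightarrow> 'u \<Rightarrow> 'u" where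
  "pr a b = the (papp app (app pairing a) (Some b))"

lemma pr:
  assumes "a \<in> A" "b \<in> A"
  shows "papp app (app pairing a) (Some b) = Some (pr a b)" "pr a b \<in> A"
    "x \<in> A \<Longrightarrow> app x a = Some y \<Longrightarrow> app y b = Some v \<Longrightarrow> app (pr a b) x = Some v"
proof -
  obtain c d where c: "c \<in> A" "d \<in> A" "app pairing a = Some c" "app c b = Some d"
    "\<forall>x\<in>A. \<forall>v. papp app (app x a) (Some b) = Some v \<longrightarrow> app d x = Some v"
    using pairing(2)[OF assms] by blast
  have d: "pr a b = d" unfolding pr_def by (simp add: c papp_def)
  show "papp app (app pairing a) (Some b) = Some (pr a b)" "pr a b \<in> A"
    unfolding d by (simp_all add: c papp_def)
  assume "x \<in> A" "app x a = Some y" "app y b = Some v"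
  then show "app (pr a b) x = Some v" unfolding d using c(5) by (simp add: papp_def)
qed

lemma eval_pr:
  assumes "eval_polynomial app as s = Some a" "eval_polynomial app as t = Some b" "a \<in> A" "b \<in> A"
  shows "eval_polynomial app as (App (App (Const pairing) s) t) = Some (pr a b)"
  using pr(1)[OF assms(3,4)] assms(1,2) by (simp add: papp_def)

lemma tracked_pr:
  assumes p: "\<And>s. s \<in> S \<Longrightarrow> p s \<in> A" and q: "tracked S p q" and r: "tracked S p r"
  shows "tracked S p (\<lambda>s. pr (q s) (r s))"
proof -
  obtain d e where d: "d \<in> A" "\<forall>s\<in>S. app d (p s) = Some (q s)" and e: "e \<in> A" "\<forall>s\<in>S. app e (p s) = Some (r s)"
    using q r unfolding tracked_def by blast
  show ?thesis
    by (rule tracked_polynomial[of "App (App (Const pairing) (App (Const d) (Var 0))) (App (Const e) (Var 0))"],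
        use d e pairing(1) in simp, rule p, assumption, rule eval_pr)
      (use d e p tracked_mem[OF q] tracked_mem[OF r] in \<open>simp_all add: papp_def\<close>)
qed

text \<open>Apply the pair to an element \<open>k\<close> that returns the first of its two
  arguments.\<close>

lemma tracked_fst:
  assumes q: "\<And>s. s \<in> S \<Longrightarrow> q s \<in> A" and r: "\<And>s. s \<in> S \<Longrightarrow> r s \<in> A"
  shows "tracked S (\<lambda>s. pr (q s) (r s)) q"
proof -
  have "polynomial_over A 2 (Var 0)" by simp
  from realizer2[OF this] obtain k where k: "k \<in> A" "\<forall>a\<in>A. \<exists>c\<in>A. app k a = Some c \<and>
    (\<forall>b\<in>A. \<forall>v. eval_polynomial app [a, b] (Var 0) = Some v \<longrightarrow> app c b = Some v)" .
  have "app (pr a b) k = Some a" if "a \<in> A" "b \<in> A" for a b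
    using k(2)[rule_format, OF that(1)] pr(3)[OF that k(1)] that by auto
  then show ?thesis
    using k q r by (intro tracked_polynomial[of "App (Var 0) (Const k)"] pr(2)) (simp_all add: papp_def)
qed

lemma tracked_snd:
  assumes q: "\<And>s. s \<in> S \<Longrightarrow> q s \<in> A" and r: "\<And>s. s \<in> S \<Longrightarrow> r s \<in> A"
  shows "tracked S (\<lambda>s. pr (q s) (r s)) r"
proof -
  have "polynomial_over A 2 (Var 1)" by simp
  from realizer2[OF this] obtain k where k: "k \<in> A" "\<forall>a\<in>A. \<exists>c\<in>A. app k a = Some c \<and>
    (\<forall>b\<in>A. \<forall>v. eval_polynomial app [a, b] (Var 1) = Some v \<longrightarrow> app c b = Some v)" .
  have "app (pr a b) k = Some b" if "a \<in> A" "b \<in> A" for a b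
    using k(2)[rule_format, OF that(1)] pr(3)[OF that k(1)] that by auto
  then show ?thesis
    using k q r by (intro tracked_polynomial[of "App (Var 0) (Const k)"] pr(2)) (simp_all add: papp_def)
qed

lemma tracked_app:
  assumes q: "\<And>s. s \<in> S \<Longrightarrow> q s \<in> A" and r: "\<And>s. s \<in> S \<Longrightarrow> r s \<in> A"
    and v: "\<And>s. s \<in> S \<Longrightarrow> app (q s) (r s) = Some (v s)"
  shows "tracked S (\<lambda>s. pr (q s) (r s)) v"
proof -
  obtain d e where "d \<in> A" "\<forall>s\<in>S. app d (pr (q s) (r s)) = Some (q s)" "e \<in> A" "\<forall>s\<in>S. app e (pr (q s) (r s)) = Some (r s)"
    using tracked_fst[of S q r] tracked_snd[of S q r] q r unfolding tracked_def by blast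
  then show ?thesis
    using q r v by (intro tracked_polynomial[of "App (App (Const d) (Var 0)) (App (Const e) (Var 0))"] pr(2))
      (simp_all add: papp_def)
qed

text \<open>Abstract over both arguments of \<open>d\<close> applied to their pair. The axiom for
  two variables makes \<open>e a\<close> defined for every \<open>a\<close> in \<open>A\<close>,
  whether or not \<open>a\<close> occurs among the \<open>p z\<close>.\<close>

lemma tracked_curry:
  assumes p: "\<And>z. z \<in> Z \<Longrightarrow> p z \<in> A" and b: "\<And>z. z \<in> Z \<Longrightarrow> b z \<in> A"
    and v: "tracked Z (\<lambda>z. pr (p z) (b z)) v"
  obtains e c where "e \<in> A" "\<forall>a\<in>A. c a \<in> A \<and> app e a = Some (c a)" "\<forall>z\<in>Z. app (c (p z)) (b z) = Some (v z)"
proof -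
  obtain d where d: "d \<in> A" "\<forall>z\<in>Z. app d (pr (p z) (b z)) = Some (v z)" using v unfolding tracked_def by blast
  let ?t = "App (Const d) (App (App (Const pairing) (Var 0)) (Var 1))"
  have "polynomial_over A 2 ?t" using d pairing by simp
  from realizer2[OF this] obtain e where e: "e \<in> A" "\<forall>a\<in>A. \<exists>c\<in>A. app e a = Some c \<and>
    (\<forall>b\<in>A. \<forall>v. eval_polynomial app [a, b] ?t = Some v \<longrightarrow> app c b = Some v)" .
  define c where "c a = the (app e a)" for a
  have c: "c a \<in> A \<and> app e a = Some (c a)" "\<And>b v. b \<in> A \<Longrightarrow> eval_polynomial app [a, b] ?t = Some v \<Longrightarrow> app (c a) b = Some v"
    if "a \<in> A" for a
    using e(2) that unfolding c_def by fastforce+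
  have "app (c (p z)) (b z) = Some (v z)" if "z \<in> Z" for z
  proof (rule c(2)[OF p[OF that] b[OF that]])
    have "eval_polynomial app [p z, b z] (App (App (Const pairing) (Var 0)) (Var 1)) = Some (pr (p z) (b z))"
      by (rule eval_pr) (use p b that in auto)
    then show "eval_polynomial app [p z, b z] ?t = Some (v z)" using d that by (simp add: papp_def)
  qed
  then show thesis using that[of e c] e(1) c(1) by blast
qed

lemma category_PAsm: "category (PAsm U A app)"
proof
  have Hom: "f \<in> Hom (PAsm U A app) (I, \<phi>) (J, \<psi>) \<longleftrightarrow> f \<in> I \<rightarrow>\<^sub>E J \<and> tracked I \<phi> (\<lambda>i. \<psi> (f i))" for f I \<phi> J \<psi>
    unfolding PAsm_def tracked_def by simp
  have Obj: "(I, \<phi>) \<in> Obj (PAsm U A app) \<longleftrightarrow> I \<in> U \<and> \<phi> \<in> I \<rightarrow>\<^sub>E A" for I \<phi>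
    unfolding PAsm_def by simp
  have Comp: "Comp (PAsm U A app) (I, \<phi>) Y Z g f = compose I g f" for I \<phi> Y Z g f
    unfolding PAsm_def by (simp add: split_def)
  have Ide: "Ide (PAsm U A app) (I, \<phi>) = (\<lambda>i\<in>I. i)" for I \<phi>
    unfolding PAsm_def by simp
  fix X assume "X \<in> Obj (PAsm U A app)"
  moreover obtain I \<phi> where X: "X = (I, \<phi>)" by fastforce
  ultimately have I: "\<phi> \<in> I \<rightarrow>\<^sub>E A" by (simp add: Obj)
  have "tracked I \<phi> \<phi>" by (rule tracked_refl) (use I in auto)
  then show "Ide (PAsm U A app) X \<in> Hom (PAsm U A app) X X"
    unfolding X Ide Hom by (auto elim!: tracked_cong)
  fix Y assume "Y \<in> Obj (PAsm U A app)"
  moreover obtain J \<psi> where Y: "Y = (J, \<psi>)" by fastforce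
  ultimately have J: "\<psi> \<in> J \<rightarrow>\<^sub>E A" by (simp add: Obj)
  fix f assume "f \<in> Hom (PAsm U A app) X Y"
  then have f: "f \<in> I \<rightarrow>\<^sub>E J" "tracked I \<phi> (\<lambda>i. \<psi> (f i))" unfolding X Y Hom by auto
  show "Comp (PAsm U A app) X Y Y (Ide (PAsm U A app) Y) f = f"
    "Comp (PAsm U A app) X X Y f (Ide (PAsm U A app) X) = f"
    using f(1) unfolding X Y Comp Ide by (auto simp: compose_def fun_eq_iff)
  fix Z g assume "Z \<in> Obj (PAsm U A app)" and "g \<in> Hom (PAsm U A app) Y Z"
  moreover obtain K \<chi> where Z: "Z = (K, \<chi>)" by fastforce
  ultimately have g: "g \<in> J \<rightarrow>\<^sub>E K" "tracked J \<psi> (\<lambda>i. \<chi> (g i))" unfolding Y Z Hom by auto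
  have "tracked I \<phi> (\<lambda>i. \<chi> (g (f i)))"
    by (rule tracked_trans[OF _ f(2) tracked_reindex[OF g(2)]]) (use f I in auto)
  then have "tracked I \<phi> (\<lambda>i. \<chi> (compose I g f i))" by (rule tracked_cong) (auto simp: compose_def)
  then show "Comp (PAsm U A app) X Y Z g f \<in> Hom (PAsm U A app) X Z"
    unfolding X Y Z Comp Hom using f(1) g(1) by (auto simp: compose_def)
  fix W h assume "h \<in> Hom (PAsm U A app) Z W"
  show "Comp (PAsm U A app) X Z W h (Comp (PAsm U A app) X Y Z g f)
    = Comp (PAsm U A app) X Y W (Comp (PAsm U A app) Y Z W h g) f"
    unfolding X Y Comp using f(1) by (auto simp: compose_def fun_eq_iff)
qed

end

section \<open>From the categorical structure to partitioned assemblies\<close>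

locale sdg_application = sdg_pair U C T N \<eta> \<epsilon> G GG \<pi>\<^sub>1 \<pi>\<^sub>2 \<kappa>
  for U :: "'u set set" and C :: "('o, 'u) cat" and T N \<eta> \<epsilon> G GG \<pi>\<^sub>1 \<pi>\<^sub>2 \<kappa> +
  fixes app :: "'u \<Rightarrow> 'u \<Rightarrow> 'u option"
  assumes app_mem: "\<And>a b v. app a b = Some v \<Longrightarrow> a \<in> A \<and> b \<in> A \<and> v \<in> A"
    and trk_app_graph: "trk {(a, b). app a b \<noteq> None} (\<lambda>(a, b). pr a b) (\<lambda>(a, b). the (app a b))"
    and curry_graph: "\<And>D v. D \<subseteq> A \<times> A \<Longrightarrow> trk D (\<lambda>(a, b). pr a b) v \<Longrightarrow>
      \<exists>c\<in>Hom C G G. \<forall>(a, b)\<in>D. app (Comp C T G G c a) b = Some (v (a, b))"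
begin

section \<open>Tracking as application, and the combinatory axiom\<close>

lemma trk_app:
  assumes v: "\<And>s. s \<in> S \<Longrightarrow> app (q s) (r s) = Some (v s)"
  shows "trk S (\<lambda>s. pr (q s) (r s)) v"
proof -
  have "trk S (\<lambda>s. case (q s, r s) of (a, b) \<Rightarrow> pr a b) (\<lambda>s. case (q s, r s) of (a, b) \<Rightarrow> the (app a b))"
    by (rule trk_reindex[OF trk_app_graph]) (use v in simp)
  then show ?thesis by (rule trk_cong) (use v in simp_all)
qed

text \<open>Transfers \<open>curry_graph\<close> from sets of pairs to indexed families. One pair
  may arise from several indices; by \<open>trk_fun\<close> they give the same value, so any choice
  \<open>g\<close> of an index will do.\<close>

lemma curry:
  assumes p: "\<And>z. z \<in> Z \<Longrightarrow> p z \<in> A" and b: "\<And>z. z \<in> Z \<Longrightarrow> b z \<in> A"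
    and v: "trk Z (\<lambda>z. pr (p z) (b z)) v"
  obtains c where "c \<in> Hom C G G" "\<forall>z\<in>Z. app (Comp C T G G c (p z)) (b z) = Some (v z)"
proof -
  define f where "f z = (p z, b z)" for z
  define g where "g = inv_into Z f"
  have g: "g s \<in> Z" "f (g s) = s" if "s \<in> f ` Z" for s
    using that unfolding g_def by (auto simp: inv_into_into f_inv_into_f)
  have fc: "pr (p z) (b z) = (case f z of (a, b) \<Rightarrow> pr a b)" for z unfolding f_def by simp
  have "trk (f ` Z) (\<lambda>s. pr (p (g s)) (b (g s))) (\<lambda>s. v (g s))"
    by (rule trk_reindex[OF v g(1)])
  then have "trk (f ` Z) (\<lambda>(a, b). pr a b) (\<lambda>s. v (g s))"
    by (rule trk_cong) (simp_all add: fc g(2))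
  moreover have "f ` Z \<subseteq> A \<times> A" unfolding f_def using p b by auto
  ultimately obtain c where c: "c \<in> Hom C G G" "\<forall>(a, b)\<in>f ` Z. app (Comp C T G G c a) b = Some (v (g (a, b)))"
    using curry_graph by meson
  have "app (Comp C T G G c (p z)) (b z) = Some (v z)" if z: "z \<in> Z" for z
  proof -
    have fz: "f z \<in> f ` Z" using z by simp
    have "v (g (f z)) = v z"
      by (rule trk_fun[OF v g(1)[OF fz] z]) (simp add: fc g(2)[OF fz])
    then show ?thesis using bspec[OF c(2) fz] unfolding f_def by simp
  qed
  then show thesis using that[OF c(1)] by blast
qed

text \<open>From left to right the function is curried with a constant dummy argument
  \<open>a\<close>, and the value of the curried arrow at \<open>a\<close> is the realizer. From
  right to left the realizer is paired with the argument and application, itself tracked, is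
  performed.\<close>

lemma trk_iff_realizer:
  assumes p: "\<And>s. s \<in> S \<Longrightarrow> p s \<in> A"
  shows "trk S p q \<longleftrightarrow> (\<exists>e\<in>A. \<forall>s\<in>S. app e (p s) = Some (q s))"
proof
  obtain a where a: "a \<in> A" by (rule A_nonempty)
  assume "trk S p q"
  with trk_snd[of S "\<lambda>_. a" p] a p have "trk S (\<lambda>s. pr a (p s)) q" by (blast intro: trk_trans)
  from curry[OF a p this] obtain c where c: "c \<in> Hom C G G" "\<forall>s\<in>S. app (Comp C T G G c a) (p s) = Some (q s)" .
  then show "\<exists>e\<in>A. \<forall>s\<in>S. app e (p s) = Some (q s)" using ap_pts[OF G_obj G_obj c(1) a] by blast
next
  assume "\<exists>e\<in>A. \<forall>s\<in>S. app e (p s) = Some (q s)"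
  then obtain e where e: "e \<in> A" "\<forall>s\<in>S. app e (p s) = Some (q s)" by blast
  have "trk S p (\<lambda>s. pr e (p s))" by (rule trk_pr[OF trk_const[OF e(1) p] trk_refl[OF p]])
  moreover have "trk S (\<lambda>s. pr e (p s)) q" by (rule trk_app) (use e in blast)
  ultimately show "trk S p q" by (rule trk_trans)
qed

text \<open>Nested to the left, so that appending an argument is one pairing and the last argument
  is the one that \<open>curry\<close> splits off. The start value is an arbitrary element.\<close>

definition env :: "'u list \<Rightarrow> 'u" where
  "env as = foldl pr (SOME a. a \<in> A) as"

abbreviation tuples :: "nat \<Rightarrow> 'u list set" where
  "tuples n \<equiv> {as. length as = n \<and> set as \<subseteq> A}"

lemma env_snoc [simp]: "env (as @ [a]) = pr (env as) a"
  by (simp add: env_def)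

lemma env_mem: "set as \<subseteq> A \<Longrightarrow> env as \<in> A"
proof (induction as rule: rev_induct)
  case Nil
  obtain a where "a \<in> A" by (rule A_nonempty)
  then show ?case unfolding env_def by (simp add: someI[of "\<lambda>a. a \<in> A"])
next
  case (snoc a as)
  then show ?case by (simp add: pr_mem)
qed

lemma tuples_Suc: "as \<in> tuples (Suc n) \<Longrightarrow> butlast as \<in> tuples n \<and> last as \<in> A \<and> as = butlast as @ [last as]"
  by (cases as rule: rev_cases) auto

lemma trk_nth: "i < n \<Longrightarrow> trk (tuples n) env (\<lambda>as. as ! i)"
proof (induction n)
  case (Suc n)
  have mem: "env (butlast as) \<in> A \<and> last as \<in> A" if "as \<in> tuples (Suc n)" for as
    using tuples_Suc[OF that] env_mem by blast
  have env: "pr (env (butlast as)) (last as) = env as" if "as \<in> tuples (Suc n)" for as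
    using tuples_Suc[OF that] env_snoc by metis
  have last: "last as = as ! n" if "as \<in> tuples (Suc n)" for as
    using that by (cases as rule: rev_cases) auto
  show ?case
  proof (cases "i = n")
    case True
    have "trk (tuples (Suc n)) (\<lambda>as. pr (env (butlast as)) (last as)) last" by (rule trk_snd[OF mem])
    then show ?thesis by (rule trk_cong) (use env True last in \<open>simp_all\<close>)
  next
    case False
    then have "i < n" using Suc by simp
    have "trk (tuples (Suc n)) (\<lambda>as. pr (env (butlast as)) (last as)) (\<lambda>as. env (butlast as))"
      by (rule trk_fst[OF mem])
    then have "trk (tuples (Suc n)) env (\<lambda>as. env (butlast as))"
      by (rule trk_cong) (use env in auto)
    moreover have "trk (tuples (Suc n)) (\<lambda>as. env (butlast as)) (\<lambda>as. butlast as ! i)"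
      by (rule trk_reindex[OF Suc.IH[OF \<open>i < n\<close>]]) (use tuples_Suc in blast)
    ultimately have "trk (tuples (Suc n)) env (\<lambda>as. butlast as ! i)" by (rule trk_trans)
    then show ?thesis by (rule trk_cong) (use \<open>i < n\<close> in \<open>auto simp: nth_butlast\<close>)
  qed
qed simp

text \<open>The domain consists of the tuples at which the term is defined. There both parts of an
  application are defined too, so the induction hypotheses restrict to it and combine by
  \<open>trk_pr\<close> and \<open>trk_app\<close>.\<close>

lemma trk_polynomial:
  "polynomial_over A n t \<Longrightarrow>
    trk {as \<in> tuples n. eval_polynomial app as t \<noteq> None} env (\<lambda>as. the (eval_polynomial app as t))"
proof (induction t)
  case (Var i)
  then show ?case using trk_nth[of i n] by (simp add: trk_reindex[where f = "\<lambda>as. as"])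
next
  case (Const a)
  then show ?case using trk_const[of a "tuples n" env] env_mem by (auto simp: trk_reindex[where f = "\<lambda>as. as"])
next
  case (App s t)
  let ?S = "{as \<in> tuples n. eval_polynomial app as (App s t) \<noteq> None}"
  let ?s = "\<lambda>as. the (eval_polynomial app as s)" and ?t = "\<lambda>as. the (eval_polynomial app as t)"
  have defined: "eval_polynomial app as s \<noteq> None \<and> eval_polynomial app as t \<noteq> None \<and>
      app (?s as) (?t as) = Some (the (eval_polynomial app as (App s t)))" if "as \<in> ?S" for as
    using that by (cases "eval_polynomial app as s"; cases "eval_polynomial app as t") (auto simp: papp_def)
  have "trk ?S env ?s"
    by (rule trk_reindex[where f = "\<lambda>as. as", OF App.IH(1)]) (use App.prems defined in auto)
  moreover have "trk ?S env ?t"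
    by (rule trk_reindex[where f = "\<lambda>as. as", OF App.IH(2)]) (use App.prems defined in auto)
  ultimately have "trk ?S env (\<lambda>as. pr (?s as) (?t as))" by (rule trk_pr)
  moreover have "trk ?S (\<lambda>as. pr (?s as) (?t as)) (\<lambda>as. the (eval_polynomial app as (App s t)))"
    by (rule trk_app) (use defined in blast)
  ultimately show ?case by (rule trk_trans)
qed

lemma app_list_snoc: "app_list app e (as @ [a]) = papp app (app_list app e as) (Some a)"
  by (simp add: app_list_def)

text \<open>The last argument is curried away by an arrow \<open>c\<close> from \<open>G\<close> to
  \<open>G\<close>; \<open>c\<close> applied to the environment of the remaining arguments is again
  tracked, with one argument fewer.\<close>

lemma ex_curried_code:
  "trk (tuples n) env g \<Longrightarrow> \<exists>e\<in>A. \<forall>as\<in>tuples n. app_list app e as = Some (g as)"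
proof (induction n arbitrary: g)
  case 0
  then show ?case using trk_mem(2)[OF 0, of "[]"] by (auto simp: app_list_def)
next
  case (Suc n)
  have mem: "env (butlast as) \<in> A" "last as \<in> A" if "as \<in> tuples (Suc n)" for as
    using tuples_Suc[OF that] env_mem by blast+
  have "trk (tuples (Suc n)) (\<lambda>as. pr (env (butlast as)) (last as)) g"
    by (rule trk_cong[OF Suc.prems]) (use tuples_Suc env_snoc in \<open>metis, simp\<close>)
  from curry[OF mem this] obtain c where c: "c \<in> Hom C G G"
    "\<forall>as\<in>tuples (Suc n). app (Comp C T G G c (env (butlast as))) (last as) = Some (g as)" .
  have "trk (tuples n) env (\<lambda>as. Comp C T G G c (env as))" by (rule trk_arrow[OF c(1)]) (use env_mem in blast)
  from Suc.IH[OF this] obtain e where e: "e \<in> A" "\<forall>as\<in>tuples n. app_list app e as = Some (Comp C T G G c (env as))"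
    by blast
  have "app_list app e as = Some (g as)" if as: "as \<in> tuples (Suc n)" for as
  proof -
    have "app_list app e (butlast as @ [last as]) = Some (g as)"
      unfolding app_list_snoc using e(2) c(2) tuples_Suc[OF as] as by (simp add: papp_def)
    then show ?thesis using tuples_Suc[OF as] by simp
  qed
  then show ?case using e(1) by blast
qed

lemma pca_app: "pca A app"
  unfolding pca_def
proof (intro conjI allI impI)
  show "partial_applicative_structure A app"
    unfolding partial_applicative_structure_def using app_mem by blast
  fix n t assume t: "polynomial_over A (Suc n) t"
  let ?Z = "{as \<in> tuples (Suc n). eval_polynomial app as t \<noteq> None}"
  have mem: "env (butlast as) \<in> A" "last as \<in> A" if "as \<in> ?Z" for as
    using that tuples_Suc[of as n] env_mem by blast+
  have "trk ?Z (\<lambda>as. pr (env (butlast as)) (last as)) (\<lambda>as. the (eval_polynomial app as t))"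
    by (rule trk_cong[OF trk_polynomial[OF t]]) (use tuples_Suc[of _ n] env_snoc in \<open>(metis (mono_tags, lifting) mem_Collect_eq), simp\<close>)
  \<comment> \<open>Only the last argument meets partiality. The arrow \<open>c\<close> is total on
    the points of \<open>G\<close>, so after \<open>n\<close> arguments a code exists for every
    tuple, which is the definedness that the axiom requires.\<close>
  from curry[OF mem this] obtain c where c: "c \<in> Hom C G G"
    "\<forall>as\<in>?Z. app (Comp C T G G c (env (butlast as))) (last as) = Some (the (eval_polynomial app as t))" .
  have "trk (tuples n) env (\<lambda>as. Comp C T G G c (env as))" by (rule trk_arrow[OF c(1)]) (use env_mem in blast)
  from ex_curried_code[OF this] obtain e where e: "e \<in> A"
    "\<forall>as\<in>tuples n. app_list app e as = Some (Comp C T G G c (env as))" by blast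
  show "\<exists>e\<in>A. \<forall>as. length as = n \<and> set as \<subseteq> A \<longrightarrow> app_list app e as \<noteq> None \<and>
      (\<forall>a\<in>A. eval_polynomial app (as @ [a]) t \<preceq> app_list app e (as @ [a]))"
  proof (rule bexI[OF _ e(1)], intro allI impI conjI ballI)
    fix as assume as: "length as = n \<and> set as \<subseteq> A"
    then have ea: "app_list app e as = Some (Comp C T G G c (env as))" using e(2) by blast
    then show "app_list app e as \<noteq> None" by simp
    fix a assume a: "a \<in> A"
    have "app_list app e (as @ [a]) = Some v" if v: "eval_polynomial app (as @ [a]) t = Some v" for v
    proof -
      have "as @ [a] \<in> ?Z" using as a v by simp
      from bspec[OF c(2) this] show ?thesis unfolding app_list_snoc ea using v by (simp add: papp_def)
    qed
    then show "eval_polynomial app (as @ [a]) t \<preceq> app_list app e (as @ [a])" unfolding refines_def by blast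
  qed
qed

section \<open>The functor to partitioned assemblies\<close>

definition code :: "'o \<Rightarrow> 'u" where
  "code X = (SOME c. cartesian X G c)"

lemma code: "X \<in> Obj C \<Longrightarrow> cartesian X G (code X)"
  using someI_ex[OF ex_code] unfolding code_def .

definition to_PAsm :: "('o, 'u, 'u set \<times> ('u \<Rightarrow> 'u), 'u \<Rightarrow> 'u) fun_data" where
  "to_PAsm = \<lparr>FObj = (\<lambda>X. (pts X, \<lambda>x\<in>pts X. Comp C T X G (code X) x)),
    FMap = (\<lambda>X Y f. \<lambda>x\<in>pts X. Comp C T X Y f x)\<rparr>"

lemma code_mem: "X \<in> Obj C \<Longrightarrow> x \<in> pts X \<Longrightarrow> Comp C T X G (code X) x \<in> A"
  using ap_pts[OF cartesianD] code by blast

lemma trk_code_iff: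
  assumes "X \<in> Obj C"
  shows "trk (pts X) (\<lambda>x. Comp C T X G (code X) x) q \<longleftrightarrow>
    (\<exists>e\<in>A. \<forall>x\<in>pts X. app e (Comp C T X G (code X) x) = Some (q x))"
  by (rule trk_iff_realizer) (rule code_mem[OF assms])

lemma PAsm_hom_iff:
  assumes X: "X \<in> Obj C" and Y: "Y \<in> Obj C"
  shows "k \<in> Hom (PAsm U A app) (FObj to_PAsm X) (FObj to_PAsm Y) \<longleftrightarrow> k \<in> pts X \<rightarrow>\<^sub>E pts Y \<and>
    trk (pts X) (\<lambda>x. Comp C T X G (code X) x) (\<lambda>x. Comp C T Y G (code Y) (k x))"
proof -
  let ?r = "\<lambda>e. \<forall>i\<in>pts X. app e (restrict (\<lambda>x. Comp C T X G (code X) x) (pts X) i)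
    = Some (restrict (\<lambda>x. Comp C T Y G (code Y) x) (pts Y) (k i))"
  have "k \<in> Hom (PAsm U A app) (FObj to_PAsm X) (FObj to_PAsm Y) \<longleftrightarrow> k \<in> pts X \<rightarrow>\<^sub>E pts Y \<and> (\<exists>e\<in>A. ?r e)"
    unfolding PAsm_def to_PAsm_def by simp
  moreover have "?r e \<longleftrightarrow> (\<forall>x\<in>pts X. app e (Comp C T X G (code X) x) = Some (Comp C T Y G (code Y) (k x)))"
    if "k \<in> pts X \<rightarrow>\<^sub>E pts Y" for e
    by (rule ball_cong[OF refl]) (use PiE_mem[OF that] in simp)
  ultimately show ?thesis
    unfolding trk_code_iff[OF X] by blast
qed

lemma functor_to_PAsm: "is_functor C (PAsm U A app) to_PAsm"
  unfolding is_functor_def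
proof (intro conjI ballI)
  show "FObj to_PAsm X \<in> Obj (PAsm U A app)" if "X \<in> Obj C" for X
    using code_mem[OF that] pts_U[OF that] by (simp add: to_PAsm_def PAsm_def)
  show "FMap to_PAsm X Y f \<in> Hom (PAsm U A app) (FObj to_PAsm X) (FObj to_PAsm Y)"
    if X: "X \<in> Obj C" "Y \<in> Obj C" and f: "f \<in> Hom C X Y" for X Y f
  proof -
    note c = code[OF X(1)] and d = cartesianD(3)[OF code[OF X(2)]]
    have "trk (pts X) (\<lambda>x. Comp C T X G (code X) x) (\<lambda>x. Comp C T Y G (code Y) (restrict (Comp C T X Y f) (pts X) x))"
      by (rule trkI[OF c Comp_Hom[OF X G_obj f d]]) (auto simp: ap_comp[OF X G_obj f d])
    then show ?thesis unfolding PAsm_hom_iff[OF X] using ap_pts[OF X f] by (simp add: to_PAsm_def)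
  qed
  show "FMap to_PAsm X X (Ide C X) = Ide (PAsm U A app) (FObj to_PAsm X)" if "X \<in> Obj C" for X
    using Comp_Ide_left[OF T_obj that] by (auto simp: to_PAsm_def PAsm_def)
  show "FMap to_PAsm X Z (Comp C X Y Z g f)
      = Comp (PAsm U A app) (FObj to_PAsm X) (FObj to_PAsm Y) (FObj to_PAsm Z) (FMap to_PAsm Y Z g) (FMap to_PAsm X Y f)"
    if X: "X \<in> Obj C" "Y \<in> Obj C" "Z \<in> Obj C" "f \<in> Hom C X Y" "g \<in> Hom C Y Z" for X Y Z f g
    using ap_comp[OF X] ap_pts[OF X(1,2,4)] by (auto simp: to_PAsm_def PAsm_def compose_def)
qed

text \<open>Faithfulness is that of global sections. For fullness, a tracked \<open>k\<close> yields
  an arrow \<open>h\<close> from \<open>X\<close> to \<open>G\<close> whose values are the codes of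
  the \<open>k x\<close>, and closedness of \<open>code Y\<close> lifts \<open>h\<close> to an arrow
  into \<open>Y\<close>.\<close>

lemma ff_to_PAsm: "fully_faithful C (PAsm U A app) to_PAsm"
  unfolding fully_faithful_def bij_betw_def
proof (intro ballI conjI)
  fix X Y assume X: "X \<in> Obj C" "Y \<in> Obj C"
  show "inj_on (FMap to_PAsm X Y) (Hom C X Y)"
  proof (rule inj_onI)
    fix f g assume f: "f \<in> Hom C X Y" "g \<in> Hom C X Y" and eq: "FMap to_PAsm X Y f = FMap to_PAsm X Y g"
    have "Comp C T X Y f x = Comp C T X Y g x" if "x \<in> pts X" for x
      using fun_cong[OF eq, of x] that by (simp add: to_PAsm_def)
    then show "f = g" by (rule faithful[OF X f])
  qed
  have "k \<in> FMap to_PAsm X Y ` Hom C X Y"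
    if "k \<in> Hom (PAsm U A app) (FObj to_PAsm X) (FObj to_PAsm Y)" for k
  proof -
    have k: "k \<in> pts X \<rightarrow>\<^sub>E pts Y"
      and trk: "trk (pts X) (\<lambda>x. Comp C T X G (code X) x) (\<lambda>x. Comp C T Y G (code Y) (k x))"
      using that unfolding PAsm_hom_iff[OF X] by auto
    have "\<exists>s\<in>pts X. Comp C T X G (code X) x = Comp C T X G (code X) s" if "x \<in> pts X" for x using that by blast
    from trk_extend[OF trk X(1) cartesianD(3)[OF code[OF X(1)]] this]
    obtain h where h: "h \<in> Hom C X G" and hk: "\<And>x s. x \<in> pts X \<Longrightarrow> s \<in> pts X \<Longrightarrow>
        Comp C T X G (code X) x = Comp C T X G (code X) s \<Longrightarrow> Comp C T X G h x = Comp C T Y G (code Y) (k s)"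
      by blast
    have "k \<in> pts X \<rightarrow> pts Y" using k unfolding PiE_def by blast
    from cartesian_lift[OF code[OF X(2)] X(1) h this hk[OF _ _ refl, symmetric]]
    obtain m where m: "m \<in> Hom C X Y" "\<And>x. x \<in> pts X \<Longrightarrow> Comp C T X Y m x = k x" by blast
    have "FMap to_PAsm X Y m x = k x" for x
      by (cases "x \<in> pts X") (simp_all add: to_PAsm_def m(2) PiE_arb[OF k])
    then have "FMap to_PAsm X Y m = k" by (rule ext)
    then show ?thesis using m(1) by blast
  qed
  moreover have "FMap to_PAsm X Y f \<in> Hom (PAsm U A app) (FObj to_PAsm X) (FObj to_PAsm Y)" if "f \<in> Hom C X Y" for f
    using functor_map[OF functor_to_PAsm X that] .
  ultimately show "FMap to_PAsm X Y ` Hom C X Y = Hom (PAsm U A app) (FObj to_PAsm X) (FObj to_PAsm Y)" by blast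
qed

text \<open>An assembly is a family of points of \<open>G\<close>, so \<open>ex_cartesian\<close>
  supplies an object with \<open>I\<close> as points and a closed arrow \<open>c\<close> with values
  \<open>\<phi>\<close>. The chosen \<open>code X\<close> may be another closed arrow, but each of
  the two is tracked from the other, which gives realizers for both directions of the
  isomorphism.\<close>

lemma es_to_PAsm: "essentially_surjective C (PAsm U A app) to_PAsm"
  unfolding essentially_surjective_def
proof
  fix S assume "S \<in> Obj (PAsm U A app)"
  moreover obtain I \<phi> where S: "S = (I, \<phi>)" by fastforce
  ultimately have I: "I \<in> U" "\<phi> \<in> I \<rightarrow>\<^sub>E A" by (auto simp: PAsm_def)
  have "\<phi> \<in> I \<rightarrow> A" using I(2) unfolding PiE_def by blast
  from ex_cartesian[OF G_obj I(1) this] obtain X c \<theta> where c: "cartesian X G c" and \<theta>: "bij_betw \<theta> I (pts X)"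
    and c\<theta>: "\<And>i. i \<in> I \<Longrightarrow> Comp C T X G c (\<theta> i) = \<phi> i" by blast
  note X = cartesianD[OF c] and d = code[OF cartesianD(1)[OF c]]
  note d_hom = cartesianD(3)[OF d]
  let ?d = "\<lambda>x. Comp C T X G (code X) x" and ?\<theta> = "restrict \<theta> I" and ?\<psi> = "restrict (inv_into I \<theta>) (pts X)"
  have \<theta>_mem: "\<theta> i \<in> pts X" if "i \<in> I" for i using \<theta> that unfolding bij_betw_def by blast
  have \<psi>: "inv_into I \<theta> x \<in> I" "\<theta> (inv_into I \<theta> x) = x" if "x \<in> pts X" for x
    using \<theta> that unfolding bij_betw_def by (auto simp: inv_into_into f_inv_into_f)
  have \<psi>\<theta>: "inv_into I \<theta> (\<theta> i) = i" if "i \<in> I" for i using \<theta> that by (simp add: bij_betw_def)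
  have "trk (pts X) ?d (\<lambda>x. \<phi> (inv_into I \<theta> x))"
    by (rule trkI[OF d X(3)]) (use c\<theta> \<psi> in metis)
  then obtain e where e: "e \<in> A" "\<forall>x\<in>pts X. app e (?d x) = Some (\<phi> (inv_into I \<theta> x))"
    unfolding trk_code_iff[OF X(1)] by blast
  have "trk I \<phi> (\<lambda>i. ?d (\<theta> i))"
    by (rule trkI[OF c d_hom]) (use c\<theta> \<theta>_mem in blast)
  moreover have "trk I \<phi> q \<longleftrightarrow> (\<exists>e\<in>A. \<forall>i\<in>I. app e (\<phi> i) = Some (q i))" for q
    by (rule trk_iff_realizer) (use I in blast)
  ultimately obtain e' where e': "e' \<in> A" "\<forall>i\<in>I. app e' (\<phi> i) = Some (?d (\<theta> i))"
    by auto
  have "?\<psi> \<in> Hom (PAsm U A app) (FObj to_PAsm X) S"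
    unfolding S using \<psi> e by (auto simp: PAsm_def to_PAsm_def intro!: bexI[of _ e])
  moreover have "?\<theta> \<in> Hom (PAsm U A app) S (FObj to_PAsm X)"
    unfolding S using \<theta>_mem e' by (auto simp: PAsm_def to_PAsm_def intro!: bexI[of _ e'])
  moreover have "compose (pts X) ?\<theta> ?\<psi> = (\<lambda>x\<in>pts X. x)" "compose I ?\<psi> ?\<theta> = (\<lambda>i\<in>I. i)"
    using \<psi> \<psi>\<theta> \<theta>_mem by (auto simp: compose_def)
  ultimately have "is_iso (PAsm U A app) (FObj to_PAsm X) S ?\<psi>"
    unfolding is_iso_def S by (intro conjI bexI[of _ ?\<theta>]) (simp_all add: PAsm_def to_PAsm_def)
  then show "\<exists>X\<in>Obj C. \<exists>i. is_iso (PAsm U A app) (FObj to_PAsm X) S i" using X(1) by blast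
qed

lemma equivalent_PAsm: "equivalent_categories C (PAsm U A app)"
  by (rule ff_imp_equivalence[OF category_axioms pca_structure.category_PAsm[OF pca_structure.intro[OF pca_app]]
        functor_to_PAsm ff_to_PAsm es_to_PAsm])

end

lemma (in sdg_category) ex_equivalent_PAsm:
  "\<exists>A app. A \<in> U \<and> pca A app \<and> equivalent_categories C (PAsm U A app)"
proof -
  obtain GG \<pi>\<^sub>1 \<pi>\<^sub>2 where GG: "is_product GG G G \<pi>\<^sub>1 \<pi>\<^sub>2" using ex_product[OF G_obj G_obj] .
  obtain \<kappa> where \<kappa>: "cartesian GG G \<kappa>" using ex_code[OF productD(1)[OF GG]] by blast
  interpret sdg_pair U C T N \<eta> \<epsilon> G GG \<pi>\<^sub>1 \<pi>\<^sub>2 \<kappa> by unfold_locales fact+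
  obtain app :: "'u \<Rightarrow> 'u \<Rightarrow> 'u option" where "sdg_application U C T N \<eta> \<epsilon> G GG \<pi>\<^sub>1 \<pi>\<^sub>2 \<kappa> app"
    by (rule ex_application) (rule that, unfold_locales)
  then interpret sdg_application U C T N \<eta> \<epsilon> G GG \<pi>\<^sub>1 \<pi>\<^sub>2 \<kappa> app .
  show ?thesis using A_U pca_app equivalent_PAsm by blast
qed

section \<open>Categories equivalent to partitioned assemblies\<close>

locale PAsm_equivalent = set_universe U + category C + pca_structure A app
  for U :: "'u set set" and C :: "('o, 'u) cat" and A :: "'u set" and app :: "'u \<Rightarrow> 'u \<Rightarrow> 'u option" +
  fixes F :: "('o, 'u, 'u set \<times> ('u \<Rightarrow> 'u), 'u \<Rightarrow> 'u) fun_data"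
  assumes A_U: "A \<in> U" and F_functor: "is_functor C (PAsm U A app) F"
    and F_ff: "fully_faithful C (PAsm U A app) F" and F_es: "essentially_surjective C (PAsm U A app) F"
begin

section \<open>Underlying sets, codes and tracked functions\<close>

abbreviation car :: "'o \<Rightarrow> 'u set" where "car X \<equiv> fst (FObj F X)"
abbreviation ph :: "'o \<Rightarrow> 'u \<Rightarrow> 'u" where "ph X \<equiv> snd (FObj F X)"
abbreviation mp :: "'o \<Rightarrow> 'o \<Rightarrow> 'u \<Rightarrow> 'u \<Rightarrow> 'u" where "mp X Y f \<equiv> FMap F X Y f"

lemma PAsm_Hom:
  "k \<in> Hom (PAsm U A app) V W \<longleftrightarrow> k \<in> fst V \<rightarrow>\<^sub>E fst W \<and> tracked (fst V) (snd V) (\<lambda>x. snd W (k x))"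
  by (auto simp: PAsm_def tracked_def split: prod.splits)

lemma PAsm_Comp: "Comp (PAsm U A app) V W Z g f = compose (fst V) g f"
  by (auto simp: PAsm_def split: prod.splits)

lemma PAsm_Ide: "Ide (PAsm U A app) V = (\<lambda>i\<in>fst V. i)"
  by (auto simp: PAsm_def split: prod.splits)

lemma FObj_mem: "X \<in> Obj C \<Longrightarrow> FObj F X \<in> Obj (PAsm U A app)"
  using functor_obj[OF F_functor] .

lemma car_U: "X \<in> Obj C \<Longrightarrow> car X \<in> U"
  using FObj_mem[of X] by (auto simp: PAsm_def split_beta)

lemma ph_mem: "X \<in> Obj C \<Longrightarrow> x \<in> car X \<Longrightarrow> ph X x \<in> A"
  using FObj_mem[of X] by (auto simp: PAsm_def split_beta)

lemma mp_mem: "X \<in> Obj C \<Longrightarrow> Y \<in> Obj C \<Longrightarrow> f \<in> Hom C X Y \<Longrightarrow> x \<in> car X \<Longrightarrow> mp X Y f x \<in> car Y"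
  using functor_map[OF F_functor, of X Y f] unfolding PAsm_Hom by blast

lemma mp_tracked: "X \<in> Obj C \<Longrightarrow> Y \<in> Obj C \<Longrightarrow> f \<in> Hom C X Y \<Longrightarrow> tracked (car X) (ph X) (\<lambda>x. ph Y (mp X Y f x))"
  using functor_map[OF F_functor, of X Y f] unfolding PAsm_Hom by blast

lemma mp_Comp: "X \<in> Obj C \<Longrightarrow> Y \<in> Obj C \<Longrightarrow> Z \<in> Obj C \<Longrightarrow> f \<in> Hom C X Y \<Longrightarrow> g \<in> Hom C Y Z \<Longrightarrow> x \<in> car X \<Longrightarrow>
    mp X Z (Comp C X Y Z g f) x = mp Y Z g (mp X Y f x)"
  using functor_Comp[OF F_functor, of X Y Z f g] by (simp add: PAsm_Comp compose_def)

lemma mp_eq: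
  assumes X: "X \<in> Obj C" "Y \<in> Obj C" and f: "f \<in> Hom C X Y" "g \<in> Hom C X Y"
    and eq: "\<And>x. x \<in> car X \<Longrightarrow> mp X Y f x = mp X Y g x"
  shows "f = g"
proof (rule ff_inj[OF F_ff X f])
  have "mp X Y f \<in> car X \<rightarrow>\<^sub>E car Y" "mp X Y g \<in> car X \<rightarrow>\<^sub>E car Y"
    using functor_map[OF F_functor X f(1)] functor_map[OF F_functor X f(2)] unfolding PAsm_Hom by auto
  then show "mp X Y f = mp X Y g" by (rule PiE_ext) (rule eq)
qed

lemma mp_ex:
  assumes X: "X \<in> Obj C" "Y \<in> Obj C" and k: "\<And>x. x \<in> car X \<Longrightarrow> k x \<in> car Y"
    and tr: "tracked (car X) (ph X) (\<lambda>x. ph Y (k x))"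
  shows "\<exists>f\<in>Hom C X Y. \<forall>x\<in>car X. mp X Y f x = k x"
proof -
  have "tracked (car X) (ph X) (\<lambda>x. ph Y (restrict k (car X) x))" by (rule tracked_cong[OF tr]) simp_all
  then have "restrict k (car X) \<in> Hom (PAsm U A app) (FObj F X) (FObj F Y)"
    unfolding PAsm_Hom using k by simp
  from ff_surj[OF F_ff X this] obtain f where f: "f \<in> Hom C X Y" "mp X Y f = restrict k (car X)" by (elim bexE)
  then show ?thesis by (intro bexI[of _ f]) simp_all
qed

text \<open>
  \<open>F X\<close> is isomorphic, by \<open>\<theta>\<close> and \<open>\<psi>\<close>, to the partitioned assembly \<open>(S, p)\<close>, where the small set
  \<open>S\<close> may have elements of any type.
\<close>

definition represents :: "'o \<Rightarrow> 'x set \<Rightarrow> ('x \<Rightarrow> 'u) \<Rightarrow> ('x \<Rightarrow> 'u) \<Rightarrow> ('u \<Rightarrow> 'x) \<Rightarrow> bool" where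
  "represents X S p \<theta> \<psi> \<longleftrightarrow> X \<in> Obj C \<and> (\<forall>s\<in>S. \<theta> s \<in> car X \<and> \<psi> (\<theta> s) = s) \<and>
    (\<forall>x\<in>car X. \<psi> x \<in> S \<and> \<theta> (\<psi> x) = x) \<and>
    tracked S p (\<lambda>s. ph X (\<theta> s)) \<and> tracked (car X) (ph X) (\<lambda>x. p (\<psi> x))"

lemma representsD:
  assumes "represents X S p \<theta> \<psi>"
  shows "X \<in> Obj C" "\<And>s. s \<in> S \<Longrightarrow> \<theta> s \<in> car X" "\<And>s. s \<in> S \<Longrightarrow> \<psi> (\<theta> s) = s"
    "\<And>x. x \<in> car X \<Longrightarrow> \<psi> x \<in> S" "\<And>x. x \<in> car X \<Longrightarrow> \<theta> (\<psi> x) = x"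
    "tracked S p (\<lambda>s. ph X (\<theta> s))" "tracked (car X) (ph X) (\<lambda>x. p (\<psi> x))"
  using assms unfolding represents_def by blast+

lemma ex_represents:
  assumes S: "small U S" and p: "\<And>s. s \<in> S \<Longrightarrow> p s \<in> A"
  obtains X \<theta> \<psi> where "represents X S p \<theta> \<psi>"
proof -
  obtain g where g: "inj_on g S" "g ` S \<in> U" using S unfolding small_def by (elim exE conjE)
  define g' where "g' = inv_into S g"
  have g': "g' (g s) = s" if "s \<in> S" for s unfolding g'_def using g(1) that by simp
  let ?\<phi> = "\<lambda>i\<in>g ` S. p (g' i)"
  have V: "(g ` S, ?\<phi>) \<in> Obj (PAsm U A app)" using g(2) g' p by (auto simp: PAsm_def)
  obtain X i where X: "X \<in> Obj C" and "is_iso (PAsm U A app) (FObj F X) (g ` S, ?\<phi>) i"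
    using F_es V unfolding essentially_surjective_def by blast
  then obtain j where i: "i \<in> Hom (PAsm U A app) (FObj F X) (g ` S, ?\<phi>)"
    and j: "j \<in> Hom (PAsm U A app) (g ` S, ?\<phi>) (FObj F X)"
    and ji: "compose (car X) j i = (\<lambda>x\<in>car X. x)" and ij: "compose (g ` S) i j = (\<lambda>x\<in>g ` S. x)"
    unfolding is_iso_def PAsm_Comp PAsm_Ide by auto
  have i_mem: "i x \<in> g ` S" if "x \<in> car X" for x using i that unfolding PAsm_Hom by auto
  have j_mem: "j y \<in> car X" if "y \<in> g ` S" for y using j that unfolding PAsm_Hom by auto
  have ji': "j (i x) = x" if "x \<in> car X" for x using fun_cong[OF ji, of x] that by (simp add: compose_def)
  have ij': "i (j y) = y" if "y \<in> g ` S" for y using fun_cong[OF ij, of y] that by (simp add: compose_def)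
  have gg': "g' y \<in> S" "g (g' y) = y" if "y \<in> g ` S" for y using that g' by auto
  have tj: "tracked (g ` S) ?\<phi> (\<lambda>y. ph X (j y))" and ti: "tracked (car X) (ph X) (\<lambda>x. ?\<phi> (i x))"
    using i j unfolding PAsm_Hom by auto
  have "tracked S (\<lambda>s. ?\<phi> (g s)) (\<lambda>s. ph X (j (g s)))" by (rule tracked_reindex[OF tj]) simp
  then have "tracked S p (\<lambda>s. ph X (j (g s)))" by (rule tracked_cong) (simp_all add: g')
  moreover have "tracked (car X) (ph X) (\<lambda>x. p (g' (i x)))"
    by (rule tracked_cong[OF ti]) (use i_mem in auto)
  ultimately have "represents X S p (\<lambda>s. j (g s)) (\<lambda>x. g' (i x))"
    unfolding represents_def using X i_mem j_mem ji' ij' g' gg' by simp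
  then show thesis by (rule that)
qed

text \<open>Arrows into and, below, out of an object can be given on any set that represents it;
  this avoids encoding pairs and functions as elements of \<open>'u\<close>.\<close>

lemma represents_in:
  assumes X: "represents X S p \<theta> \<psi>" and W: "W \<in> Obj C" and k: "\<And>w. w \<in> car W \<Longrightarrow> k w \<in> S"
    and tr: "tracked (car W) (ph W) (\<lambda>w. p (k w))"
  shows "\<exists>f\<in>Hom C W X. \<forall>w\<in>car W. mp W X f w = \<theta> (k w)"
proof (rule mp_ex[OF W representsD(1)[OF X]])
  show "\<theta> (k w) \<in> car X" if "w \<in> car W" for w using representsD(2)[OF X k[OF that]] .
  show "tracked (car W) (ph W) (\<lambda>w. ph X (\<theta> (k w)))"
    by (rule tracked_trans[OF ph_mem[OF W] tr tracked_reindex[OF representsD(6)[OF X] k]])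
qed

lemma represents_out:
  assumes X: "represents X S p \<theta> \<psi>" and W: "W \<in> Obj C" and k: "\<And>s. s \<in> S \<Longrightarrow> k s \<in> car W"
    and tr: "tracked S p (\<lambda>s. ph W (k s))"
  shows "\<exists>f\<in>Hom C X W. \<forall>x\<in>car X. mp X W f x = k (\<psi> x)"
proof (rule mp_ex[OF representsD(1)[OF X] W])
  note d = representsD[OF X]
  show "k (\<psi> x) \<in> car W" if "x \<in> car X" for x using k[OF d(4)[OF that]] .
  show "tracked (car X) (ph X) (\<lambda>x. ph W (k (\<psi> x)))"
    by (rule tracked_trans[OF ph_mem[OF d(1)] d(7) tracked_reindex[OF tr d(4)]])
qed

section \<open>The terminal object and its points\<close>

definition unit_code :: 'u where "unit_code = (SOME a. a \<in> A)"

lemma unit_code: "unit_code \<in> A"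
proof -
  obtain a where "a \<in> A" by (rule A_nonempty)
  then show ?thesis unfolding unit_code_def by (rule someI)
qed

text \<open>One element with an arbitrary code: the maps to it are tracked because constants
  are.\<close>

definition T :: 'o where
  "T = (SOME X. \<exists>\<theta> \<psi>. represents X {()} (\<lambda>_. unit_code) \<theta> \<psi>)"

definition t0 :: 'u where "t0 = (THE t. t \<in> car T)"

lemma T: "T \<in> Obj C" "car T = {t0}"
proof -
  obtain X \<theta> and \<psi> :: "'u \<Rightarrow> unit" where "represents X {()} (\<lambda>_. unit_code) \<theta> \<psi>"
    using ex_represents[OF small_finite, of "{()}" "\<lambda>_. unit_code"] unit_code by auto
  then have "\<exists>X \<theta> \<psi>. represents X {()} (\<lambda>_. unit_code) \<theta> \<psi>" by blast
  then obtain \<theta> \<psi> where r: "represents T {()} (\<lambda>_. unit_code) \<theta> \<psi>"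
    unfolding T_def by (elim someI_ex[elim_format] exE)
  show "T \<in> Obj C" using representsD(1)[OF r] .
  have "x = \<theta> ()" if "x \<in> car T" for x using representsD(5)[OF r that] by simp
  moreover have "\<theta> () \<in> car T" using representsD(2)[OF r] by simp
  ultimately have "car T = {\<theta> ()}" by blast
  then show "car T = {t0}" unfolding t0_def by simp
qed

lemma terminal_T: "is_terminal C T"
  unfolding is_terminal_def
proof (intro conjI T ballI)
  fix X assume X: "X \<in> Obj C"
  have t: "ph T t0 \<in> A" using ph_mem[OF T(1)] T(2) by simp
  have "tracked (car X) (ph X) (\<lambda>_. ph T t0)" by (rule tracked_const[OF t ph_mem[OF X]])
  from mp_ex[OF X T(1) _ this] obtain f where f: "f \<in> Hom C X T" using T(2) by auto
  have "mp X T g x = t0" if "g \<in> Hom C X T" "x \<in> car X" for g x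
    using mp_mem[OF X T(1) that] T(2) by simp
  then have "g = f" if "g \<in> Hom C X T" for g
    by - (rule mp_eq[OF X T(1) that f], use that f in simp)
  then show "\<exists>!f. f \<in> Hom C X T" using f by blast
qed

text \<open>\<open>val\<close> and \<open>pt\<close> identify the global points of \<open>X\<close>
  with its underlying set, which links statements about \<Gamma> to computations on underlying
  sets.\<close>

definition val :: "'o \<Rightarrow> 'u \<Rightarrow> 'u" where "val X h = mp T X h t0"

definition pt :: "'o \<Rightarrow> 'u \<Rightarrow> 'u" where "pt X x = (SOME h. h \<in> Hom C T X \<and> val X h = x)"

lemma val_mem: "X \<in> Obj C \<Longrightarrow> h \<in> Hom C T X \<Longrightarrow> val X h \<in> car X"
  unfolding val_def using mp_mem[OF T(1)] T(2) by simp

lemma val_inj: "X \<in> Obj C \<Longrightarrow> h \<in> Hom C T X \<Longrightarrow> h' \<in> Hom C T X \<Longrightarrow> val X h = val X h' \<Longrightarrow> h = h'"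
  by (rule mp_eq[OF T(1)]) (simp_all add: T(2) val_def)

lemma pt: assumes X: "X \<in> Obj C" and x: "x \<in> car X"
  shows "pt X x \<in> Hom C T X" "val X (pt X x) = x"
proof -
  have "tracked (car T) (ph T) (\<lambda>_. ph X x)" by (rule tracked_const[OF ph_mem[OF X x] ph_mem[OF T(1)]])
  from mp_ex[OF T(1) X x this] have "\<exists>h. h \<in> Hom C T X \<and> val X h = x" unfolding val_def T(2) by auto
  from someI_ex[OF this] show "pt X x \<in> Hom C T X" "val X (pt X x) = x" unfolding pt_def by auto
qed

lemma val_Comp: "X \<in> Obj C \<Longrightarrow> Y \<in> Obj C \<Longrightarrow> f \<in> Hom C X Y \<Longrightarrow> h \<in> Hom C T X \<Longrightarrow>
    val Y (Comp C T X Y f h) = mp X Y f (val X h)"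
  unfolding val_def by (rule mp_Comp[OF T(1)]) (simp_all add: T(2))

lemma pt_val: "X \<in> Obj C \<Longrightarrow> h \<in> Hom C T X \<Longrightarrow> pt X (val X h) = h"
  using val_inj[OF _ pt(1)[OF _ val_mem] _ pt(2)[OF _ val_mem]] by simp

section \<open>Finite limits and pullbacks\<close>

definition tuple_code :: "'u list \<Rightarrow> 'u" where
  "tuple_code as = foldr pr as unit_code"

lemma tuple_code_mem: "set as \<subseteq> A \<Longrightarrow> tuple_code as \<in> A"
  unfolding tuple_code_def by (induction as) (simp_all add: unit_code pr(2))

lemma tracked_tuple:
  assumes p: "\<And>s. s \<in> S \<Longrightarrow> p s \<in> A" and q: "\<And>j. j \<in> set js \<Longrightarrow> tracked S p (q j)"
  shows "tracked S p (\<lambda>s. tuple_code (map (\<lambda>j. q j s) js))"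
  using q
proof (induction js)
  case Nil
  then show ?case by (simp add: tuple_code_def tracked_const[OF unit_code p])
next
  case (Cons j js)
  then have "tracked S p (\<lambda>s. pr (q j s) (tuple_code (map (\<lambda>j. q j s) js)))" by (intro tracked_pr[OF p]) simp_all
  then show ?case by (simp add: tuple_code_def)
qed

lemma tracked_component:
  assumes "\<And>j s. j \<in> set js \<Longrightarrow> s \<in> S \<Longrightarrow> q j s \<in> A" and "i \<in> set js"
  shows "tracked S (\<lambda>s. tuple_code (map (\<lambda>j. q j s) js)) (q i)"
  using assms
proof (induction js)
  case (Cons j js)
  let ?t = "\<lambda>s. tuple_code (map (\<lambda>j. q j s) js)"
  have mem: "q j s \<in> A" "?t s \<in> A" if "s \<in> S" for s
    using Cons.prems(1) that by (auto intro!: tuple_code_mem)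
  have eq: "tuple_code (map (\<lambda>j. q j s) (j # js)) = pr (q j s) (?t s)" for s by (simp add: tuple_code_def)
  show ?case
  proof (cases "i = j")
    case True
    then show ?thesis unfolding eq by (auto intro: tracked_fst mem)
  next
    case False
    then have t: "tracked S ?t (q i)" using Cons by simp
    show ?thesis unfolding eq by (rule tracked_trans[OF _ tracked_snd[OF mem] t]) (rule pr(2)[OF mem])
  qed
qed simp

text \<open>The limit is the set of compatible families, as for sets, with a family coded by the
  tuple of the codes of its components along a list \<open>js\<close> of the objects. By
  \<open>tracked_component\<close> the projections are tracked, and by \<open>tracked_tuple\<close>
  so is the map induced by a cone.\<close>

lemma has_finite_limits: "has_finite_limits C"
  unfolding has_finite_limits_def
proof (intro allI impI, elim conjE)
  fix J :: "(nat, nat) cat" and D assume J: "finite_category J" and D: "is_functor J C D"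
  let ?D = "FObj D"
  have Do: "?D j \<in> Obj C" if "j \<in> Obj J" for j using functor_obj[OF D that] .
  have Dm: "FMap D j k f \<in> Hom C (?D j) (?D k)" if "j \<in> Obj J" "k \<in> Obj J" "f \<in> Hom J j k" for j k f
    using functor_map[OF D that] .
  have "finite (Obj J)" using J unfolding finite_category_def by blast
  then obtain js where js: "set js = Obj J" using finite_list by blast
  define S where "S = {x \<in> PiE (Obj J) (\<lambda>j. car (?D j)).
    \<forall>j\<in>Obj J. \<forall>k\<in>Obj J. \<forall>f\<in>Hom J j k. mp (?D j) (?D k) (FMap D j k f) (x j) = x k}"
  have S_mem: "x j \<in> car (?D j)" if "x \<in> S" "j \<in> Obj J" for x j using that unfolding S_def by auto
  have "small U (PiE (Obj J) (\<lambda>j. car (?D j)))"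
    by (rule small_PiE) (use \<open>finite (Obj J)\<close> small_finite small_U car_U Do in auto)
  then have "small U S" by (rule small_subset) (auto simp: S_def)
  define q where "q j x = ph (?D j) (x j)" for j x
  have q: "q j x \<in> A" if "j \<in> set js" "x \<in> S" for j x
    unfolding q_def using that S_mem Do ph_mem js by blast
  define p where "p x = tuple_code (map (\<lambda>j. q j x) js)" for x
  have p: "p x \<in> A" if "x \<in> S" for x unfolding p_def using q that by (auto intro!: tuple_code_mem)
  obtain L \<theta> \<psi> where L: "represents L S p \<theta> \<psi>" using ex_represents[OF \<open>small U S\<close> p] .
  note Ld = representsD[OF L]
  have "\<exists>f\<in>Hom C L (?D j). \<forall>x\<in>car L. mp L (?D j) f x = \<psi> x j" if j: "j \<in> Obj J" for j
  proof (rule represents_out[OF L Do[OF j]])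
    show "s j \<in> car (?D j)" if "s \<in> S" for s using S_mem[OF that j] .
    have "tracked S (\<lambda>s. tuple_code (map (\<lambda>j. q j s) js)) (q j)" by (rule tracked_component[OF q]) (use j js in auto)
    then show "tracked S p (\<lambda>s. ph (?D j) (s j))" unfolding p_def q_def .
  qed
  then obtain l where l: "\<And>j. j \<in> Obj J \<Longrightarrow> l j \<in> Hom C L (?D j)"
    "\<And>j x. j \<in> Obj J \<Longrightarrow> x \<in> car L \<Longrightarrow> mp L (?D j) (l j) x = \<psi> x j" by metis
  have "is_limit J C D L l"
    unfolding is_limit_def
  proof (intro conjI allI impI)
    show "is_cone J C D L l"
      unfolding is_cone_def
    proof (intro conjI ballI Ld(1) l(1))
      fix j k f assume j: "j \<in> Obj J" "k \<in> Obj J" "f \<in> Hom J j k"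
      note o = Do[OF j(1)] Do[OF j(2)] and f = Dm[OF j]
      show "Comp C L (?D j) (?D k) (FMap D j k f) (l j) = l k"
      proof (rule mp_eq[OF Ld(1) o(2) Comp_Hom[OF Ld(1) o l(1)[OF j(1)] f] l(1)[OF j(2)]])
        fix x assume x: "x \<in> car L"
        show "mp L (?D k) (Comp C L (?D j) (?D k) (FMap D j k f) (l j)) x = mp L (?D k) (l k) x"
          unfolding mp_Comp[OF Ld(1) o l(1)[OF j(1)] f x] l(2)[OF j(1) x] l(2)[OF j(2) x]
          using Ld(4)[OF x] j unfolding S_def by blast
      qed
    qed
    fix X \<mu> assume cone: "is_cone J C D X \<mu>"
    then have X: "X \<in> Obj C" and \<mu>: "\<And>j. j \<in> Obj J \<Longrightarrow> \<mu> j \<in> Hom C X (?D j)"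
      and \<mu>c: "\<And>j k f. j \<in> Obj J \<Longrightarrow> k \<in> Obj J \<Longrightarrow> f \<in> Hom J j k \<Longrightarrow> Comp C X (?D j) (?D k) (FMap D j k f) (\<mu> j) = \<mu> k"
      unfolding is_cone_def by blast+
    define h where "h x = (\<lambda>j\<in>Obj J. mp X (?D j) (\<mu> j) x)" for x
    have hS: "h x \<in> S" if x: "x \<in> car X" for x
      unfolding S_def
    proof (intro CollectI conjI ballI)
      show "h x \<in> PiE (Obj J) (\<lambda>j. car (?D j))" unfolding h_def using mp_mem[OF X Do \<mu> x] by simp
      fix j k f assume j: "j \<in> Obj J" "k \<in> Obj J" "f \<in> Hom J j k"
      have "mp (?D j) (?D k) (FMap D j k f) (mp X (?D j) (\<mu> j) x) = mp X (?D k) (\<mu> k) x"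
        unfolding \<mu>c[OF j, symmetric] by (rule mp_Comp[OF X Do[OF j(1)] Do[OF j(2)] \<mu>[OF j(1)] Dm[OF j] x, symmetric])
      then show "mp (?D j) (?D k) (FMap D j k f) (h x j) = h x k" unfolding h_def using j by simp
    qed
    have "tracked (car X) (ph X) (\<lambda>x. tuple_code (map (\<lambda>j. ph (?D j) (mp X (?D j) (\<mu> j) x)) js))"
      by (rule tracked_tuple[OF ph_mem[OF X]]) (use mp_tracked[OF X Do \<mu>] js in auto)
    moreover have "map (\<lambda>j. ph (?D j) (mp X (?D j) (\<mu> j) x)) js = map (\<lambda>j. q j (h x)) js" for x
      using js by (simp add: q_def h_def)
    ultimately have "tracked (car X) (ph X) (\<lambda>x. p (h x))" unfolding p_def by simp
    then have "\<exists>m\<in>Hom C X L. \<forall>x\<in>car X. mp X L m x = \<theta> (h x)"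
      by - (rule represents_in[OF L X hS])
    then obtain m where m: "m \<in> Hom C X L" "\<forall>x\<in>car X. mp X L m x = \<theta> (h x)"
      by (elim bexE)
    have lm: "Comp C X L (?D j) (l j) m' = \<mu> j \<longleftrightarrow> (\<forall>x\<in>car X. \<psi> (mp X L m' x) j = mp X (?D j) (\<mu> j) x)"
      if m': "m' \<in> Hom C X L" and j: "j \<in> Obj J" for m' j
    proof -
      have "mp X (?D j) (Comp C X L (?D j) (l j) m') x = \<psi> (mp X L m' x) j" if x: "x \<in> car X" for x
        unfolding mp_Comp[OF X Ld(1) Do[OF j] m' l(1)[OF j] x] by (rule l(2)[OF j mp_mem[OF X Ld(1) m' x]])
      then show ?thesis
        using mp_eq[OF X Do[OF j] Comp_Hom[OF X Ld(1) Do[OF j] m' l(1)[OF j]] \<mu>[OF j]] by auto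
    qed
    show "\<exists>!h. h \<in> Hom C X L \<and> (\<forall>j\<in>Obj J. Comp C X L (?D j) (l j) h = \<mu> j)"
    proof (rule ex1I[of _ m], intro conjI ballI m(1))
      show "Comp C X L (?D j) (l j) m = \<mu> j" if j: "j \<in> Obj J" for j
        unfolding lm[OF m(1) j] using m(2) Ld(3)[OF hS] j by (simp add: h_def)
      fix m' assume m': "m' \<in> Hom C X L \<and> (\<forall>j\<in>Obj J. Comp C X L (?D j) (l j) m' = \<mu> j)"
      show "m' = m"
      proof (rule mp_eq[OF X Ld(1) conjunct1[OF m'] m(1)])
        fix x assume x: "x \<in> car X"
        have y: "mp X L m' x \<in> car L" using mp_mem[OF X Ld(1) conjunct1[OF m'] x] .
        have "\<psi> (mp X L m' x) = h x"
        proof (rule PiE_ext)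
          show "\<psi> (mp X L m' x) \<in> PiE (Obj J) (\<lambda>j. car (?D j))" "h x \<in> PiE (Obj J) (\<lambda>j. car (?D j))"
            using Ld(4)[OF y] hS[OF x] unfolding S_def by auto
          show "\<psi> (mp X L m' x) j = h x j" if j: "j \<in> Obj J" for j
            using m' lm[OF conjunct1[OF m'] j] j x by (simp add: h_def)
        qed
        then show "mp X L m' x = mp X L m x" using Ld(5)[OF y] bspec[OF m(2) x] by simp
      qed
    qed
  qed
  then show "\<exists>L l. is_limit J C D L l" by blast
qed

text \<open>An arbitrary pullback is compared with the concrete object \<open>Q\<close> of matching
  pairs. The mediating arrow from \<open>Q\<close> to \<open>P\<close> supplies the points, and
  since it is tracked, the code of a point of \<open>P\<close> can be computed from the codes of its
  two projections.\<close>

lemma pullback_description: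
  assumes P: "is_pullback C P X Y Z p q f g"
  shows "x \<in> car X \<Longrightarrow> y \<in> car Y \<Longrightarrow> mp X Z f x = mp Y Z g y \<Longrightarrow> \<exists>z\<in>car P. mp P X p z = x \<and> mp P Y q z = y"
    "z \<in> car P \<Longrightarrow> z' \<in> car P \<Longrightarrow> mp P X p z = mp P X p z' \<Longrightarrow> mp P Y q z = mp P Y q z' \<Longrightarrow> z = z'"
    "tracked (car P) (\<lambda>z. pr (ph X (mp P X p z)) (ph Y (mp P Y q z))) (ph P)"
proof -
  note d = pullbackD[OF P]
  define S where "S = {(x, y). x \<in> car X \<and> y \<in> car Y \<and> mp X Z f x = mp Y Z g y}"
  define c where "c = (\<lambda>(x, y). pr (ph X x) (ph Y y))"
  have "small U (car X \<times> car Y)" by (intro small_Times small_U car_U d)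
  then have small: "small U S" by (rule small_subset) (auto simp: S_def)
  have c: "c s \<in> A" if "s \<in> S" for s
    using that ph_mem[OF d(2)] ph_mem[OF d(3)] unfolding c_def S_def by (auto intro: pr(2))
  obtain Q \<theta> \<psi> where Q: "represents Q S c \<theta> \<psi>" using ex_represents[OF small c] .
  note Qd = representsD[OF Q]
  have mem: "ph X (fst s) \<in> A" "ph Y (snd s) \<in> A" if "s \<in> S" for s
    using that ph_mem[OF d(2)] ph_mem[OF d(3)] unfolding S_def by auto
  have ta: "tracked S c (\<lambda>s. ph X (fst s))"
    by (rule tracked_cong[OF tracked_fst[OF mem]]) (auto simp: c_def)
  have "\<exists>f\<in>Hom C Q X. \<forall>z\<in>car Q. mp Q X f z = fst (\<psi> z)"
    by (rule represents_out[OF Q d(2) _ ta]) (auto simp: S_def)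
  then obtain a where a: "a \<in> Hom C Q X" "\<forall>z\<in>car Q. mp Q X a z = fst (\<psi> z)"
    by (elim bexE)
  have tb: "tracked S c (\<lambda>s. ph Y (snd s))"
    by (rule tracked_cong[OF tracked_snd[OF mem]]) (auto simp: c_def)
  have "\<exists>f\<in>Hom C Q Y. \<forall>z\<in>car Q. mp Q Y f z = snd (\<psi> z)"
    by (rule represents_out[OF Q d(3) _ tb]) (auto simp: S_def)
  then obtain b where b: "b \<in> Hom C Q Y" "\<forall>z\<in>car Q. mp Q Y b z = snd (\<psi> z)"
    by (elim bexE)
  have "Comp C Q X Z f a = Comp C Q Y Z g b"
  proof (rule mp_eq[OF Qd(1) d(4) Comp_Hom[OF Qd(1) d(2,4) a(1) d(7)] Comp_Hom[OF Qd(1) d(3,4) b(1) d(8)]])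
    fix z assume z: "z \<in> car Q"
    show "mp Q Z (Comp C Q X Z f a) z = mp Q Z (Comp C Q Y Z g b) z"
      unfolding mp_Comp[OF Qd(1) d(2,4) a(1) d(7) z] mp_Comp[OF Qd(1) d(3,4) b(1) d(8) z]
        bspec[OF a(2) z] bspec[OF b(2) z] using Qd(4)[OF z] unfolding S_def by auto
  qed
  from pullback_ex1[OF P Qd(1) a(1) b(1) this] obtain m where m: "m \<in> Hom C Q P"
    "Comp C Q P X p m = a" "Comp C Q P Y q m = b" by blast
  have mz: "mp Q P m (\<theta> (x, y)) \<in> car P" "mp P X p (mp Q P m (\<theta> (x, y))) = x" "mp P Y q (mp Q P m (\<theta> (x, y))) = y"
    if xy: "(x, y) \<in> S" for x y
  proof -
    note z = Qd(2)[OF xy]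
    show "mp Q P m (\<theta> (x, y)) \<in> car P" using mp_mem[OF Qd(1) d(1) m(1) z] .
    show "mp P X p (mp Q P m (\<theta> (x, y))) = x"
      unfolding mp_Comp[OF Qd(1) d(1,2) m(1) d(5) z, symmetric] m(2) bspec[OF a(2) z] Qd(3)[OF xy] by simp
    show "mp P Y q (mp Q P m (\<theta> (x, y))) = y"
      unfolding mp_Comp[OF Qd(1) d(1,3) m(1) d(6) z, symmetric] m(3) bspec[OF b(2) z] Qd(3)[OF xy] by simp
  qed
  show "\<exists>z\<in>car P. mp P X p z = x \<and> mp P Y q z = y" if "x \<in> car X" "y \<in> car Y" "mp X Z f x = mp Y Z g y"
  proof -
    have "(x, y) \<in> S" using that unfolding S_def by simp
    note m_xy = mz[OF this]
    show ?thesis by (rule bexI[where x = "mp Q P m (\<theta> (x, y))"]) (intro conjI m_xy(2,3), rule m_xy(1))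
  qed
  show uniq: "z = z'" if z: "z \<in> car P" "z' \<in> car P" "mp P X p z = mp P X p z'" "mp P Y q z = mp P Y q z'" for z z'
  proof -
    note t = pt[OF d(1) z(1)] and t' = pt[OF d(1) z(2)]
    have "Comp C T P X p (pt P z) = Comp C T P X p (pt P z')"
      by (rule val_inj[OF d(2) Comp_Hom[OF T(1) d(1,2) t(1) d(5)] Comp_Hom[OF T(1) d(1,2) t'(1) d(5)]])
        (simp only: val_Comp[OF d(1,2,5) t(1)] val_Comp[OF d(1,2,5) t'(1)] t(2) t'(2) z(3))
    moreover have "Comp C T P Y q (pt P z) = Comp C T P Y q (pt P z')"
      by (rule val_inj[OF d(3) Comp_Hom[OF T(1) d(1,3) t(1) d(6)] Comp_Hom[OF T(1) d(1,3) t'(1) d(6)]])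
        (simp only: val_Comp[OF d(1,3,6) t(1)] val_Comp[OF d(1,3,6) t'(1)] t(2) t'(2) z(4))
    ultimately have "pt P z = pt P z'" by (rule pullback_eq[OF P T(1) t(1) t'(1)])
    then have "val P (pt P z) = val P (pt P z')" by (rule arg_cong)
    then show ?thesis unfolding t(2) t'(2) .
  qed
  have S_mem: "(mp P X p z, mp P Y q z) \<in> S" if z: "z \<in> car P" for z
    using mp_mem[OF d(1,2,5) z] mp_mem[OF d(1,3,6) z] d(9)
      mp_Comp[OF d(1,2,4,5,7) z] mp_Comp[OF d(1,3,4,6,8) z] unfolding S_def by simp
  have "tracked S c (\<lambda>s. ph P (mp Q P m (\<theta> s)))"
    by (rule tracked_trans[OF c Qd(6) tracked_reindex[OF mp_tracked[OF Qd(1) d(1) m(1)] Qd(2)]])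
  from tracked_reindex[OF this S_mem]
  show "tracked (car P) (\<lambda>z. pr (ph X (mp P X p z)) (ph Y (mp P Y q z))) (ph P)"
  proof (rule tracked_cong)
    fix z assume z: "z \<in> car P"
    show "c (mp P X p z, mp P Y q z) = pr (ph X (mp P X p z)) (ph Y (mp P Y q z))" unfolding c_def by simp
    have "mp Q P m (\<theta> (mp P X p z, mp P Y q z)) = z"
      by (rule uniq[OF mz(1)[OF S_mem[OF z]] z mz(2,3)[OF S_mem[OF z]]])
    then show "ph P (mp Q P m (\<theta> (mp P X p z, mp P Y q z))) = ph P z" by simp
  qed
qed

section \<open>The local structure and the generic object\<close>

lemma Hom_U: "X \<in> Obj C \<Longrightarrow> Y \<in> Obj C \<Longrightarrow> Hom C X Y \<in> U"
proof -
  assume X: "X \<in> Obj C" and Y: "Y \<in> Obj C"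
  \<comment> \<open>\<open>F\<close> embeds the hom-set into a set of functions, which is small
    though not itself a set of elements of \<open>'u\<close>; \<open>small_U_iff\<close> leads back
    to \<open>U\<close>.\<close>
  have "inj_on (mp X Y) (Hom C X Y)" by (rule inj_onI) (rule ff_inj[OF F_ff X Y])
  moreover have "mp X Y ` Hom C X Y \<subseteq> PiE (car X) (\<lambda>_. car Y)"
    using functor_map[OF F_functor X Y] unfolding PAsm_Hom by blast
  moreover have "small U (PiE (car X) (\<lambda>_. car Y))" by (intro small_PiE small_U car_U X Y)
  ultimately have "small U (Hom C X Y)" by (intro small_inj[of _ "mp X Y"])
  then show ?thesis unfolding small_U_iff .
qed

lemma points_eq:
  assumes W: "W \<in> Obj C" "X \<in> Obj C" and g: "g \<in> Hom C W X" "h \<in> Hom C W X"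
    and eq: "\<And>t. t \<in> Hom C T W \<Longrightarrow> Comp C T W X g t = Comp C T W X h t"
  shows "g = h"
proof (rule mp_eq[OF W g])
  fix x assume x: "x \<in> car W"
  note t = pt[OF W(1) x]
  have "val X (Comp C T W X g (pt W x)) = val X (Comp C T W X h (pt W x))" unfolding eq[OF t(1)] ..
  then show "mp W X g x = mp W X h x"
    unfolding val_Comp[OF W g(1) t(1)] val_Comp[OF W g(2) t(1)] t(2) .
qed

text \<open>Give every element of \<open>S\<close> the same code. Since constants are tracked, every
  function into the resulting object is an arrow, which is the universal property of \<nabla> of
  \<open>S\<close>.\<close>

lemma ex_nabla: "\<exists>N \<eta> \<epsilon>. adjunction C (set_cat U) (hom_functor C T) N \<eta> \<epsilon>"
proof -
  have "\<exists>X \<theta> \<psi>. S \<in> U \<longrightarrow> represents X S (\<lambda>_. unit_code) \<theta> \<psi>" for S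
  proof (cases "S \<in> U")
    case True
    obtain X \<theta> \<psi> where "represents X S (\<lambda>_. unit_code) \<theta> \<psi>"
      using ex_represents[OF small_U[OF True], of "\<lambda>_. unit_code"] unit_code by blast
    then show ?thesis by blast
  qed simp
  then obtain NO \<theta> \<psi> where rep: "\<And>S. S \<in> U \<Longrightarrow> represents (NO S) S (\<lambda>_. unit_code) (\<theta> S) (\<psi> S)"
    by metis
  define \<epsilon> where "\<epsilon> S = (\<lambda>t\<in>Hom C T (NO S). \<psi> S (val (NO S) t))" for S
  have "\<exists>N \<eta>. adjunction C (set_cat U) (hom_functor C T) N \<eta> \<epsilon>"
  proof (rule universal_adjunction[OF category_axioms category_set_cat functor_hom[OF T(1)]])
    show "Hom C T Y \<in> U" if "Y \<in> Obj C" for Y using Hom_U[OF T(1) that] .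
    fix S assume "S \<in> Obj (set_cat U)"
    then have S: "S \<in> U" by (simp add: set_cat_def)
    note d = representsD[OF rep[OF S]]
    show "NO S \<in> Obj C" by (rule d(1))
    show "\<epsilon> S \<in> Hom (set_cat U) (FObj (hom_functor C T) (NO S)) S"
      unfolding \<epsilon>_def using d(4)[OF val_mem[OF d(1)]] by (simp add: set_cat_def hom_functor_def)
    fix X f assume X: "X \<in> Obj C" and "f \<in> Hom (set_cat U) (FObj (hom_functor C T) X) S"
    then have f: "f \<in> Hom C T X \<rightarrow>\<^sub>E S" by (simp add: set_cat_def hom_functor_def)
    let ?c = "\<lambda>g. Comp (set_cat U) (FObj (hom_functor C T) X) (FObj (hom_functor C T) (NO S)) S (\<epsilon> S)
      (FMap (hom_functor C T) X (NO S) g)"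
    have c: "?c g t = \<psi> S (mp X (NO S) g (val X t))" if "g \<in> Hom C X (NO S)" "t \<in> Hom C T X" for g t
      using that Comp_Hom[OF T(1) X d(1) that(2,1)]
      by (simp add: set_cat_def hom_functor_def compose_def \<epsilon>_def val_Comp[OF X d(1) that(1,2)])
    have c_undef: "?c g t = undefined" if "t \<notin> Hom C T X" for g t
      using that by (simp add: set_cat_def hom_functor_def compose_def)
    have k: "f (pt X x) \<in> S" if "x \<in> car X" for x using PiE_mem[OF f pt(1)[OF X that]] .
    have "tracked (car X) (ph X) (\<lambda>_. unit_code)" by (rule tracked_const[OF unit_code ph_mem[OF X]])
    then have "\<exists>m\<in>Hom C X (NO S). \<forall>x\<in>car X. mp X (NO S) m x = \<theta> S (f (pt X x))"
      by - (rule represents_in[OF rep[OF S] X k])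
    then obtain m where m: "m \<in> Hom C X (NO S)" "\<forall>x\<in>car X. mp X (NO S) m x = \<theta> S (f (pt X x))"
      by (elim bexE)
    show "\<exists>!g. g \<in> Hom C X (NO S) \<and> ?c g = f"
    proof (rule ex1I[of _ m], intro conjI m(1))
      show "?c m = f"
      proof
        fix t
        show "?c m t = f t"
        proof (cases "t \<in> Hom C T X")
          case True
          show ?thesis
            unfolding c[OF m(1) True] bspec[OF m(2) val_mem[OF X True]] pt_val[OF X True] d(3)[OF PiE_mem[OF f True]] ..
        next
          case False
          show ?thesis unfolding c_undef[OF False] PiE_arb[OF f False] ..
        qed
      qed
      fix g assume g: "g \<in> Hom C X (NO S) \<and> ?c g = f"
      show "g = m"
      proof (rule mp_eq[OF X d(1) conjunct1[OF g] m(1)])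
        fix x assume x: "x \<in> car X"
        note t = pt[OF X x]
        have "\<psi> S (mp X (NO S) g x) = f (pt X x)"
          using c[OF conjunct1[OF g] t(1)] unfolding conjunct2[OF g] t(2) by (rule sym)
        then have "\<theta> S (\<psi> S (mp X (NO S) g x)) = mp X (NO S) m x" unfolding bspec[OF m(2) x] by (rule arg_cong)
        then show "mp X (NO S) g x = mp X (NO S) m x"
          unfolding d(5)[OF mp_mem[OF X d(1) conjunct1[OF g] x]] .
      qed
    qed
  qed
  then show ?thesis by blast
qed

lemma ex_local_structure: "\<exists>N \<eta> \<epsilon>. local_category U C T N \<eta> \<epsilon>"
  using ex_nabla Hom_U terminal_T has_finite_limits category_axioms
  unfolding local_category_def locally_small_def by blast

text \<open>\<open>G\<close> is \<open>A\<close> with each element as its own code. The local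
  structure is any given one; it enters through the descriptions of closed arrows and separated
  objects by points.\<close>

lemma ex_generic:
  assumes loc: "local_category U C T N \<eta> \<epsilon>"
  shows "\<exists>G\<in>Obj C. separated_object C T N \<eta> G \<and> discrete_object C T N \<eta> G \<and> generic_object C T N \<eta> G"
proof -
  interpret L: local_cat U C T N \<eta> \<epsilon>
    by unfold_locales (rule has_finite_limits, rule loc)
  obtain G \<theta> \<psi> where rep: "represents G A (\<lambda>a. a) \<theta> \<psi>" using ex_represents[OF small_U[OF A_U], of "\<lambda>a. a"] by blast
  note d = representsD[OF rep] and G = representsD(1)[OF rep]
  have faithful: "L.global_sections_faithful"
    unfolding L.global_sections_faithful_def by (intro ballI impI, rule points_eq) (assumption | erule (1) bspec)+
  \<comment> \<open>An arrow is closed once the code of a point can be computed from the code of its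
    image: a function into \<open>X\<close> that lies over a tracked function is then tracked
    itself.\<close>
  have cartesianI: "L.cartesian X Z f"
    if X: "X \<in> Obj C" "Z \<in> Obj C" "f \<in> Hom C X Z" and tr: "tracked (car X) (\<lambda>x. ph Z (mp X Z f x)) (ph X)" for X Z f
  proof (rule L.cartesianI_faithful[OF faithful X])
    fix W h k assume W: "W \<in> Obj C" "h \<in> Hom C W Z" and k: "k \<in> Hom C T W \<rightarrow> Hom C T X"
      and kh: "\<And>t. t \<in> Hom C T W \<Longrightarrow> Comp C T X Z f (k t) = Comp C T W Z h t"
    define v where "v w = val X (k (pt W w))" for w
    have kp: "k (pt W w) \<in> Hom C T X" if "w \<in> car W" for w using k pt(1)[OF W(1) that] by blast
    have v: "v w \<in> car X" if "w \<in> car W" for w unfolding v_def using val_mem[OF X(1) kp[OF that]] .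
    have fv: "mp X Z f (v w) = mp W Z h w" if w: "w \<in> car W" for w
    proof -
      note t = pt[OF W(1) w]
      have "val Z (Comp C T X Z f (k (pt W w))) = val Z (Comp C T W Z h (pt W w))" unfolding kh[OF t(1)] ..
      then show ?thesis unfolding val_Comp[OF X kp[OF w]] val_Comp[OF W(1) X(2) W(2) t(1)] t(2) v_def .
    qed
    have "tracked (car W) (\<lambda>w. ph Z (mp X Z f (v w))) (\<lambda>w. ph X (v w))" by (rule tracked_reindex[OF tr v])
    then have "tracked (car W) (\<lambda>w. ph Z (mp W Z h w)) (\<lambda>w. ph X (v w))" by (rule tracked_cong) (simp_all add: fv)
    from tracked_trans[OF _ mp_tracked[OF W(1) X(2) W(2)] this] ph_mem[OF W(1)]
    have "tracked (car W) (ph W) (\<lambda>w. ph X (v w))" by blast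
    then have "\<exists>m\<in>Hom C W X. \<forall>w\<in>car W. mp W X m w = v w" by - (rule mp_ex[OF W(1) X(1) v])
    then obtain m where m: "m \<in> Hom C W X" "\<forall>w\<in>car W. mp W X m w = v w" by (elim bexE)
    have "Comp C T W X m t = k t" if t: "t \<in> Hom C T W" for t
    proof (rule val_inj[OF X(1) Comp_Hom[OF T(1) W(1) X(1) t m(1)]])
      show "k t \<in> Hom C T X" using k t by blast
      show "val X (Comp C T W X m t) = val X (k t)"
        unfolding val_Comp[OF W(1) X(1) m(1) t] bspec[OF m(2) val_mem[OF W(1) t]] v_def pt_val[OF W(1) t] ..
    qed
    then show "\<exists>m\<in>Hom C W X. \<forall>t\<in>Hom C T W. Comp C T W X m t = k t" using m(1) by blast
  qed
  have sep: "separated_object C T N \<eta> G"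
    by (rule L.separatedI[OF G points_eq[OF _ G]])
  have "\<exists>f\<in>Hom C X G. L.cartesian X G f" if X: "X \<in> Obj C" for X
  proof -
    \<comment> \<open>The closed arrow into \<open>G\<close> is the code function of
      \<open>X\<close>, read as a map into \<open>A\<close>.\<close>
    have "\<exists>f\<in>Hom C X G. \<forall>x\<in>car X. mp X G f x = \<theta> (ph X x)"
      by (rule represents_in[OF rep X ph_mem[OF X] tracked_refl[OF ph_mem[OF X]]])
    then obtain f where f: "f \<in> Hom C X G" "\<forall>x\<in>car X. mp X G f x = \<theta> (ph X x)" by (elim bexE)
    have "tracked (car X) (\<lambda>x. ph G (mp X G f x)) (\<lambda>x. \<psi> (mp X G f x))"
      by (rule tracked_reindex[OF d(7) mp_mem[OF X G f(1)]])
    then have "tracked (car X) (\<lambda>x. ph G (mp X G f x)) (ph X)"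
      by (rule tracked_cong) (simp_all add: f(2) d(3)[OF ph_mem[OF X]])
    then show ?thesis using cartesianI[OF X G f(1)] f(1) by blast
  qed
  then have gen: "generic_object C T N \<eta> G"
    unfolding generic_object_def L.closed_iff using G by blast
  have ext: "\<exists>!g. g \<in> Hom C X G \<and> Comp C D X G g e = f"
    if X: "X \<in> Obj C" and D: "D \<in> Obj C" and e: "e \<in> Hom C D X" and f: "f \<in> Hom C D G"
      and cart: "L.cartesian D X e"
      and onto: "FMap (hom_functor C T) D X e ` FObj (hom_functor C T) D = FObj (hom_functor C T) X" for X D e f
  proof -
    have "\<exists>y\<in>car D. mp D X e y = x" if x: "x \<in> car X" for x
    proof -
      note t = pt[OF X x]
      have "pt X x \<in> FMap (hom_functor C T) D X e ` FObj (hom_functor C T) D"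
        unfolding onto using t(1) by (simp add: hom_functor_def)
      then obtain s where s: "s \<in> Hom C T D" "pt X x = Comp C T D X e s" by (auto simp: hom_functor_def)
      have "mp D X e (val D s) = x" using t(2) unfolding s(2) val_Comp[OF D X e s(1)] .
      then show ?thesis using val_mem[OF D s(1)] by (rule bexI)
    qed
    \<comment> \<open>A section of \<open>e\<close> on underlying sets, chosen without regard to
      tracking; the extension will be \<open>f\<close> after \<open>\<sigma>\<close>.\<close>
    then obtain \<sigma> where \<sigma>: "\<And>x. x \<in> car X \<Longrightarrow> \<sigma> x \<in> car D" "\<And>x. x \<in> car X \<Longrightarrow> mp D X e (\<sigma> x) = x" by metis
    \<comment> \<open>Closedness of \<open>e\<close> is tested on \<open>D'\<close>, the underlying
      set of \<open>D\<close> recoded by the codes of the images under \<open>e\<close>. The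
      identity function lifts to an arrow \<open>m\<close> from \<open>D'\<close> to
      \<open>D\<close>, so the code of \<open>y\<close> can be computed from the code of its
      image.\<close>
    define c where "c y = ph X (mp D X e y)" for y
    have c: "c y \<in> A" if "y \<in> car D" for y unfolding c_def using ph_mem[OF X mp_mem[OF D X e that]] .
    obtain D' \<theta>' \<psi>' where D': "represents D' (car D) c \<theta>' \<psi>'" using ex_represents[OF small_U[OF car_U[OF D]] c] .
    note d' = representsD[OF D']
    have "tracked (car D) c (\<lambda>y. ph X (mp D X e y))" unfolding c_def[abs_def]
      by (rule tracked_refl) (use ph_mem[OF X mp_mem[OF D X e]] in blast)
    then have "\<exists>e'\<in>Hom C D' X. \<forall>y\<in>car D'. mp D' X e' y = mp D X e (\<psi>' y)"
      by - (rule represents_out[OF D' X mp_mem[OF D X e]])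
    then obtain e' where e': "e' \<in> Hom C D' X" "\<forall>y\<in>car D'. mp D' X e' y = mp D X e (\<psi>' y)" by (elim bexE)
    have kD: "pt D (\<psi>' (val D' t)) \<in> Hom C T D" "val D (pt D (\<psi>' (val D' t))) = \<psi>' (val D' t)" if "t \<in> Hom C T D'" for t
      using pt[OF D d'(4)[OF val_mem[OF d'(1) that]]] .
    have "Comp C T D X e (pt D (\<psi>' (val D' t))) = Comp C T D' X e' t" if t: "t \<in> Hom C T D'" for t
      by (rule val_inj[OF X Comp_Hom[OF T(1) D X kD(1)[OF t] e] Comp_Hom[OF T(1) d'(1) X t e'(1)]])
        (simp only: val_Comp[OF D X e kD(1)[OF t]] val_Comp[OF d'(1) X e'(1) t] kD(2)[OF t] bspec[OF e'(2) val_mem[OF d'(1) t]])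
    then have kh: "\<forall>t\<in>Hom C T D'. Comp C T D X e (pt D (\<psi>' (val D' t))) = Comp C T D' X e' t" by blast
    have "(\<lambda>t. pt D (\<psi>' (val D' t))) \<in> Hom C T D' \<rightarrow> Hom C T D" using kD(1) by blast
    from L.cartesian_ex1[OF cart d'(1) e'(1) this kh]
    obtain m where m: "m \<in> Hom C D' D" "\<forall>t\<in>Hom C T D'. Comp C T D' D m t = pt D (\<psi>' (val D' t))" by (elim ex1E conjE)
    have m_val: "mp D' D m y = \<psi>' y" if y: "y \<in> car D'" for y
    proof -
      note t = pt[OF d'(1) y]
      have "val D (Comp C T D' D m (pt D' y)) = \<psi>' y" unfolding bspec[OF m(2) t(1)] t(2) by (rule pt(2)[OF D d'(4)[OF y]])
      then show ?thesis unfolding val_Comp[OF d'(1) D m(1) t(1)] t(2) .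
    qed
    have "tracked (car D') (ph D') (\<lambda>y. ph D (mp D' D m y))" by (rule mp_tracked[OF d'(1) D m(1)])
    then have "tracked (car D) (\<lambda>y. ph D' (\<theta>' y)) (\<lambda>y. ph D (mp D' D m (\<theta>' y)))" by (rule tracked_reindex) (rule d'(2))
    from tracked_trans[OF c d'(6) this] have "tracked (car D) c (\<lambda>y. ph D (mp D' D m (\<theta>' y)))" by simp
    then have "tracked (car D) c (ph D)"
      by (rule tracked_cong) (simp_all add: m_val d'(2,3))
    from tracked_trans[OF c this mp_tracked[OF D G f]] have tf: "tracked (car D) c (\<lambda>y. ph G (mp D G f y))" by simp
    have "tracked (car D) (\<lambda>y. ph G (mp D G f y)) (\<lambda>y. \<psi> (mp D G f y))" by (rule tracked_reindex[OF d(7) mp_mem[OF D G f]])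
    from tracked_trans[OF c tf this] have "tracked (car D) c (\<lambda>y. \<psi> (mp D G f y))" by simp
    then obtain a where a: "\<forall>y\<in>car D. app a (c y) = Some (\<psi> (mp D G f y))" unfolding tracked_def by (elim bexE)
    \<comment> \<open>Elements of \<open>G\<close> are their own codes up to the representation, so
      a value of \<open>f\<close> that is computed from the code of the image of \<open>y\<close>
      depends on that image alone. This makes the extension independent of
      \<open>\<sigma>\<close>.\<close>
    have f_eq: "mp D G f y = mp D G f y'" if y: "y \<in> car D" "y' \<in> car D" "mp D X e y = mp D X e y'" for y y'
    proof -
      have "\<psi> (mp D G f y) = \<psi> (mp D G f y')" using bspec[OF a y(1)] bspec[OF a y(2)] y(3) unfolding c_def by simp
      then have "\<theta> (\<psi> (mp D G f y)) = \<theta> (\<psi> (mp D G f y'))" by (rule arg_cong)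
      then show ?thesis unfolding d(5)[OF mp_mem[OF D G f y(1)]] d(5)[OF mp_mem[OF D G f y(2)]] .
    qed
    have "tracked (car X) (\<lambda>x. c (\<sigma> x)) (\<lambda>x. ph G (mp D G f (\<sigma> x)))" by (rule tracked_reindex[OF tf \<sigma>(1)])
    then have "tracked (car X) (ph X) (\<lambda>x. ph G (mp D G f (\<sigma> x)))"
      by (rule tracked_cong) (simp_all add: c_def \<sigma>(2))
    then have "\<exists>g\<in>Hom C X G. \<forall>x\<in>car X. mp X G g x = mp D G f (\<sigma> x)"
      by - (rule mp_ex[OF X G mp_mem[OF D G f \<sigma>(1)]])
    then obtain g where g: "g \<in> Hom C X G" "\<forall>x\<in>car X. mp X G g x = mp D G f (\<sigma> x)" by (elim bexE)
    show ?thesis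
    proof (rule ex1I[of _ g], intro conjI g(1))
      show "Comp C D X G g e = f"
      proof (rule mp_eq[OF D G Comp_Hom[OF D X G e g(1)] f])
        fix y assume y: "y \<in> car D"
        note x = mp_mem[OF D X e y]
        show "mp D G (Comp C D X G g e) y = mp D G f y"
          unfolding mp_Comp[OF D X G e g(1) y] bspec[OF g(2) x] by (rule f_eq[OF \<sigma>(1)[OF x] y \<sigma>(2)[OF x]])
      qed
      fix g' assume g': "g' \<in> Hom C X G \<and> Comp C D X G g' e = f"
      show "g' = g"
      proof (rule mp_eq[OF X G conjunct1[OF g'] g(1)])
        fix x assume x: "x \<in> car X"
        have "mp D G (Comp C D X G g' e) (\<sigma> x) = mp X G g x" unfolding conjunct2[OF g'] bspec[OF g(2) x] ..
        then show "mp X G g' x = mp X G g x"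
          unfolding mp_Comp[OF D X G e conjunct1[OF g'] \<sigma>(1)[OF x]] \<sigma>(2)[OF x] .
      qed
    qed
  qed
  have disc: "discrete_object C T N \<eta> G"
    unfolding discrete_object_def L.closed_iff by (intro conjI ballI impI G ext) auto
  show ?thesis using G sep disc gen by blast
qed

text \<open>
  The weak dependent product of \<open>b : B \<rightarrow> J\<close> along \<open>u : J \<rightarrow> I\<close> consists of the triples \<open>(i, f, e)\<close>
  of an element \<open>i\<close> of \<open>I\<close>, a section \<open>f\<close> of \<open>b\<close> over the fibre of \<open>u\<close> at \<open>i\<close>, and a code \<open>e\<close>
  tracking \<open>f\<close>.
\<close>

lemma weakly_locally_cartesian_closed: "weakly_locally_cartesian_closed C"
proof -
  interpret lex_category C by unfold_locales (rule has_finite_limits)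
  show ?thesis
  proof (rule weakly_locally_cartesian_closedI)
    fix B J I b u
    assume B: "B \<in> Obj C" and J: "J \<in> Obj C" and I: "I \<in> Obj C" and b: "b \<in> Hom C B J" and u: "u \<in> Hom C J I"
    define fib where "fib i = {j \<in> car J. mp J I u j = i}" for i
    define S where "S = {(i, f, e). i \<in> car I \<and> f \<in> fib i \<rightarrow>\<^sub>E car B \<and> e \<in> A \<and>
      (\<forall>j\<in>fib i. mp B J b (f j) = j \<and> app e (ph J j) = Some (ph B (f j)))}"
    have fib: "j \<in> car J" "mp J I u j = i" if "j \<in> fib i" for i j using that unfolding fib_def by auto
    have small_fib: "small U (fib i)" for i by (rule small_subset[OF small_U[OF car_U[OF J]]]) (auto simp: fib_def)
    have "small U (SIGMA i:car I. (fib i \<rightarrow>\<^sub>E car B) \<times> A)"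
      by (rule small_Sigma[OF small_U[OF car_U[OF I]]
            small_Times[OF small_PiE[OF small_fib small_U[OF car_U[OF B]]] small_U[OF A_U]]])
    then have small: "small U S" by (rule small_subset) (auto simp: S_def)
    \<comment> \<open>The section \<open>f\<close> is not coded directly; \<open>e\<close>
      determines the codes of its values.\<close>
    define c where "c = (\<lambda>(i, f :: 'u \<Rightarrow> 'u, e). pr (ph I i) e)"
    have S_mem: "ph I (fst s) \<in> A" "snd (snd s) \<in> A" "fst s \<in> car I" if "s \<in> S" for s
      using that ph_mem[OF I] unfolding S_def by auto
    have c: "c s \<in> A" if "s \<in> S" for s
      using pr(2)[OF S_mem(1,2)[OF that]] unfolding c_def by (simp add: split_beta)
    obtain R \<theta> \<psi> where rep: "represents R S c \<theta> \<psi>" using ex_represents[OF small c] .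
    note R = representsD(1)[OF rep] and d = representsD[OF rep]
    have c1: "tracked S c (\<lambda>s. ph I (fst s))"
      by (rule tracked_cong[OF tracked_fst[OF S_mem(1,2)]]) (auto simp: c_def)
    have c2: "tracked S c (\<lambda>s. snd (snd s))"
      by (rule tracked_cong[OF tracked_snd[OF S_mem(1,2)]]) (auto simp: c_def)
    have "\<exists>r\<in>Hom C R I. \<forall>z\<in>car R. mp R I r z = fst (\<psi> z)"
      by (rule represents_out[OF rep I S_mem(3) c1])
    then obtain r where r: "r \<in> Hom C R I" "\<forall>z\<in>car R. mp R I r z = fst (\<psi> z)" by (elim bexE)
    have "\<exists>w\<in>Hom C P B. Comp C P B J b w = p \<and> (\<forall>X x P' p' q' m.
        is_pullback C P' J X I p' q' u x \<and> m \<in> Hom C P' B \<and> Comp C P' B J b m = p' \<longrightarrow>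
        (\<exists>k\<in>Hom C X R. Comp C X R I r k = x \<and> (\<forall>n\<in>Hom C P' P. Comp C P' P J p n = p' \<and>
          Comp C P' P R q n = Comp C P' X R k q' \<longrightarrow> Comp C P' P B w n = m)))"
      if pb: "is_pullback C P J R I p q u r" for P p q
    proof -
      note dP = pullbackD[OF pb]
      note P = dP(1) and p = dP(5) and q = dP(6)
      \<comment> \<open>Evaluation: a point of \<open>P\<close> amounts to some \<open>j\<close> and
        a triple over the image of \<open>j\<close>. The value is the section at \<open>j\<close>,
        and its code is obtained by applying the code \<open>we\<close> of the section to the code
        of \<open>j\<close>.\<close>
      define wf where "wf z = fst (snd (\<psi> (mp P R q z))) (mp P J p z)" for z
      define we where "we z = snd (snd (\<psi> (mp P R q z)))" for z
      have \<psi>S: "\<psi> (mp P R q z) \<in> S" if "z \<in> car P" for z using d(4)[OF mp_mem[OF P R q that]] .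
      have pf: "mp P J p z \<in> fib (fst (\<psi> (mp P R q z)))" if z: "z \<in> car P" for z
      proof -
        have "mp J I u (mp P J p z) = mp R I r (mp P R q z)"
          unfolding mp_Comp[OF P J I p u z, symmetric] mp_Comp[OF P R I q r(1) z, symmetric] dP(9) ..
        then show ?thesis unfolding fib_def using mp_mem[OF P J p z] bspec[OF r(2) mp_mem[OF P R q z]] by simp
      qed
      have wf: "wf z \<in> car B \<and> mp B J b (wf z) = mp P J p z \<and> app (we z) (ph J (mp P J p z)) = Some (ph B (wf z)) \<and> we z \<in> A"
        if z: "z \<in> car P" for z
      proof -
        obtain i f e where s: "\<psi> (mp P R q z) = (i, f, e)" by (cases "\<psi> (mp P R q z)")
        show ?thesis using \<psi>S[OF z] pf[OF z] unfolding wf_def we_def s S_def by auto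
      qed
      have tq: "tracked (car P) (ph P) (\<lambda>z. ph R (mp P R q z))" by (rule mp_tracked[OF P R q])
      have "tracked (car P) (\<lambda>z. ph R (mp P R q z)) (\<lambda>z. c (\<psi> (mp P R q z)))"
        by (rule tracked_reindex[OF d(7) mp_mem[OF P R q]])
      from tracked_trans[OF _ tq this] ph_mem[OF P] have t1: "tracked (car P) (ph P) (\<lambda>z. c (\<psi> (mp P R q z)))" by blast
      have "tracked (car P) (\<lambda>z. c (\<psi> (mp P R q z))) we"
        unfolding we_def[abs_def] by (rule tracked_reindex[OF c2 \<psi>S])
      from tracked_trans[OF _ t1 this] ph_mem[OF P] have t2: "tracked (car P) (ph P) we" by blast
      have t3: "tracked (car P) (ph P) (\<lambda>z. pr (we z) (ph J (mp P J p z)))"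
        by (rule tracked_pr[OF _ t2 mp_tracked[OF P J p]]) (rule ph_mem[OF P])
      have "tracked (car P) (\<lambda>z. pr (we z) (ph J (mp P J p z))) (\<lambda>z. ph B (wf z))"
        by (rule tracked_app) (simp_all add: wf ph_mem[OF J mp_mem[OF P J p]])
      from tracked_trans[OF _ t3 this] ph_mem[OF P] have "tracked (car P) (ph P) (\<lambda>z. ph B (wf z))" by blast
      then have "\<exists>w\<in>Hom C P B. \<forall>z\<in>car P. mp P B w z = wf z"
        by - (rule mp_ex[OF P B], use wf in simp)
      then obtain w where w: "w \<in> Hom C P B" "\<forall>z\<in>car P. mp P B w z = wf z" by (elim bexE)
      have bw: "Comp C P B J b w = p"
        by (rule mp_eq[OF P J Comp_Hom[OF P B J w(1) b] p])
          (simp add: mp_Comp[OF P B J w(1) b] bspec[OF w(2)] wf)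
      have "\<exists>k\<in>Hom C X R. Comp C X R I r k = x \<and> (\<forall>n\<in>Hom C P' P. Comp C P' P J p n = p' \<and>
          Comp C P' P R q n = Comp C P' X R k q' \<longrightarrow> Comp C P' P B w n = m)"
        if pb': "is_pullback C P' J X I p' q' u x" and m: "m \<in> Hom C P' B" and bm: "Comp C P' B J b m = p'"
        for X x P' p' q' m
      proof -
        note dP' = pullbackD[OF pb']
        note P' = dP'(1) and X = dP'(3) and p' = dP'(5) and q' = dP'(6) and x = dP'(8)
        note pbd = pullback_description[OF pb']
        \<comment> \<open>The points of \<open>P'\<close> presented as pairs, which
          \<open>pullback_description\<close> allows; \<open>\<zeta>\<close> leads back from pairs
          to points.\<close>
        define Z where "Z = {(j, y). y \<in> car X \<and> j \<in> fib (mp X I x y)}"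
        define \<zeta> where "\<zeta> s = (SOME z. z \<in> car P' \<and> mp P' J p' z = fst s \<and> mp P' X q' z = snd s)" for s
        have \<zeta>: "\<zeta> (j, y) \<in> car P'" "mp P' J p' (\<zeta> (j, y)) = j" "mp P' X q' (\<zeta> (j, y)) = y"
          if jy: "(j, y) \<in> Z" for j y
        proof -
          have "y \<in> car X" "j \<in> car J" "mp J I u j = mp X I x y" using jy fib unfolding Z_def by auto
          from pbd(1)[OF this(2,1,3)] have "\<exists>z. z \<in> car P' \<and> mp P' J p' z = fst (j, y) \<and> mp P' X q' z = snd (j, y)"
            unfolding fst_conv snd_conv Bex_def .
          from someI_ex[OF this] show "\<zeta> (j, y) \<in> car P'" "mp P' J p' (\<zeta> (j, y)) = j" "mp P' X q' (\<zeta> (j, y)) = y"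
            unfolding \<zeta>_def fst_conv snd_conv by auto
        qed
        have in_Z: "(mp P' J p' z, mp P' X q' z) \<in> Z" if z: "z \<in> car P'" for z
        proof -
          have "mp J I u (mp P' J p' z) = mp X I x (mp P' X q' z)"
            unfolding mp_Comp[OF P' J I p' u z, symmetric] mp_Comp[OF P' X I q' x z, symmetric] dP'(9) ..
          then show ?thesis unfolding Z_def fib_def using mp_mem[OF P' J p' z] mp_mem[OF P' X q' z] by simp
        qed
        have \<zeta>_eq: "\<zeta> (mp P' J p' z, mp P' X q' z) = z" if z: "z \<in> car P'" for z
          by (rule pbd(2)[OF \<zeta>(1)[OF in_Z[OF z]] z \<zeta>(2)[OF in_Z[OF z]] \<zeta>(3)[OF in_Z[OF z]]])
        have Z_mem: "ph J (fst s) \<in> A" "ph X (snd s) \<in> A" "\<zeta> s \<in> car P'" if "s \<in> Z" for s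
          using that \<zeta>(1) fib(1) ph_mem[OF J] ph_mem[OF X] unfolding Z_def by auto
        have "tracked Z (\<lambda>s. pr (ph J (mp P' J p' (\<zeta> s))) (ph X (mp P' X q' (\<zeta> s)))) (\<lambda>s. ph P' (\<zeta> s))"
          by (rule tracked_reindex[OF pbd(3) Z_mem(3)])
        then have t1: "tracked Z (\<lambda>s. pr (ph J (fst s)) (ph X (snd s))) (\<lambda>s. ph P' (\<zeta> s))"
          by (rule tracked_cong) (auto simp: \<zeta>(2,3))
        have t2: "tracked Z (\<lambda>s. ph P' (\<zeta> s)) (\<lambda>s. ph B (mp P' B m (\<zeta> s)))"
          by (rule tracked_reindex[OF mp_tracked[OF P' B m] Z_mem(3)])
        have pr_mem: "pr (ph X (snd s)) (ph J (fst s)) \<in> A" if "s \<in> Z" for s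
          using pr(2) Z_mem that by blast
        \<comment> \<open>Currying takes the code of \<open>y\<close> first, because the code of the
          section must be computed from it while \<open>j\<close> is left open.\<close>
        have swap: "tracked Z (\<lambda>s. pr (ph X (snd s)) (ph J (fst s))) (\<lambda>s. pr (ph J (fst s)) (ph X (snd s)))"
          by (rule tracked_pr[OF pr_mem tracked_snd[OF Z_mem(2,1)] tracked_fst[OF Z_mem(2,1)]])
        have t3: "tracked Z (\<lambda>s. pr (ph X (snd s)) (ph J (fst s))) (\<lambda>s. ph B (mp P' B m (\<zeta> s)))"
          by (rule tracked_trans[OF pr_mem tracked_trans[OF pr_mem swap t1] t2])
        obtain e0 g where e0: "e0 \<in> A" and g: "\<forall>a\<in>A. g a \<in> A \<and> app e0 a = Some (g a)"
          and app_g: "\<forall>s\<in>Z. app (g (ph X (snd s))) (ph J (fst s)) = Some (ph B (mp P' B m (\<zeta> s)))"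
          using tracked_curry[OF Z_mem(2,1) t3] by blast
        \<comment> \<open>The section assigned to \<open>y\<close> sends \<open>j\<close> to
          \<open>m\<close> at the point of \<open>P'\<close> over \<open>j\<close> and
          \<open>y\<close>, and the curried realizer provides its code
          \<open>g (ph X y)\<close>.\<close>
        define k where "k y = (mp X I x y, (\<lambda>j\<in>fib (mp X I x y). mp P' B m (\<zeta> (j, y))), g (ph X y))" for y
        have kS: "k y \<in> S" if y: "y \<in> car X" for y
        proof -
          have Zj: "(j, y) \<in> Z" if "j \<in> fib (mp X I x y)" for j using that y unfolding Z_def by simp
          have "mp P' B m (\<zeta> (j, y)) \<in> car B \<and> mp B J b (mp P' B m (\<zeta> (j, y))) = j \<and>
              app (g (ph X y)) (ph J j) = Some (ph B (mp P' B m (\<zeta> (j, y))))" if j: "j \<in> fib (mp X I x y)" for j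
          proof (intro conjI)
            note z = \<zeta>(1)[OF Zj[OF j]]
            show "mp P' B m (\<zeta> (j, y)) \<in> car B" by (rule mp_mem[OF P' B m z])
            show "mp B J b (mp P' B m (\<zeta> (j, y))) = j"
              unfolding mp_Comp[OF P' B J m b z, symmetric] bm by (rule \<zeta>(2)[OF Zj[OF j]])
            show "app (g (ph X y)) (ph J j) = Some (ph B (mp P' B m (\<zeta> (j, y))))"
              using bspec[OF app_g Zj[OF j]] by simp
          qed
          then show ?thesis unfolding S_def k_def using mp_mem[OF X I x y] bspec[OF g ph_mem[OF X y]] by simp
        qed
        have "tracked (car X) (ph X) (\<lambda>y. g (ph X y))"
          unfolding tracked_def using e0 g ph_mem[OF X] by blast
        then have "tracked (car X) (ph X) (\<lambda>y. pr (ph I (mp X I x y)) (g (ph X y)))"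
          by - (rule tracked_pr[OF _ mp_tracked[OF X I x]], rule ph_mem[OF X])
        then have "tracked (car X) (ph X) (\<lambda>y. c (k y))" unfolding c_def k_def by simp
        then have "\<exists>h\<in>Hom C X R. \<forall>y\<in>car X. mp X R h y = \<theta> (k y)"
          by - (rule represents_in[OF rep X kS])
        then obtain h where h: "h \<in> Hom C X R" "\<forall>y\<in>car X. mp X R h y = \<theta> (k y)" by (elim bexE)
        show ?thesis
        proof (rule bexI[OF _ h(1)], intro conjI ballI impI)
          show "Comp C X R I r h = x"
          proof (rule mp_eq[OF X I Comp_Hom[OF X R I h(1) r(1)] x])
            fix y assume y: "y \<in> car X"
            show "mp X I (Comp C X R I r h) y = mp X I x y"
              unfolding mp_Comp[OF X R I h(1) r(1) y] bspec[OF h(2) y] bspec[OF r(2) d(2)[OF kS[OF y]]] d(3)[OF kS[OF y]]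
              by (simp add: k_def)
          qed
          fix n assume n: "n \<in> Hom C P' P" and eq: "Comp C P' P J p n = p' \<and> Comp C P' P R q n = Comp C P' X R h q'"
          show "Comp C P' P B w n = m"
          proof (rule mp_eq[OF P' B Comp_Hom[OF P' P B n w(1)] m])
            fix z assume z: "z \<in> car P'"
            note nz = mp_mem[OF P' P n z] and y = mp_mem[OF P' X q' z]
            have pn: "mp P J p (mp P' P n z) = mp P' J p' z"
              unfolding mp_Comp[OF P' P J n p z, symmetric] conjunct1[OF eq] ..
            have qn: "mp P R q (mp P' P n z) = \<theta> (k (mp P' X q' z))"
              unfolding mp_Comp[OF P' P R n q z, symmetric] conjunct2[OF eq] mp_Comp[OF P' X R q' h(1) z]
              by (rule bspec[OF h(2) y])
            have "mp P' B (Comp C P' P B w n) z = wf (mp P' P n z)"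
              unfolding mp_Comp[OF P' P B n w(1) z] by (rule bspec[OF w(2) nz])
            also have "\<dots> = mp P' B m (\<zeta> (mp P' J p' z, mp P' X q' z))"
              unfolding wf_def pn qn d(3)[OF kS[OF y]] using in_Z[OF z] unfolding k_def Z_def by simp
            finally show "mp P' B (Comp C P' P B w n) z = mp P' B m z" unfolding \<zeta>_eq[OF z] .
          qed
        qed
      qed
      then show ?thesis using w(1) bw by blast
    qed
    then show "\<exists>R\<in>Obj C. \<exists>r\<in>Hom C R I. \<forall>P p q. is_pullback C P J R I p q u r \<longrightarrow>
      (\<exists>w\<in>Hom C P B. Comp C P B J b w = p \<and> (\<forall>X x P' p' q' m.
        is_pullback C P' J X I p' q' u x \<and> m \<in> Hom C P' B \<and> Comp C P' B J b m = p' \<longrightarrow>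
        (\<exists>k\<in>Hom C X R. Comp C X R I r k = x \<and> (\<forall>n\<in>Hom C P' P. Comp C P' P J p n = p' \<and>
          Comp C P' P R q n = Comp C P' X R k q' \<longrightarrow> Comp C P' P B w n = m))))"
      using R r(1) by blast
  qed
qed

end

theorem corollary3p9:
  fixes U :: "'u set set" and C :: "('o, 'u) cat"
  assumes "universe U" and "category C"
  shows "(\<exists>A app. A \<in> U \<and> pca A app \<and> equivalent_categories C (PAsm U A app)) \<longleftrightarrow>
    weakly_locally_cartesian_closed C \<and>
    (\<exists>T N \<eta> \<epsilon>. local_category U C T N \<eta> \<epsilon> \<and>
      (\<exists>G\<in>Obj C. separated_object C T N \<eta> G \<and> discrete_object C T N \<eta> G \<and>
        generic_object C T N \<eta> G))"
proof
  assume "\<exists>A app. A \<in> U \<and> pca A app \<and> equivalent_categories C (PAsm U A app)"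
  then obtain A app where A: "A \<in> U" "pca A app" and "equivalent_categories C (PAsm U A app)" by blast
  from equivalence_imp_ff[OF this(3)] obtain F where F: "is_functor C (PAsm U A app) F"
    "fully_faithful C (PAsm U A app) F" "essentially_surjective C (PAsm U A app) F" by blast
  interpret PAsm_equivalent U C A app F
    using assms A F by (simp add: PAsm_equivalent_def set_universe_def pca_structure_def PAsm_equivalent_axioms_def)
  show "weakly_locally_cartesian_closed C \<and>
    (\<exists>T N \<eta> \<epsilon>. local_category U C T N \<eta> \<epsilon> \<and>
      (\<exists>G\<in>Obj C. separated_object C T N \<eta> G \<and> discrete_object C T N \<eta> G \<and>
        generic_object C T N \<eta> G))"
    using weakly_locally_cartesian_closed ex_local_structure ex_generic by blast
next
  assume "weakly_locally_cartesian_closed C \<and>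
    (\<exists>T N \<eta> \<epsilon>. local_category U C T N \<eta> \<epsilon> \<and>
      (\<exists>G\<in>Obj C. separated_object C T N \<eta> G \<and> discrete_object C T N \<eta> G \<and>
        generic_object C T N \<eta> G))"
  then obtain T N \<eta> \<epsilon> G where wlcc: "weakly_locally_cartesian_closed C" and loc: "local_category U C T N \<eta> \<epsilon>"
    and G: "separated_object C T N \<eta> G" "discrete_object C T N \<eta> G" "generic_object C T N \<eta> G" by blast
  have lim: "has_finite_limits C" using wlcc unfolding weakly_locally_cartesian_closed_def by blast
  interpret category C by fact
  interpret sdg_category U C T N \<eta> \<epsilon> G
    by unfold_locales (fact assms(1) lim loc wlcc G)+
  show "\<exists>A app. A \<in> U \<and> pca A app \<and> equivalent_categories C (PAsm U A app)"
    by (rule ex_equivalent_PAsm)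
qed

end
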